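(* Let $F(t,x,u,v)$ be a function on a neighborhood $\Delta$ of the origin of $\mathbb{C}_t\times\mathbb{C}_x\times\mathbb{C}_u\times\mathbb{C}_v$, and set $\Delta_0=\Delta\cap\{t=0,u=0,v=0\}$. Suppose that $F$ is holomorphic in $\Delta$, that $F(0,x,0,0)\equiv0$ in $\Delta_0$, that $\frac{\partial F}{\partial v}(0,x,0,0)\equiv0$ in $\Delta_0$, and that $\mathrm{Re}\,\lambda(0)<0$, where $\lambda(x)=\frac{\partial F}{\partial u}(0,x,0,0)$. Let $u(t,x)$ be a holomorphic solution of $$t\frac{\partial u}{\partial t}=F\Bigl(t,x,u,\frac{\partial u}{\partial x}\Bigr)$$ in a neighborhood of $(0,\sigma_0)\times D_{R_0}$ for some $\sigma_0>0$ and $R_0>0$. If $$\varlimsup_{R\to+0}\Bigl[\lim_{\sigma\to+0}\Bigl(\frac{1}{R^2}\sup_{(0,\sigma)\times D_R}|u(t,x)|\Bigr)\Bigr]=0,$$ then $u(t,x)$ can be continued holomorphically up to a neighborhood of $(0,0)\in\mathbb{C}_t\times\mathbb{C}_x$.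
   Context: $D_r=\{z\in\mathbb{C}: |z|<r\}$. The interval $(0,\sigma_0)$ is a real interval, regarded as a subset of $\mathbb{C}_t$; the suprema are over real $t\in(0,\sigma)$ and complex $x\in D_R$. A solution is understood to satisfy $(t,x,u(t,x),\partial u/\partial x(t,x))\in\Delta$. "$u$ can be continued holomorphically up to a neighborhood of $(0,0)$" means: there are an open neighborhood $V$ of $(0,0)$ in $\mathbb{C}_t\times\mathbb{C}_x$ and a holomorphic function on $V$ that coincides with $u$ on $(0,T_1)\times D_{R_1}$ for some $T_1>0$, $R_1>0$. *)

theory Defs
  imports "HOL-Complex_Analysis.Complex_Analysis"
begin

(* Holomorphy in several variables is complex Frechet differentiability at every point of an
   open set: the real derivative of the library is required to be complex linear. *)

definition holomorphic2_on :: "(complex \<times> complex \<Rightarrow> complex) \<Rightarrow> (complex \<times> complex) set \<Rightarrow> bool"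
    (infixl "holomorphic2'_on" 50) where
  "f holomorphic2_on S \<longleftrightarrow>
     open S \<and>
     (\<forall>p\<in>S. \<exists>a b. (f has_derivative (\<lambda>(h, k). a * h + b * k)) (at p))"

definition holomorphic4_on ::
    "(complex \<times> complex \<times> complex \<times> complex \<Rightarrow> complex) \<Rightarrow>
     (complex \<times> complex \<times> complex \<times> complex) set \<Rightarrow> bool"
    (infixl "holomorphic4'_on" 50) where
  "f holomorphic4_on S \<longleftrightarrow>
     open S \<and>
     (\<forall>p\<in>S. \<exists>a b c d.
        (f has_derivative (\<lambda>(h, k, l, m). a * h + b * k + c * l + d * m)) (at p))"

definition dF_du ::
    "(complex \<times> complex \<times> complex \<times> complex \<Rightarrow> complex) \<Rightarrow>
     complex \<times> complex \<times> complex \<times> complex \<Rightarrow> complex" where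
  "dF_du F = (\<lambda>(t, x, u, v). deriv (\<lambda>w. F (t, x, w, v)) u)"

definition dF_dv ::
    "(complex \<times> complex \<times> complex \<times> complex \<Rightarrow> complex) \<Rightarrow>
     complex \<times> complex \<times> complex \<times> complex \<Rightarrow> complex" where
  "dF_dv F = (\<lambda>(t, x, u, v). deriv (\<lambda>w. F (t, x, u, w)) v)"

definition du_dt :: "(complex \<times> complex \<Rightarrow> complex) \<Rightarrow> complex \<times> complex \<Rightarrow> complex" where
  "du_dt u = (\<lambda>(t, x). deriv (\<lambda>s. u (s, x)) t)"

definition du_dx :: "(complex \<times> complex \<Rightarrow> complex) \<Rightarrow> complex \<times> complex \<Rightarrow> complex" where
  "du_dx u = (\<lambda>(t, x). deriv (\<lambda>y. u (t, y)) x)"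

(* (0, \<sigma>) \<times> D_R, the real interval being regarded as a subset of the complex t-plane *)
definition seg_disc :: "real \<Rightarrow> real \<Rightarrow> (complex \<times> complex) set" where
  "seg_disc \<sigma> R = complex_of_real ` {0<..<\<sigma>} \<times> ball 0 R"

definition holomorphic_solution ::
    "(complex \<times> complex \<times> complex \<times> complex) set \<Rightarrow>
     (complex \<times> complex \<times> complex \<times> complex \<Rightarrow> complex) \<Rightarrow>
     (complex \<times> complex) set \<Rightarrow> (complex \<times> complex \<Rightarrow> complex) \<Rightarrow> bool" where
  "holomorphic_solution \<Delta> F W u \<longleftrightarrow>
     u holomorphic2_on W \<and>
     (\<forall>(t, x)\<in>W. (t, x, u (t, x), du_dx u (t, x)) \<in> \<Delta> \<and>
                 t * du_dt u (t, x) = F (t, x, u (t, x), du_dx u (t, x)))"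

(* The supremum is taken in the extended reals, so an unbounded u yields \<infinity>. It is monotone
   in \<sigma>, so that the limit always exists and Lim denotes it. *)
definition scaled_sup_limit :: "(complex \<times> complex \<Rightarrow> complex) \<Rightarrow> real \<Rightarrow> ereal" where
  "scaled_sup_limit u R =
     Lim (at_right 0) (\<lambda>\<sigma>::real. ereal (1 / R\<^sup>2) * (SUP p\<in>seg_disc \<sigma> R. ereal (cmod (u p))))"

(* W is the domain of u. *)
definition continues_to_origin ::
    "(complex \<times> complex) set \<Rightarrow> (complex \<times> complex \<Rightarrow> complex) \<Rightarrow> bool" where
  "continues_to_origin W u \<longleftrightarrow>
     (\<exists>V w. (0, 0) \<in> V \<and> w holomorphic2_on V \<and>
        (\<exists>T\<^sub>1>0. \<exists>R\<^sub>1>0. seg_disc T\<^sub>1 R\<^sub>1 \<subseteq> V \<inter> W \<and> (\<forall>p\<in>seg_disc T\<^sub>1 R\<^sub>1. w p = u p)))"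

end

(* Write F = a(x) t + lam(x) u + P(t,x,u,v), where P vanishes to second order at t = u = v = 0.

   Existence.  A holomorphic solution w with w(0,x) = 0 is found by Picard iteration on
   w = t U(x) + z, U = a/(1 - lam), solving t z'_t - lam z' = P(t, x, tU + z, tU' + z_x) at each step.
   On the conical domain A|t| + |x| < R with gap d = R - |x| - A|t| the bounds |z|, |z_x| <= |t|,
   |z_xx| <= |t| d^(-1/2) reproduce themselves for large A: integrating d^(-3/2) along the ray
   towards t = 0 gains a power of d and a factor 1/A, which pays for the Cauchy estimate.

   Uniqueness.  The difference v = u - w satisfies |t v_t - lam v| <= K N (|v| + |v_x|) when N bounds
   |t|, u, w and their x-derivatives.  Since Re lam < 0, a maximum principle along the characteristics
   gives |v(t,.)| <= (t0/t)^c sup |v(t0,.)| at the cost of shrinking the disc by about K N / (t0/t).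
   The growth hypothesis with one sufficiently small constant starts an iteration with t0/t fixed, over
   discs shrinking to half the radius, in which |v| drops by 4 while t is halved, so v = O(t).
   Then the total drift is finite, t0 can tend to 0, and v = 0. *)

theory Submission imports Defs begin

section \<open>Holomorphic functions of two variables\<close>

text \<open>The weight 1/R^2 is the scale at which the problem is invariant. If |v| <= eps s^2 on a
  disc of radius s, Cauchy's estimate gives |v_x| = O(eps s) on a smaller one; since P is quadratic,
  the coefficient of v_x in the equation of the difference is O(eps s) as well, and while t grows by
  a fixed factor the characteristics drift by O(eps s), a small fraction of s. The obstacle is the
  loss of one x-derivative in P(t,x,u,u_x). The invariant bounds on the cone do not by themselves
  give convergence of the iterates; this needs a second estimate with growing powers of the distance
  to the boundary. In the uniqueness proof v = O(t) has to be reached before t0 may tend to 0,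
  because only then is the coefficient of v_x of order t. The sign of Re lam enters three times: j -
  lam stays away from 0 for j = 0, 1, 2, ..., so power series in t can be solved termwise; s^(-lam)
  tends to 0 with s, so integration along a ray needs no initial value; and the linear part decays
  as t grows, so that v near t = 0 controls v at later t.\<close>

text \<open>Cauchy's inequality on the circles of radius \<open>s < r\<close>, after which
  \<open>s\<close> tends to \<open>r\<close>: the full factor \<open>1 / r\<close> is kept although
  \<open>f\<close> is given on the open disc only.\<close>

lemma deriv_norm_le:
  assumes "f holomorphic_on ball z r" "r > 0" and B: "\<And>w. w \<in> ball z r \<Longrightarrow> cmod (f w) \<le> B"
  shows "cmod (deriv f z) \<le> B / r"
proof -
  have "s * cmod (deriv f z) \<le> B" if "0 < s" "s < r" for s
  proof -
    have "cmod ((deriv ^^ 1) f z) \<le> fact 1 * B / s ^ 1"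
    proof (rule Cauchy_inequality)
      show "f holomorphic_on ball z s" "continuous_on (cball z s) f"
        using assms(1) that by (auto intro!: holomorphic_on_imp_continuous_on elim!: holomorphic_on_subset)
      show "cmod (f x) \<le> B" if "cmod (z - x) = s" for x
        using that \<open>s < r\<close> by (intro B) (auto simp: dist_norm)
    qed (use that in auto)
    then show ?thesis using that by (simp add: field_simps)
  qed
  then have "r * cmod (deriv f z) \<le> B"
  proof (cases "deriv f z = 0")
    case True
    have "cmod (f z) \<le> B" using B \<open>r > 0\<close> by simp
    then show ?thesis using True norm_ge_zero[of "f z"] by (simp del: norm_ge_zero)
  next
    case False
    then have pos: "cmod (deriv f z) > 0" by simp
    have "r \<le> B / cmod (deriv f z)"
      by (rule dense_le_bounded[OF \<open>r > 0\<close>])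
        (use \<open>\<And>s. 0 < s \<Longrightarrow> s < r \<Longrightarrow> s * cmod (deriv f z) \<le> B\<close> pos in \<open>auto simp: field_simps\<close>)
    then show ?thesis using pos by (simp add: field_simps)
  qed
  then show ?thesis using \<open>r > 0\<close> by (simp add: field_simps)
qed

text \<open>Cauchy's estimate at distance \<open>r\<close> from the boundary, then the mean value
  inequality. This is how the Lipschitz constants of \<open>P\<close> come out of a bound on
  \<open>P\<close>.\<close>

lemma lipschitz_of_bounded:
  assumes "f holomorphic_on ball 0 (R + r)" "r > 0" and B: "\<And>w. w \<in> ball 0 (R + r) \<Longrightarrow> cmod (f w) \<le> B"
    and "cmod a \<le> R" "cmod b \<le> R"
  shows "cmod (f a - f b) \<le> B / r * cmod (a - b)"
proof (rule field_differentiable_bound[of "cball 0 R" _ "deriv f"])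
  fix z :: complex assume "z \<in> cball 0 R"
  then have sub: "ball z r \<subseteq> ball 0 (R + r)"
    by (auto simp: dist_norm) (smt (verit) norm_triangle_sub norm_minus_commute)
  show "(f has_field_derivative deriv f z) (at z within cball 0 R)"
    using \<open>z \<in> cball 0 R\<close> \<open>r > 0\<close>
    by (intro has_field_derivative_at_within[OF holomorphic_derivI[OF assms(1)]]) auto
  show "cmod (deriv f z) \<le> B / r"
    using sub \<open>r > 0\<close> by (intro deriv_norm_le B holomorphic_on_subset[OF assms(1)]) auto
qed (use assms in auto)

lemma holo2_partials:
  assumes "f holomorphic2_on S" "(t, x) \<in> S"
  shows "((\<lambda>s. f (s, x)) has_field_derivative du_dt f (t, x)) (at t)"
    and "((\<lambda>y. f (t, y)) has_field_derivative du_dx f (t, x)) (at x)"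
proof -
  obtain a b where ab: "(f has_derivative (\<lambda>(h, k). a * h + b * k)) (at (t, x))"
    using assms unfolding holomorphic2_on_def by blast
  have "((\<lambda>s. (s, x)) has_derivative (\<lambda>h. (h, 0))) (at t)"
    by (auto intro!: derivative_eq_intros)
  from has_derivative_compose[OF this ab]
  have 1: "((\<lambda>s. f (s, x)) has_field_derivative a) (at t)"
    by (simp add: has_field_derivative_def)
  then show "((\<lambda>s. f (s, x)) has_field_derivative du_dt f (t, x)) (at t)"
    by (simp add: du_dt_def DERIV_imp_deriv)
  have "((\<lambda>y. (t, y)) has_derivative (\<lambda>h. (0, h))) (at x)"
    by (auto intro!: derivative_eq_intros)
  from has_derivative_compose[OF this ab]
  have 1: "((\<lambda>y. f (t, y)) has_field_derivative b) (at x)"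
    by (simp add: has_field_derivative_def)
  then show "((\<lambda>y. f (t, y)) has_field_derivative du_dx f (t, x)) (at x)"
    by (simp add: du_dx_def DERIV_imp_deriv)
qed

lemma holo2_has_derivative:
  assumes "f holomorphic2_on S" "(t, x) \<in> S"
  shows "(f has_derivative (\<lambda>(h, k). du_dt f (t, x) * h + du_dx f (t, x) * k)) (at (t, x))"
proof -
  obtain a b where ab: "(f has_derivative (\<lambda>(h, k). a * h + b * k)) (at (t, x))"
    using assms unfolding holomorphic2_on_def by blast
  have "((\<lambda>s. (s, x)) has_derivative (\<lambda>h. (h, 0))) (at t)" "((\<lambda>y. (t, y)) has_derivative (\<lambda>h. (0, h))) (at x)"
    by (auto intro!: derivative_eq_intros)
  from has_derivative_compose[OF this(1) ab] has_derivative_compose[OF this(2) ab]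
  have "((\<lambda>s. f (s, x)) has_field_derivative a) (at t)" "((\<lambda>y. f (t, y)) has_field_derivative b) (at x)"
    by (simp_all add: has_field_derivative_def)
  then have "a = du_dt f (t, x)" "b = du_dx f (t, x)"
    using holo2_partials[OF assms] DERIV_unique by blast+
  then show ?thesis using ab by simp
qed

lemma holo2_diff_partials:
  assumes "f holomorphic2_on S" "g holomorphic2_on S" "p \<in> S"
  shows "du_dt (\<lambda>p. f p - g p) p = du_dt f p - du_dt g p"
    and "du_dx (\<lambda>p. f p - g p) p = du_dx f p - du_dx g p"
proof -
  obtain t x where p: "p = (t, x)" by (cases p)
  note f = holo2_partials[OF assms(1) assms(3)[unfolded p]] and g = holo2_partials[OF assms(2) assms(3)[unfolded p]]
  show "du_dt (\<lambda>p. f p - g p) p = du_dt f p - du_dt g p"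
    using DERIV_imp_deriv[OF DERIV_diff[OF f(1) g(1)]] by (simp add: du_dt_def p)
  show "du_dx (\<lambda>p. f p - g p) p = du_dx f p - du_dx g p"
    using DERIV_imp_deriv[OF DERIV_diff[OF f(2) g(2)]] by (simp add: du_dx_def p)
qed

lemma holo2_continuous: "f holomorphic2_on S \<Longrightarrow> continuous_on S f"
  unfolding holomorphic2_on_def
  by (metis continuous_at_imp_continuous_on has_derivative_continuous)

lemma open_contains_bidisc:
  fixes S :: "('a::metric_space \<times> 'b::metric_space) set"
  assumes "open S" "(t, x) \<in> S"
  obtains r where "r > 0" "cball t r \<times> cball x r \<subseteq> S"
proof -
  obtain A B where "open A" "open B" "t \<in> A" "x \<in> B" "A \<times> B \<subseteq> S"
    using open_prod_elim[OF assms] by (metis mem_Sigma_iff)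
  moreover obtain r1 where "r1 > 0" "cball t r1 \<subseteq> A"
    using \<open>open A\<close> \<open>t \<in> A\<close> open_contains_cball by blast
  moreover obtain r2 where "r2 > 0" "cball x r2 \<subseteq> B"
    using \<open>open B\<close> \<open>x \<in> B\<close> open_contains_cball by blast
  ultimately show ?thesis
    by (intro that[of "min r1 r2"]) (auto simp: subset_eq)
qed

section \<open>Osgood's lemma: from separate to joint holomorphy\<close>

text \<open>The variation in \<open>t\<close> is handled by Cauchy's estimate for the difference of
  two slices, which is small because \<open>f\<close> is uniformly continuous on a compact bidisc;
  the variation in \<open>x\<close> by the one-variable theory on the slice through the
  point.\<close>

lemma sep_holo_continuous_du_dx:
  assumes "open S" and cont: "continuous_on S f"
    and dx: "\<And>t x. (t, x) \<in> S \<Longrightarrow> (\<lambda>y. f (t, y)) field_differentiable at x"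
  shows "continuous_on S (du_dx f)"
proof -
  have "isCont (du_dx f) (t0, x0)" if "(t0, x0) \<in> S" for t0 x0
  proof -
    obtain r where r: "r > 0" "cball t0 r \<times> cball x0 r \<subseteq> S"
      using open_contains_bidisc[OF \<open>open S\<close> \<open>(t0, x0) \<in> S\<close>] .
    define \<rho> where "\<rho> = r / 2"
    have \<rho>: "\<rho> > 0" "\<rho> < r" "2 * \<rho> = r" using r by (auto simp: \<rho>_def)
    have hol: "(\<lambda>y. f (t, y)) holomorphic_on ball x0 r" if "t \<in> cball t0 r" for t
      unfolding holomorphic_on_def
      using that r(2) by (intro ballI field_differentiable_at_within[OF dx]) auto
    have ucont: "uniformly_continuous_on (cball t0 r \<times> cball x0 r) f"
      by (intro compact_uniformly_continuous continuous_on_subset[OF cont] r compact_Times) auto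
    have "isCont (\<lambda>y. deriv (\<lambda>y. f (t0, y)) y) x0"
      using holomorphic_on_imp_continuous_on[OF holomorphic_deriv[OF hol[of t0]]] r(1)
      by (simp add: continuous_on_eq_continuous_at)
    then have c0: "isCont (\<lambda>y. du_dx f (t0, y)) x0"
      by (simp add: du_dx_def)
    have "\<exists>d>0. \<forall>p. dist p (t0, x0) < d \<longrightarrow> dist (du_dx f p) (du_dx f (t0, x0)) < e" if "e > 0" for e
    proof -
      obtain d1 where d1: "d1 > 0" "\<And>y. dist y x0 < d1 \<Longrightarrow> dist (du_dx f (t0, y)) (du_dx f (t0, x0)) < e / 2"
        using c0 \<open>e > 0\<close> unfolding continuous_at_eps_delta by (metis half_gt_zero)
      have "e / 4 * \<rho> > 0" using \<open>e > 0\<close> \<rho> by simp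
      then obtain d2 where d2: "d2 > 0"
        "\<And>p q. p \<in> cball t0 r \<times> cball x0 r \<Longrightarrow> q \<in> cball t0 r \<times> cball x0 r \<Longrightarrow> dist p q < d2 \<Longrightarrow> dist (f p) (f q) < e / 4 * \<rho>"
        using ucont unfolding uniformly_continuous_on_def by metis
      define d where "d = min \<rho> (min d1 d2)"
      have "dist (du_dx f (t, x)) (du_dx f (t0, x0)) < e" if "dist (t, x) (t0, x0) < d" for t x
      proof -
        have dt: "dist t t0 < d" and dx: "dist x x0 < d"
          using that dist_fst_le[of "(t,x)" "(t0,x0)"] dist_snd_le[of "(t,x)" "(t0,x0)"] by auto
        have tr: "t \<in> cball t0 r" "t0 \<in> cball t0 r"
          using dt \<rho> by (auto simp: d_def dist_commute)
        have sub: "ball x \<rho> \<subseteq> ball x0 r"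
        proof
          fix y assume "y \<in> ball x \<rho>"
          then show "y \<in> ball x0 r"
            using dx \<rho> dist_triangle[of x0 y x] by (auto simp: d_def dist_commute)
        qed
        have "cmod (deriv (\<lambda>y. f (t, y) - f (t0, y)) x) \<le> (e / 4 * \<rho>) / \<rho>"
        proof (rule deriv_norm_le)
          show "(\<lambda>y. f (t, y) - f (t0, y)) holomorphic_on ball x \<rho>"
            using tr sub by (intro holomorphic_intros holomorphic_on_subset[OF hol])
          show "cmod (f (t, w) - f (t0, w)) \<le> e / 4 * \<rho>" if "w \<in> ball x \<rho>" for w
          proof -
            have "w \<in> cball x0 r" using that sub by auto
            moreover have "dist (t, w) (t0, w) < d2"
              using dt by (simp add: dist_Pair_Pair d_def)
            ultimately show ?thesis
              using d2(2)[of "(t, w)" "(t0, w)"] tr by (simp add: dist_norm)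
          qed
        qed (use \<rho> in auto)
        moreover have "deriv (\<lambda>y. f (t, y) - f (t0, y)) x = du_dx f (t, x) - du_dx f (t0, x)"
        proof -
          have "x \<in> ball x0 r" using sub \<rho>(1) by (metis centre_in_ball subsetD)
          then have "(\<lambda>y. f (s, y)) field_differentiable at x" if "s \<in> cball t0 r" for s
            using hol[OF that] by (auto intro: holomorphic_on_imp_differentiable_at)
          then show ?thesis unfolding du_dx_def using tr by (simp add: deriv_diff)
        qed
        ultimately have "dist (du_dx f (t, x)) (du_dx f (t0, x)) < e / 2"
          using \<rho> \<open>e > 0\<close> by (simp add: dist_norm)
        moreover have "dist (du_dx f (t0, x)) (du_dx f (t0, x0)) < e / 2"
          using d1(2)[of x] dx by (simp add: d_def)
        ultimately show ?thesis
          using dist_triangle[of "du_dx f (t, x)" "du_dx f (t0, x0)" "du_dx f (t0, x)"] by linarith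
      qed
      moreover have "d > 0" using \<rho> d1 d2 by (simp add: d_def)
      ultimately show ?thesis by (intro exI[of _ d]) auto
    qed
    then show ?thesis unfolding continuous_at_eps_delta by blast
  qed
  then show ?thesis by (auto intro!: continuous_at_imp_continuous_on)
qed

text \<open>A \<open>t\<close>-derivative at the point together with a jointly continuous
  \<open>x\<close>-derivative gives the Frechet derivative, and that continuity is the preceding
  lemma.\<close>

lemma holo2I:
  assumes "open S" "continuous_on S f"
    and dt: "\<And>t x. (t, x) \<in> S \<Longrightarrow> (\<lambda>s. f (s, x)) field_differentiable at t"
    and dx: "\<And>t x. (t, x) \<in> S \<Longrightarrow> (\<lambda>y. f (t, y)) field_differentiable at x"
  shows "f holomorphic2_on S"
proof -
  have cont: "continuous_on S (du_dx f)"
    using sep_holo_continuous_du_dx[OF assms(1,2) dx] .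
  have "\<exists>a b. (f has_derivative (\<lambda>(h, k). a * h + b * k)) (at (t, x))" if "(t, x) \<in> S" for t x
  proof -
    obtain r where r: "r > 0" "cball t r \<times> cball x r \<subseteq> S"
      using open_contains_bidisc[OF \<open>open S\<close> \<open>(t, x) \<in> S\<close>] .
    have "((\<lambda>(s, y). f (s, y)) has_derivative 
       (\<lambda>(h, k). (*) (deriv (\<lambda>s. f (s, x)) t) h + blinfun_mult_right (du_dx f (t, x)) k)) 
       (at (t, x) within ball t r \<times> ball x r)"
    proof (rule has_derivative_partialsI[where fy = "\<lambda>s y. blinfun_mult_right (du_dx f (s, y))"])
      show "((\<lambda>s. f (s, x)) has_derivative (*) (deriv (\<lambda>s. f (s, x)) t)) (at t within ball t r)"
        using dt[OF \<open>(t, x) \<in> S\<close>]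
        by (metis DERIV_deriv_iff_field_differentiable has_field_derivative_def has_derivative_at_withinI)
      show "((\<lambda>y. f (s, y)) has_derivative blinfun_apply (blinfun_mult_right (du_dx f (s, y)))) (at y within ball x r)"
        if "s \<in> ball t r" "y \<in> ball x r" for s y
      proof -
        have "(s, y) \<in> S" using that r by auto
        from dx[OF this] show ?thesis
          by (simp add: du_dx_def DERIV_deriv_iff_field_differentiable[symmetric] has_field_derivative_def has_derivative_at_withinI)
      qed
      have "isCont (du_dx f) (t, x)"
        using cont \<open>open S\<close> \<open>(t, x) \<in> S\<close> by (simp add: continuous_on_eq_continuous_at)
      then have "isCont (\<lambda>p. blinfun_mult_right (du_dx f p)) (t, x)"
        by (rule bounded_linear.continuous[OF bounded_linear_blinfun_mult_right])
      then show "continuous (at (t, x) within ball t r \<times> ball x r) (\<lambda>(s, y). blinfun_mult_right (du_dx f (s, y)))"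
        by (simp add: case_prod_unfold continuous_at_imp_continuous_within)
    qed (use r in auto)
    moreover have "at (t, x) within ball t r \<times> ball x r = at (t, x)"
      using r(1) by (intro at_within_open open_Times) auto
    ultimately have "(f has_derivative (\<lambda>(h, k). deriv (\<lambda>s. f (s, x)) t * h + du_dx f (t, x) * k)) (at (t, x))"
      by (simp add: case_prod_unfold)
    then show ?thesis by blast
  qed
  then show ?thesis using \<open>open S\<close> unfolding holomorphic2_on_def by auto
qed

text \<open>The working form of the notion: closure properties split into a continuity fact and
  one-variable differentiability facts.\<close>

lemma holo2_iff:
  "f holomorphic2_on S \<longleftrightarrow> open S \<and> continuous_on S f \<and>
    (\<forall>t x. (t, x) \<in> S \<longrightarrow> (\<lambda>s. f (s, x)) field_differentiable at t \<and> (\<lambda>y. f (t, y)) field_differentiable at x)"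
  (is "?L = ?R")
proof
  assume ?L
  then show ?R
    using holo2_partials holo2_continuous holomorphic2_on_def field_differentiable_def by metis
qed (auto intro: holo2I)

section \<open>Closure properties of holomorphic functions of two variables\<close>

lemma holo2_open: "f holomorphic2_on S \<Longrightarrow> open S"
  by (simp add: holomorphic2_on_def)

lemma holo2_subset: "f holomorphic2_on S \<Longrightarrow> open T \<Longrightarrow> T \<subseteq> S \<Longrightarrow> f holomorphic2_on T"
  unfolding holomorphic2_on_def by blast

lemma holo2_slices:
  assumes "f holomorphic2_on S"
  shows "\<lbrakk>A \<times> {x} \<subseteq> S\<rbrakk> \<Longrightarrow> (\<lambda>s. f (s, x)) holomorphic_on A"
    and "\<lbrakk>{t} \<times> B \<subseteq> S\<rbrakk> \<Longrightarrow> (\<lambda>y. f (t, y)) holomorphic_on B"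
  unfolding holomorphic_on_def
  using assms field_differentiable_at_within unfolding holo2_iff by blast+

lemma holo2_add: "f holomorphic2_on S \<Longrightarrow> g holomorphic2_on S \<Longrightarrow> (\<lambda>p. f p + g p) holomorphic2_on S"
  unfolding holo2_iff by (auto intro: continuous_on_add field_differentiable_add)

lemma holo2_diff: "f holomorphic2_on S \<Longrightarrow> g holomorphic2_on S \<Longrightarrow> (\<lambda>p. f p - g p) holomorphic2_on S"
  unfolding holo2_iff by (auto intro: continuous_on_diff field_differentiable_diff)

lemma holo2_mult: "f holomorphic2_on S \<Longrightarrow> g holomorphic2_on S \<Longrightarrow> (\<lambda>p. f p * g p) holomorphic2_on S"
  unfolding holo2_iff by (auto intro: continuous_on_mult field_differentiable_mult)

lemma holo2_fst_power: "open S \<Longrightarrow> (\<lambda>p. fst p ^ n) holomorphic2_on S"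
  unfolding holo2_iff by (auto intro!: continuous_on_power continuous_on_fst intro: continuous_on_fst continuous_on_power continuous_on_id field_differentiable_power field_differentiable_ident field_differentiable_const)

lemma holo2_fst: "open S \<Longrightarrow> fst holomorphic2_on S"
  unfolding holo2_iff by (auto intro: continuous_on_fst continuous_on_power continuous_on_id field_differentiable_power field_differentiable_ident field_differentiable_const)

lemma holo2_const: "open S \<Longrightarrow> (\<lambda>p. c) holomorphic2_on S"
  unfolding holo2_iff by (auto intro: continuous_on_fst continuous_on_power continuous_on_id field_differentiable_power field_differentiable_ident field_differentiable_const)

lemma holo2_snd_compose:
  assumes "open S" "h holomorphic_on X" "open X" "S \<subseteq> UNIV \<times> X"
  shows "(\<lambda>p. h (snd p)) holomorphic2_on S"
proof -
  have "continuous_on S (\<lambda>p. h (snd p))"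
    using assms by (intro continuous_on_compose2[OF holomorphic_on_imp_continuous_on[OF assms(2)]] continuous_intros) auto
  moreover have "h field_differentiable at x" if "(t, x) \<in> S" for t x
    using assms that holomorphic_on_imp_differentiable_at by blast
  ultimately show ?thesis using \<open>open S\<close>
    unfolding holo2_iff by (auto intro: field_differentiable_const)
qed

lemma holo2_sum:
  assumes "open S" "\<And>j. j \<in> J \<Longrightarrow> f j holomorphic2_on S"
  shows "(\<lambda>p. \<Sum>j\<in>J. f j p) holomorphic2_on S"
  using assms(2) by (induction J rule: infinite_finite_induct) (auto intro: holo2_const holo2_add assms(1))

text \<open>Exchanging the variables carries results about \<open>du_dx\<close> over to
  \<open>du_dt\<close>.\<close>

lemma holo2_swap:
  assumes "f holomorphic2_on S"
  shows "(\<lambda>p. f (prod.swap p)) holomorphic2_on (prod.swap -` S)"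
proof (rule holo2I)
  show "open (prod.swap -` S)"
    using holo2_open[OF assms] by (intro open_vimage continuous_on_swap) auto
  show "continuous_on (prod.swap -` S) (\<lambda>p. f (prod.swap p))"
    by (rule continuous_on_compose2[OF holo2_continuous[OF assms] continuous_on_swap]) auto
qed (use assms in \<open>simp_all add: holo2_iff\<close>)

section \<open>Locally uniform limits and derivatives of holomorphic functions\<close>

text \<open>Weierstrass' theorem on lines parallel to the axes gives the partial derivatives and
  their convergence; the limit is continuous, so Osgood's lemma applies to it.\<close>

lemma holo2_uniform_limit:
  assumes hf: "\<And>n. f n holomorphic2_on S"
    and ul: "\<And>p. p \<in> S \<Longrightarrow> \<exists>d>0. cball p d \<subseteq> S \<and> uniform_limit (cball p d) f g sequentially"
  shows "g holomorphic2_on S"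
    and "\<And>p. p \<in> S \<Longrightarrow> (\<lambda>n. du_dt (f n) p) \<longlonglongrightarrow> du_dt g p"
    and "\<And>p. p \<in> S \<Longrightarrow> (\<lambda>n. du_dx (f n) p) \<longlonglongrightarrow> du_dx g p"
    and "\<And>p. p \<in> S \<Longrightarrow> (\<lambda>n. f n p) \<longlonglongrightarrow> g p"
proof -
  have "open S" using hf holo2_open by blast
  have cont: "continuous_on S g"
  proof (rule continuous_at_imp_continuous_on, rule)
    fix p assume "p \<in> S"
    then obtain d where d: "d > 0" "cball p d \<subseteq> S" "uniform_limit (cball p d) f g sequentially"
      using ul by blast
    have "continuous_on (cball p d) g"
      using d by (intro uniform_limit_theorem[OF _ d(3)] always_eventually allI)
        (auto intro!: continuous_on_subset[OF holo2_continuous[OF hf]])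
    then show "isCont g p"
      using d by (simp add: continuous_on_interior)
  qed
  have dt: "((\<lambda>s. g (s, x)) has_field_derivative du_dt g (t, x)) (at t) \<and> (\<lambda>n. du_dt (f n) (t, x)) \<longlonglongrightarrow> du_dt g (t, x)"
    if tx: "(t, x) \<in> S" for t x
  proof -
    have "open ((\<lambda>s. (s, x)) -` S)" using \<open>open S\<close> by (intro open_vimage continuous_intros)
    then have "\<exists>g'. \<forall>s\<in>(\<lambda>s. (s, x)) -` S. ((\<lambda>s. g (s, x)) has_field_derivative g' s) (at s) \<and> ((\<lambda>n. du_dt (f n) (s, x)) \<longlonglongrightarrow> g' s)"
    proof (rule has_complex_derivative_uniform_sequence)
      fix s assume "s \<in> (\<lambda>s. (s, x)) -` S"
      then obtain d where d: "d > 0" "cball (s, x) d \<subseteq> S" "uniform_limit (cball (s, x) d) f g sequentially"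
        using ul by blast
      have sub: "(\<lambda>s. (s, x)) ` cball s d \<subseteq> cball (s, x) d" by (auto simp: dist_Pair_Pair)
      have "uniform_limit (cball s d) (\<lambda>n s. f n (s, x)) (\<lambda>s. g (s, x)) sequentially"
        unfolding uniform_limit_iff
        using d(3) sub unfolding uniform_limit_iff by (fastforce elim!: eventually_mono)
      then show "\<exists>d>0. cball s d \<subseteq> (\<lambda>s. (s, x)) -` S \<and> uniform_limit (cball s d) (\<lambda>n s. f n (s, x)) (\<lambda>s. g (s, x)) sequentially"
        using d sub by (intro exI[of _ d]) auto
    qed (use holo2_partials(1)[OF hf] in auto)
    then obtain g' where "((\<lambda>s. g (s, x)) has_field_derivative g') (at t)" "(\<lambda>n. du_dt (f n) (t, x)) \<longlonglongrightarrow> g'"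
      using tx by auto
    moreover from this(1) have "du_dt g (t, x) = g'" by (simp add: du_dt_def DERIV_imp_deriv)
    ultimately show ?thesis by simp
  qed
  have dx: "((\<lambda>s. g (t, s)) has_field_derivative du_dx g (t, x)) (at x) \<and> (\<lambda>n. du_dx (f n) (t, x)) \<longlonglongrightarrow> du_dx g (t, x)"
    if tx: "(t, x) \<in> S" for t x
  proof -
    have "open (Pair t -` S)" using \<open>open S\<close> by (intro open_vimage continuous_intros)
    then have "\<exists>g'. \<forall>s\<in>Pair t -` S. ((\<lambda>s. g (t, s)) has_field_derivative g' s) (at s) \<and> ((\<lambda>n. du_dx (f n) (t, s)) \<longlonglongrightarrow> g' s)"
    proof (rule has_complex_derivative_uniform_sequence)
      fix s assume "s \<in> Pair t -` S"
      then obtain d where d: "d > 0" "cball (t, s) d \<subseteq> S" "uniform_limit (cball (t, s) d) f g sequentially"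
        using ul by blast
      have sub: "Pair t ` cball s d \<subseteq> cball (t, s) d" by (auto simp: dist_Pair_Pair)
      have "uniform_limit (cball s d) (\<lambda>n s. f n (t, s)) (\<lambda>s. g (t, s)) sequentially"
        unfolding uniform_limit_iff
        using d(3) sub unfolding uniform_limit_iff by (fastforce elim!: eventually_mono)
      then show "\<exists>d>0. cball s d \<subseteq> Pair t -` S \<and> uniform_limit (cball s d) (\<lambda>n s. f n (t, s)) (\<lambda>s. g (t, s)) sequentially"
        using d sub by (intro exI[of _ d]) auto
    qed (use holo2_partials(2)[OF hf] in auto)
    then obtain g' where "((\<lambda>s. g (t, s)) has_field_derivative g') (at x)" "(\<lambda>n. du_dx (f n) (t, x)) \<longlonglongrightarrow> g'"
      using tx by auto
    moreover from this(1) have "du_dx g (t, x) = g'" by (simp add: du_dx_def DERIV_imp_deriv)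
    ultimately show ?thesis by simp
  qed
  show "g holomorphic2_on S"
  proof (rule holo2I[OF \<open>open S\<close> cont])
    show "(\<lambda>s. g (s, x)) field_differentiable at t" "(\<lambda>y. g (t, y)) field_differentiable at x"
      if "(t, x) \<in> S" for t x
      using dt[OF that] dx[OF that] unfolding field_differentiable_def by blast+
  qed
  show "(\<lambda>n. du_dt (f n) p) \<longlonglongrightarrow> du_dt g p" if "p \<in> S" for p using that dt by (cases p) auto
  show "(\<lambda>n. du_dx (f n) p) \<longlonglongrightarrow> du_dx g p" if "p \<in> S" for p using that dx by (cases p) auto
  show "(\<lambda>n. f n p) \<longlonglongrightarrow> g p" if p: "p \<in> S" for p 
  proof -
    obtain d where "d > 0" "uniform_limit (cball p d) f g sequentially" using ul[OF p] by blast
    then show ?thesis using tendsto_uniform_limitI centre_in_cball less_imp_le by metis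
  qed
qed

text \<open>At this point \<open>du_dt f\<close> is not known to be differentiable in \<open>x\<close>, hence the sequence of difference quotients.\<close>
lemma du_dx_differentiable_in_t:
  assumes f: "f holomorphic2_on S" and tx: "(t, x) \<in> S"
  shows "\<exists>h g'. (\<forall>n. h n \<noteq> (0::complex)) \<and> h \<longlonglongrightarrow> 0 \<and> ((\<lambda>s. du_dx f (s, x)) has_field_derivative g') (at t) \<and>
    (\<lambda>n. (du_dt f (t, x + h n) - du_dt f (t, x)) / h n) \<longlonglongrightarrow> g'"
proof -
  obtain r where r: "r > 0" "cball t r \<times> cball x r \<subseteq> S"
    using open_contains_bidisc[OF holo2_open[OF f] tx] .
  have cont: "continuous_on S (du_dx f)"
    using f by (intro sep_holo_continuous_du_dx) (auto simp: holo2_iff)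
  then have ucont: "uniformly_continuous_on (cball t r \<times> cball x r) (du_dx f)"
    by (intro compact_uniformly_continuous continuous_on_subset[OF cont] r compact_Times) auto
  \<comment> \<open>Nonzero increments of length at most \<open>r / 2\<close>, so that
    \<open>x + h n\<close> stays in the disc where everything is controlled.\<close>
  define h where "h n = (of_real (r / (real n + 2)) :: complex)" for n
  have h0: "h n \<noteq> 0" for n using r by (simp add: h_def complex_eq_iff)
  have hn: "cmod (h n) = r / (real n + 2)" for n
    using r unfolding h_def norm_of_real by simp
  have hr: "cmod (h n) \<le> r" for n using r(1) by (simp add: hn field_simps)
  have "(\<lambda>n. r / (real n + 2)) \<longlonglongrightarrow> 0" by real_asymp
  then have hlim: "h \<longlonglongrightarrow> 0" by (simp add: hn tendsto_norm_zero_iff[of h, symmetric])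
  define q where "q n s = (f (s, x + h n) - f (s, x)) / h n" for n s
  define q' where "q' n s = (du_dt f (s, x + h n) - du_dt f (s, x)) / h n" for n s
  have ul: "uniform_limit (cball t r) q (\<lambda>s. du_dx f (s, x)) sequentially"
    unfolding uniform_limit_iff
  proof safe
    fix e :: real assume e: "e > 0"
    then obtain d where d: "d > 0" "\<And>p q. p \<in> cball t r \<times> cball x r \<Longrightarrow> q \<in> cball t r \<times> cball x r \<Longrightarrow> dist p q < d \<Longrightarrow> dist (du_dx f p) (du_dx f q) < e / 2"
      using ucont unfolding uniformly_continuous_on_def by (metis half_gt_zero)
    have "\<forall>\<^sub>F n in sequentially. cmod (h n) < d"
      using hlim d(1) by (simp add: tendsto_iff dist_norm)
    then show "\<forall>\<^sub>F n in sequentially. \<forall>s\<in>cball t r. dist (q n s) (du_dx f (s, x)) < e"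
    proof eventually_elim
      case (elim n)
      show ?case
      proof
        fix s assume s: "s \<in> cball t r"
        \<comment> \<open>\<open>f (s, \<cdot>)\<close> minus its linear part at \<open>x\<close>:
          the derivative of this function is at most \<open>e / 2\<close> near \<open>x\<close>,
          uniformly in \<open>s\<close>, and the mean value inequality bounds the error of the
          difference quotient.\<close>
        define \<phi> where "\<phi> y = f (s, y) - du_dx f (s, x) * y" for y
        have *: "cmod (\<phi> (x + h n) - \<phi> x) \<le> e / 2 * cmod ((x + h n) - x)"
        proof (rule field_differentiable_bound[of "cball x (cmod (h n))" _ "\<lambda>y. du_dx f (s, y) - du_dx f (s, x)"])
          fix y assume y: "y \<in> cball x (cmod (h n))"
          then have yr: "y \<in> cball x r" using hr[of n] by auto
          have "((\<lambda>y. f (s, y)) has_field_derivative du_dx f (s, y)) (at y)"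
            using r s yr by (intro holo2_partials[OF f]) auto
          from has_field_derivative_at_within[OF DERIV_diff[OF this DERIV_cmult_Id]]
          show "(\<phi> has_field_derivative du_dx f (s, y) - du_dx f (s, x)) (at y within cball x (cmod (h n)))"
            unfolding \<phi>_def .
          have "dist (s, y) (s, x) < d" using y elim by (auto simp: dist_Pair_Pair dist_commute)
          then show "cmod (du_dx f (s, y) - du_dx f (s, x)) \<le> e / 2"
            using d(2)[of "(s, y)" "(s, x)"] s yr r(1) by (simp add: dist_norm)
        qed (auto simp: dist_norm)
        have "h n * q n s = f (s, x + h n) - f (s, x)"
          using h0[of n] by (simp add: q_def)
        then have **: "\<phi> (x + h n) - \<phi> x = h n * (q n s - du_dx f (s, x))"
          by (simp add: \<phi>_def algebra_simps)
        have "cmod (h n) * cmod (q n s - du_dx f (s, x)) \<le> cmod (h n) * (e / 2)"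
          using *[unfolded ** norm_mult] by (simp add: mult.commute[of _ "cmod (h n)"])
        moreover have "cmod (h n) > 0" using h0[of n] by simp
        ultimately have "cmod (q n s - du_dx f (s, x)) \<le> e / 2"
          by (rule mult_left_le_imp_le)
        then show "dist (q n s) (du_dx f (s, x)) < e" using e by (simp add: dist_norm)
      qed
    qed
  qed
  \<comment> \<open>Weierstrass' theorem in \<open>t\<close>: the quotients \<open>q n\<close> tend
    uniformly to \<open>du_dx f\<close>, hence their \<open>t\<close>-derivatives
    \<open>q' n\<close> tend to its \<open>t\<close>-derivative.\<close>
  have "\<exists>g'. \<forall>s\<in>ball t r. ((\<lambda>s. du_dx f (s, x)) has_field_derivative g' s) (at s) \<and> (\<lambda>n. q' n s) \<longlonglongrightarrow> g' s"
  proof (rule has_complex_derivative_uniform_sequence)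
    show "(q n has_field_derivative q' n s) (at s)" if "s \<in> ball t r" for n s
    proof -
      have "(s, x + h n) \<in> S" "(s, x) \<in> S" using that r hr[of n] by (auto simp: dist_norm subset_eq)
      note D = holo2_partials(1)[OF f this(1)] holo2_partials(1)[OF f this(2)]
      show ?thesis unfolding q_def[abs_def] q'_def by (intro DERIV_cdivide DERIV_diff D)
    qed
    show "\<exists>d>0. cball s d \<subseteq> ball t r \<and> uniform_limit (cball s d) q (\<lambda>s. du_dx f (s, x)) sequentially" if "s \<in> ball t r" for s
    proof -
      obtain d where "d > 0" "cball s d \<subseteq> ball t r" using open_contains_cball \<open>s \<in> ball t r\<close> by blast
      then show ?thesis using uniform_limit_on_subset[OF ul] by (metis ball_subset_cball subset_trans)
    qed
  qed auto
  then obtain g' where "\<forall>s\<in>ball t r. ((\<lambda>s. du_dx f (s, x)) has_field_derivative g' s) (at s) \<and> (\<lambda>n. q' n s) \<longlonglongrightarrow> g' s"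
    by blast
  then have "((\<lambda>s. du_dx f (s, x)) has_field_derivative g' t) (at t)" "(\<lambda>n. q' n t) \<longlonglongrightarrow> g' t"
    using r(1) by simp_all
  then show ?thesis using h0 hlim unfolding q'_def by blast
qed

lemma du_dx_swap: "du_dx (\<lambda>p. f (prod.swap p)) = (\<lambda>p. du_dt f (prod.swap p))"
  by (auto simp: du_dt_def du_dx_def fun_eq_iff)

lemma holo2_du_dx:
  assumes f: "f holomorphic2_on S"
  shows "du_dx f holomorphic2_on S"
proof (rule holo2I)
  show "open S" using f holo2_open by blast
  show "continuous_on S (du_dx f)"
    using f by (intro sep_holo_continuous_du_dx) (auto simp: holo2_iff)
  fix t x assume tx: "(t, x) \<in> S"
  show "(\<lambda>s. du_dx f (s, x)) field_differentiable at t"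
    using du_dx_differentiable_in_t[OF f tx] by (auto simp: field_differentiable_def)
  have "(\<lambda>y. f (t, y)) holomorphic_on (Pair t -` S)" by (rule holo2_slices(2)[OF f]) auto
  moreover have "open (Pair t -` S)" using \<open>open S\<close> by (intro open_vimage continuous_intros)
  ultimately have "deriv (\<lambda>y. f (t, y)) holomorphic_on (Pair t -` S)" by (rule holomorphic_deriv)
  with \<open>open (Pair t -` S)\<close> tx show "(\<lambda>y. du_dx f (t, y)) field_differentiable at x"
    unfolding du_dx_def using holomorphic_on_imp_differentiable_at by fastforce
qed

lemma holo2_du_dt:
  assumes f: "f holomorphic2_on S"
  shows "du_dt f holomorphic2_on S"
proof -
  have "(\<lambda>p. du_dx (\<lambda>p. f (prod.swap p)) (prod.swap p)) holomorphic2_on (prod.swap -` (prod.swap -` S))"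
    by (intro holo2_swap holo2_du_dx f)
  then show ?thesis by (simp add: du_dx_swap vimage_def)
qed

text \<open>Along the sequence \<open>h\<close> the quotients of \<open>du_dt f\<close> in
  \<open>x\<close> have two limits: the \<open>t\<close>-derivative of \<open>du_dx f\<close> and,
  since \<open>du_dt f\<close> is differentiable in \<open>x\<close>, the other mixed
  derivative.\<close>

lemma du_dt_du_dx:
  assumes f: "f holomorphic2_on S" and tx: "(t, x) \<in> S"
  shows "du_dt (du_dx f) (t, x) = du_dx (du_dt f) (t, x)"
proof -
  obtain h g' where h: "\<And>n. h n \<noteq> (0::complex)" "h \<longlonglongrightarrow> 0" "((\<lambda>s. du_dx f (s, x)) has_field_derivative g') (at t)"
    "(\<lambda>n. (du_dt f (t, x + h n) - du_dt f (t, x)) / h n) \<longlonglongrightarrow> g'"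
    using du_dx_differentiable_in_t[OF f tx] by blast
  have "((\<lambda>y. du_dt f (t, y)) has_field_derivative du_dx (du_dt f) (t, x)) (at x)"
    by (rule holo2_partials[OF holo2_du_dt[OF f] tx])
  then have "((\<lambda>k. (du_dt f (t, x + k) - du_dt f (t, x)) / k) \<longlongrightarrow> du_dx (du_dt f) (t, x)) (at 0)"
    by (simp add: DERIV_def)
  then have "(\<lambda>n. (du_dt f (t, x + h n) - du_dt f (t, x)) / h n) \<longlonglongrightarrow> du_dx (du_dt f) (t, x)"
    by (rule filterlim_compose) (use h in \<open>auto simp: filterlim_at\<close>)
  with h(4) have "g' = du_dx (du_dt f) (t, x)" using LIMSEQ_unique by blast
  then show ?thesis using h(3) by (simp add: du_dt_def DERIV_imp_deriv)
qed

section \<open>The second-order remainder\<close>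

text \<open>Meant for \<open>f s = F (s * t, x, s * u, s * v)\<close> with \<open>S = r / N\<close>,
  where \<open>1 / S\<^sup>2\<close> becomes the quadratic factor \<open>N\<^sup>2\<close>. Cauchy's
  estimate with radius \<open>S / 2\<close> and then \<open>S / 4\<close> bounds the variation of
  the derivative; \<open>S \<ge> 4\<close> puts the unit disc where this holds.\<close>

lemma taylor2_bound:
  assumes hol: "f holomorphic_on ball 0 S" and B: "\<And>w. w \<in> ball 0 S \<Longrightarrow> cmod (f w) \<le> B" and S: "S \<ge> 4"
  shows "cmod (f 1 - f 0 - deriv f 0) \<le> 8 * B / S\<^sup>2"
proof -
  have B0: "B \<ge> 0" using B[of 0] S norm_ge_zero[of "f 0"] by (simp del: norm_ge_zero)
  have d1: "cmod (deriv f w) \<le> 2 * B / S" if "w \<in> ball 0 (S / 2)" for w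
  proof -
    have sub: "ball w (S / 2) \<subseteq> ball 0 S"
      using that by (auto simp: dist_norm) (smt (verit) norm_triangle_sub norm_minus_commute field_sum_of_halves)
    have "cmod (deriv f w) \<le> B / (S / 2)"
      using sub S by (intro deriv_norm_le B holomorphic_on_subset[OF hol]) auto
    then show ?thesis by (simp add: mult.commute)
  qed
  have d2: "cmod (deriv f w - deriv f 0) \<le> 8 * B / S\<^sup>2" if "cmod w \<le> 1" for w
  proof -
    have "cmod (deriv f w - deriv f 0) \<le> (2 * B / S) / (S / 4) * cmod (w - 0)"
    proof (rule lipschitz_of_bounded[where R = "S / 4"])
      show "deriv f holomorphic_on ball 0 (S / 4 + S / 4)"
        using S by (intro holomorphic_deriv holomorphic_on_subset[OF hol]) auto
      show "\<And>w. w \<in> ball 0 (S / 4 + S / 4) \<Longrightarrow> cmod (deriv f w) \<le> 2 * B / S"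
        using d1 by (simp add: field_simps)
    qed (use S that in auto)
    also have "\<dots> \<le> (2 * B / S) / (S / 4) * 1"
      using B0 S that by (intro mult_left_mono) auto
    finally show ?thesis using S by (simp add: power2_eq_square)
  qed
  have "cmod ((f 1 - deriv f 0 * 1) - (f 0 - deriv f 0 * 0)) \<le> 8 * B / S\<^sup>2 * cmod (1 - 0)"
  proof (rule field_differentiable_bound[of "cball 0 1" "\<lambda>w. f w - deriv f 0 * w" "\<lambda>w. deriv f w - deriv f 0"])
    fix z :: complex assume z: "z \<in> cball 0 1"
    have "(f has_field_derivative deriv f z) (at z)"
      by (rule holomorphic_derivI[OF hol]) (use z S in auto)
    from has_field_derivative_at_within[OF DERIV_diff[OF this DERIV_cmult_Id]]
    show "((\<lambda>w. f w - deriv f 0 * w) has_field_derivative deriv f z - deriv f 0) (at z within cball 0 1)" .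
    show "cmod (deriv f z - deriv f 0) \<le> 8 * B / S\<^sup>2" using d2 z by simp
  qed auto
  then show ?thesis by (simp add: algebra_simps)
qed

section \<open>Substitution of curves and functions into \<open>F\<close>\<close>

text \<open>The chain rule is proved with the anonymous coefficients of the Frechet derivative;
  applied to the four coordinate lines it identifies them as the partial derivatives.\<close>

lemma holo4_curve:
  assumes F: "F holomorphic4_on \<Delta>" and p: "(g1 s, g2 s, g3 s, g4 s) \<in> \<Delta>"
    and g: "(g1 has_field_derivative g1') (at s)" "(g2 has_field_derivative g2') (at s)"
      "(g3 has_field_derivative g3') (at s)" "(g4 has_field_derivative g4') (at s)"
  shows "((\<lambda>s. F (g1 s, g2 s, g3 s, g4 s)) has_field_derivative
       (deriv (\<lambda>w. F (w, g2 s, g3 s, g4 s)) (g1 s) * g1' + deriv (\<lambda>w. F (g1 s, w, g3 s, g4 s)) (g2 s) * g2'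
        + dF_du F (g1 s, g2 s, g3 s, g4 s) * g3' + dF_dv F (g1 s, g2 s, g3 s, g4 s) * g4')) (at s)"
proof -
  obtain t x u v where eq: "g1 s = t" "g2 s = x" "g3 s = u" "g4 s = v" by blast
  obtain a b c d where abcd: "(F has_derivative (\<lambda>(h, k, l, m). a * h + b * k + c * l + d * m)) (at (t, x, u, v))"
    using F p unfolding eq holomorphic4_on_def by blast
  have chain: "((\<lambda>s. F (g1 s, g2 s, g3 s, g4 s)) has_field_derivative (a * g1' + b * g2' + c * g3' + d * g4')) (at s)"
    if "(g1 s, g2 s, g3 s, g4 s) = (t, x, u, v)"
      "(g1 has_field_derivative g1') (at s)" "(g2 has_field_derivative g2') (at s)"
      "(g3 has_field_derivative g3') (at s)" "(g4 has_field_derivative g4') (at s)"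
    for g1 g2 g3 g4 :: "complex \<Rightarrow> complex" and g1' g2' g3' g4' s
  proof -
    have "((\<lambda>s. (g1 s, g2 s, g3 s, g4 s)) has_derivative (\<lambda>h. (g1' * h, g2' * h, g3' * h, g4' * h))) (at s)"
      using that(2-5) unfolding has_field_derivative_def by (intro has_derivative_Pair)
    from has_derivative_compose[OF this, of F "\<lambda>(h, k, l, m). a * h + b * k + c * l + d * m"] abcd that(1)
    have "((\<lambda>s. F (g1 s, g2 s, g3 s, g4 s)) has_derivative (\<lambda>h. a * (g1' * h) + b * (g2' * h) + c * (g3' * h) + d * (g4' * h))) (at s)"
      by simp
    moreover have "(\<lambda>h. a * (g1' * h) + b * (g2' * h) + c * (g3' * h) + d * (g4' * h)) = (*) (a * g1' + b * g2' + c * g3' + d * g4')"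
      by (auto simp: algebra_simps)
    ultimately show ?thesis by (simp add: has_field_derivative_def)
  qed
  have "deriv (\<lambda>w. F (w, x, u, v)) t = a"
    using chain[of "\<lambda>w. w" t "\<lambda>_. x" "\<lambda>_. u" "\<lambda>_. v" 1 0 0 0] by (simp add: DERIV_imp_deriv)
  moreover have "deriv (\<lambda>w. F (t, w, u, v)) x = b"
    using chain[of "\<lambda>_. t" x "\<lambda>w. w" "\<lambda>_. u" "\<lambda>_. v" 0 1 0 0] by (simp add: DERIV_imp_deriv)
  moreover have "dF_du F (t, x, u, v) = c"
    using chain[of "\<lambda>_. t" u "\<lambda>_. x" "\<lambda>w. w" "\<lambda>_. v" 0 0 1 0] by (simp add: DERIV_imp_deriv dF_du_def)
  moreover have "dF_dv F (t, x, u, v) = d"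
    using chain[of "\<lambda>_. t" v "\<lambda>_. x" "\<lambda>_. u" "\<lambda>w. w" 0 0 0 1] by (simp add: DERIV_imp_deriv dF_dv_def)
  ultimately show ?thesis using chain[OF _ g] by (simp add: eq)
qed

lemma holo4_field_differentiable:
  assumes F: "F holomorphic4_on \<Delta>" and p: "(g1 s, g2 s, g3 s, g4 s) \<in> \<Delta>"
    and "g1 field_differentiable at s" "g2 field_differentiable at s"
      "g3 field_differentiable at s" "g4 field_differentiable at s"
  shows "(\<lambda>s. F (g1 s, g2 s, g3 s, g4 s)) field_differentiable at s"
  using assms(3-6) holo4_curve[of F \<Delta> g1 s g2 g3 g4, OF F p] unfolding field_differentiable_def by blast

lemma holo4_continuous: "F holomorphic4_on \<Delta> \<Longrightarrow> continuous_on \<Delta> F"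
  unfolding holomorphic4_on_def
  by (metis continuous_at_imp_continuous_on has_derivative_continuous)

lemma holo4_compose:
  assumes F: "F holomorphic4_on \<Delta>" and U: "U holomorphic2_on S" and V: "V holomorphic2_on S"
    and sub: "\<And>t x. (t, x) \<in> S \<Longrightarrow> (t, x, U (t, x), V (t, x)) \<in> \<Delta>"
  shows "(\<lambda>p. F (fst p, snd p, U p, V p)) holomorphic2_on S"
proof (rule holo2I)
  show "open S" using U holo2_open by blast
  have "continuous_on S (\<lambda>p. (fst p, snd p, U p, V p))"
    by (intro continuous_intros holo2_continuous U V)
  then show "continuous_on S (\<lambda>p. F (fst p, snd p, U p, V p))"
    by (rule continuous_on_compose2[OF holo4_continuous[OF F]]) (use sub in auto)
  fix t x assume tx: "(t, x) \<in> S"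
  show "(\<lambda>s. F (fst (s, x), snd (s, x), U (s, x), V (s, x))) field_differentiable at t"
    using U V sub[OF tx] tx unfolding holo2_iff fst_conv snd_conv
    by (intro holo4_field_differentiable[OF F]) auto
  show "(\<lambda>y. F (fst (t, y), snd (t, y), U (t, y), V (t, y))) field_differentiable at x"
    using U V sub[OF tx] tx unfolding holo2_iff fst_conv snd_conv
    by (intro holo4_field_differentiable[OF F]) auto
qed

lemma holo4_polydisc:
  assumes F: "F holomorphic4_on \<Delta>" and "(0, 0, 0, 0) \<in> \<Delta>"
  obtains r M where "r > 0" "M > 0" 
    "\<And>t x u v. cmod t \<le> r \<Longrightarrow> cmod x \<le> r \<Longrightarrow> cmod u \<le> r \<Longrightarrow> cmod v \<le> r \<Longrightarrow> (t, x, u, v) \<in> \<Delta> \<and> cmod (F (t, x, u, v)) \<le> M"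
proof -
  have "open \<Delta>" using F by (simp add: holomorphic4_on_def)
  then obtain e where e: "e > 0" "cball (0, 0, 0, 0) e \<subseteq> \<Delta>"
    using assms(2) open_contains_cball by blast
  have "bounded (F ` cball (0, 0, 0, 0) e)"
    by (intro compact_imp_bounded compact_continuous_image continuous_on_subset[OF holo4_continuous[OF F]] e) auto
  then obtain M where M: "M > 0" "\<And>p. p \<in> cball (0, 0, 0, 0) e \<Longrightarrow> cmod (F p) \<le> M"
    unfolding bounded_pos by auto
  have "(t, x, u, v) \<in> cball (0, 0, 0, 0) e" if "cmod t \<le> e / 4" "cmod x \<le> e / 4" "cmod u \<le> e / 4" "cmod v \<le> e / 4" for t x u v
  proof -
    have "norm (t, x, u, v) \<le> norm t + (norm x + (norm u + norm v))"
      by (meson norm_Pair_le order_trans add_left_mono)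
    also have "\<dots> \<le> e" using that by simp
    finally show ?thesis by (simp add: zero_prod_def[symmetric])
  qed
  then show ?thesis using e M by (intro that[of "e / 4" M]) auto
qed

section \<open>The normal form of the equation and its estimates\<close>

text \<open>\<open>N\<close> is a common bound for \<open>|t|\<close>, \<open>|u|\<close> and
  \<open>|v|\<close>. It is proportional to \<open>|t|\<close> in the existence proof and in the
  last stage of uniqueness, and to the width of the current step in the uniqueness iteration. The
  Lipschitz constant in \<open>v\<close> is as small as \<open>N\<close> because \<open>P\<close>
  has no linear term in \<open>v\<close>; the Lipschitz bound in \<open>x\<close> serves to
  differentiate the nonlinear term in \<open>x\<close>.\<close>

locale briot_bouquet_estimates =
  fixes F :: "complex \<times> complex \<times> complex \<times> complex \<Rightarrow> complex"
    and \<Delta> :: "(complex \<times> complex \<times> complex \<times> complex) set"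
    and a lam :: "complex \<Rightarrow> complex" and P :: "complex \<Rightarrow> complex \<Rightarrow> complex \<Rightarrow> complex \<Rightarrow> complex"
    and \<rho> K c :: real
  defines "P \<equiv> \<lambda>t x u v. F (t, x, u, v) - a x * t - lam x * u"
  assumes F: "F holomorphic4_on \<Delta>"
    and pos: "0 < \<rho>" "\<rho> \<le> 1" "0 < K" "0 < c"
    and polydisc: "\<And>t x u v. cmod t \<le> \<rho> \<Longrightarrow> cmod x \<le> \<rho> \<Longrightarrow> cmod u \<le> \<rho> \<Longrightarrow> cmod v \<le> \<rho> \<Longrightarrow> (t, x, u, v) \<in> \<Delta>"
    and hol_a: "a holomorphic_on ball 0 \<rho>" and hol_lam: "lam holomorphic_on ball 0 \<rho>"
    and Re_lam: "\<And>x. cmod x < \<rho> \<Longrightarrow> Re (lam x) \<le> - c"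
    and P_bound: "\<And>t x u v N. cmod t \<le> N \<Longrightarrow> cmod x < \<rho> \<Longrightarrow> cmod u \<le> N \<Longrightarrow> cmod v \<le> N \<Longrightarrow> N \<le> \<rho> \<Longrightarrow> 
       cmod (P t x u v) \<le> K * N\<^sup>2"
    and P_lipschitz: "\<And>t x u v u' v' N. cmod t \<le> N \<Longrightarrow> cmod x < \<rho> \<Longrightarrow> cmod u \<le> N \<Longrightarrow> cmod v \<le> N \<Longrightarrow> 
       cmod u' \<le> N \<Longrightarrow> cmod v' \<le> N \<Longrightarrow> N \<le> \<rho> \<Longrightarrow> 
       cmod (P t x u v - P t x u' v') \<le> K * N * (cmod (u - u') + cmod (v - v'))"
    and P_lipschitz_x: "\<And>t x x' u v N. cmod t \<le> N \<Longrightarrow> cmod x < \<rho> \<Longrightarrow> cmod x' < \<rho> \<Longrightarrow> cmod u \<le> N \<Longrightarrow> cmod v \<le> N \<Longrightarrow>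
       N \<le> \<rho> \<Longrightarrow> cmod (P t x u v - P t x' u v) \<le> K * N\<^sup>2 * cmod (x - x')"

lemma briot_bouquet_estimates_exist:
  assumes orig: "(0, 0, 0, 0) \<in> \<Delta>" and F: "F holomorphic4_on \<Delta>"
    and F0: "\<And>x. (0, x, 0, 0) \<in> \<Delta> \<Longrightarrow> F (0, x, 0, 0) = 0"
    and Fv0: "\<And>x. (0, x, 0, 0) \<in> \<Delta> \<Longrightarrow> dF_dv F (0, x, 0, 0) = 0"
    and neg: "Re (dF_du F (0, 0, 0, 0)) < 0"
  obtains a lam \<rho> K c where "briot_bouquet_estimates F \<Delta> a lam \<rho> K c"
proof -
  obtain r M where r: "r > 0" "M > 0" 
    and poly: "\<And>t x u v. cmod t \<le> r \<Longrightarrow> cmod x \<le> r \<Longrightarrow> cmod u \<le> r \<Longrightarrow> cmod v \<le> r \<Longrightarrow> (t, x, u, v) \<in> \<Delta> \<and> cmod (F (t, x, u, v)) \<le> M"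
    using holo4_polydisc[OF F orig] by metis
  define a where "a x = deriv (\<lambda>s. F (s, x, 0, 0)) 0" for x
  define lam where "lam x = dF_du F (0, x, 0, 0)" for x
  define P where "P t x u v = F (t, x, u, v) - a x * t - lam x * u" for t x u v
  have hol_a: "a holomorphic_on ball 0 r"
  proof -
    have "(\<lambda>p. F (fst p, snd p, 0, 0)) holomorphic2_on (ball 0 r \<times> ball 0 r)"
      using poly r by (intro holo4_compose[OF F] holo2_const open_Times) auto
    then have "du_dt (\<lambda>p. F (fst p, snd p, 0, 0)) holomorphic2_on (ball 0 r \<times> ball 0 r)"
      by (rule holo2_du_dt)
    from holo2_slices(2)[OF this, of 0 "ball 0 r"] show ?thesis
      using r unfolding a_def[abs_def] by (force simp: du_dt_def)
  qed
  have hol_lam: "lam holomorphic_on ball 0 r"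
  proof -
    have "(\<lambda>p. F (0, snd p, fst p, 0)) holomorphic2_on (ball 0 r \<times> ball 0 r)"
    proof (rule holo2I)
      show "continuous_on (ball 0 r \<times> ball 0 r) (\<lambda>p. F (0, snd p, fst p, 0))"
        by (rule continuous_on_compose2[OF holo4_continuous[OF F]], intro continuous_intros)
          (use r poly in auto)
      show "(\<lambda>s. F (0, snd (s, x), fst (s, x), 0)) field_differentiable at t" "(\<lambda>y. F (0, snd (t, y), fst (t, y), 0)) field_differentiable at x"
        if "(t, x) \<in> ball 0 r \<times> ball 0 r" for t x
        using poly r that unfolding fst_conv snd_conv
        by (intro holo4_field_differentiable[OF F] field_differentiable_const field_differentiable_ident; simp)+
    qed (auto intro: open_Times)
    then have "du_dt (\<lambda>p. F (0, snd p, fst p, 0)) holomorphic2_on (ball 0 r \<times> ball 0 r)"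
      by (rule holo2_du_dt)
    from holo2_slices(2)[OF this, of 0 "ball 0 r"] show ?thesis
      using r unfolding lam_def[abs_def] by (force simp: du_dt_def dF_du_def)
  qed
  \<comment> \<open>The constant of \<open>taylor2_bound\<close> for a function bounded by
    \<open>M\<close> on the disc of radius \<open>r / N\<close>, with \<open>N\<^sup>2\<close> split
    off.\<close>
  define K0 where "K0 = 8 * M / r\<^sup>2"
  have K0: "K0 > 0" using r by (simp add: K0_def)
  have PB: "cmod (P t x u v) \<le> K0 * N\<^sup>2"
    if "cmod t \<le> N" "cmod x \<le> r" "cmod u \<le> N" "cmod v \<le> N" "0 < N" "4 * N \<le> r" for t x u v N
  proof -
    \<comment> \<open>The restriction of \<open>F\<close> to the complex line through
      \<open>(0, x, 0, 0)\<close> and the given point, with \<open>x\<close> frozen. As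
      \<open>F\<close> and its \<open>v\<close>-derivative vanish at \<open>(0, x, 0, 0)\<close>,
      its first-order Taylor polynomial at \<open>s = 1\<close> is exactly what \<open>P\<close>
      subtracts.\<close>
    define f where "f s = F (s * t, x, s * u, s * v)" for s
    have inD: "cmod (s * w) \<le> r" if "s \<in> ball 0 (r / N)" "cmod w \<le> N" for s w
    proof -
      have "cmod s * cmod w \<le> (r / N) * N"
        using that r \<open>0 < N\<close> by (intro mult_mono) auto
      then show ?thesis using \<open>0 < N\<close> by (simp add: norm_mult)
    qed
    have hol: "f holomorphic_on ball 0 (r / N)"
      unfolding holomorphic_on_def f_def
      by (intro ballI field_differentiable_at_within[OF holo4_field_differentiable[OF F]])
        (use poly inD that in \<open>auto intro!: derivative_intros\<close>)
    have "cmod (f 1 - f 0 - deriv f 0) \<le> 8 * M / (r / N)\<^sup>2"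
      by (rule taylor2_bound[OF hol]) (use poly inD that in \<open>auto simp: f_def field_simps\<close>)
    moreover have "8 * M / (r / N)\<^sup>2 = K0 * N\<^sup>2"
      using that r by (simp add: K0_def power_divide)
    moreover have p0: "(0, x, 0, 0) \<in> \<Delta>" using poly that r by auto
    then have "f 0 = 0" by (simp add: f_def F0)
    moreover have "deriv f 0 = a x * t + lam x * u"
    proof -
      have "((\<lambda>s. s * w) has_field_derivative w) (at 0)" for w :: complex
        by (auto intro!: derivative_eq_intros)
      from holo4_curve[OF F, of "\<lambda>s. s * t" 0 "\<lambda>s. x" "\<lambda>s. s * u" "\<lambda>s. s * v", OF _ this DERIV_const this this] p0
      have "(f has_field_derivative (a x * t + lam x * u)) (at 0)"
        by (simp add: f_def[abs_def] a_def lam_def Fv0[OF p0])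
      then show ?thesis by (rule DERIV_imp_deriv)
    qed
    ultimately show ?thesis by (simp add: P_def f_def algebra_simps)
  qed
  \<comment> \<open>The quadratic bound at scale \<open>2 * N\<close>, divided by the Cauchy radius
    \<open>N\<close>, gives the constant \<open>4 * K0 * N\<close>; hence
    \<open>8 * N \<le> r\<close>. The two arguments are changed one after the other.\<close>
  have PL: "cmod (P t x u v - P t x u' v') \<le> 4 * K0 * N * (cmod (u - u') + cmod (v - v'))"
    if "cmod t \<le> N" "cmod x < r" "cmod u \<le> N" "cmod v \<le> N" "cmod u' \<le> N" "cmod v' \<le> N" "0 < N" "8 * N \<le> r" for t x u v u' v' N
  proof -
    have N: "K0 * (2 * N)\<^sup>2 / N = 4 * K0 * N" using that by (simp add: power2_eq_square)
    have "cmod (P t x u v - P t x u' v) \<le> K0 * (2 * N)\<^sup>2 / N * cmod (u - u')"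
    proof (rule lipschitz_of_bounded[where R = N and f = "\<lambda>u. P t x u v"])
      show "(\<lambda>u. P t x u v) holomorphic_on ball 0 (N + N)"
        unfolding holomorphic_on_def P_def
        by (rule ballI, rule field_differentiable_at_within, intro field_differentiable_diff field_differentiable_mult
             holo4_field_differentiable[OF F] field_differentiable_const field_differentiable_ident) (use poly that in auto)
    qed (use that PB[of t "2 * N" x _ v] in auto)
    moreover have "cmod (P t x u' v - P t x u' v') \<le> K0 * (2 * N)\<^sup>2 / N * cmod (v - v')"
    proof (rule lipschitz_of_bounded[where R = N and f = "\<lambda>v. P t x u' v"])
      show "(\<lambda>v. P t x u' v) holomorphic_on ball 0 (N + N)"
        unfolding holomorphic_on_def P_def
        by (rule ballI, rule field_differentiable_at_within, intro field_differentiable_diff field_differentiable_mult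
             holo4_field_differentiable[OF F] field_differentiable_const field_differentiable_ident) (use poly that in auto)
    qed (use that PB[of t "2 * N" x u' _] in auto)
    ultimately have "cmod (P t x u v - P t x u' v) + cmod (P t x u' v - P t x u' v') \<le> 4 * K0 * N * (cmod (u - u') + cmod (v - v'))"
      unfolding N by (simp add: algebra_simps)
    then show ?thesis using norm_triangle_ineq[of "P t x u v - P t x u' v" "P t x u' v - P t x u' v'"] by simp
  qed
  \<comment> \<open>In \<open>x\<close> the Cauchy radius is the fixed number \<open>r / 2\<close>,
    so the quadratic factor survives undiminished.\<close>
  have PX: "cmod (P t x u v - P t x' u v) \<le> (2 * K0 / r) * N\<^sup>2 * cmod (x - x')"
    if "cmod t \<le> N" "cmod x \<le> r / 2" "cmod u \<le> N" "cmod v \<le> N" "cmod x' \<le> r / 2" "0 < N" "8 * N \<le> r" for t x u v x' N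
  proof -
    have "cmod (P t x u v - P t x' u v) \<le> K0 * N\<^sup>2 / (r / 2) * cmod (x - x')"
    proof (rule lipschitz_of_bounded[where R = "r / 2" and f = "\<lambda>x. P t x u v"])
      have "(\<lambda>x. F (t, x, u, v)) holomorphic_on ball 0 r"
        unfolding holomorphic_on_def
        by (intro ballI field_differentiable_at_within[OF holo4_field_differentiable[OF F]])
           (use poly that in auto)
      then show "(\<lambda>x. P t x u v) holomorphic_on ball 0 (r / 2 + r / 2)"
        unfolding P_def by (auto intro!: holomorphic_intros hol_a hol_lam)
    qed (use that r in \<open>auto intro!: PB\<close>)
    then show ?thesis by (simp add: mult_ac)
  qed
  have "isCont lam 0"
    using holomorphic_on_imp_continuous_on[OF hol_lam] r
    by (simp add: continuous_on_eq_continuous_at)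
  then have "isCont (\<lambda>x. Re (lam x)) 0"
    by (intro isCont_Re)
  moreover define c where "c = - Re (lam 0) / 2"
  have c: "c > 0" using neg by (simp add: c_def lam_def)
  ultimately obtain d where d: "d > 0" "\<And>x. dist x 0 < d \<Longrightarrow> dist (Re (lam x)) (Re (lam 0)) < c"
    unfolding continuous_at_eps_delta by metis
  have Rel: "Re (lam x) \<le> - c" if "cmod x < d" for x
    using d(2)[of x] that by (simp add: c_def dist_norm)
  \<comment> \<open>\<open>d\<close> keeps \<open>Re (lam x)\<close> below half its value at 0, and
    \<open>r / 8\<close> is what the Lipschitz bounds ask for at the largest scale
    \<open>N = \<rho>\<close>.\<close>
  define \<rho> where "\<rho> = min (min 1 d) (r / 8)"
  have \<rho>: "0 < \<rho>" "\<rho> \<le> 1" "\<rho> \<le> d" "8 * \<rho> \<le> r" using d r by (auto simp: \<rho>_def)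
  define K where "K = 4 * K0 + 2 * K0 / r"
  have K: "K \<ge> K0" "K \<ge> 4 * K0" "K \<ge> 2 * K0 / r" "K > 0" using K0 r by (auto simp: K_def intro!: add_pos_pos)
  have "briot_bouquet_estimates F \<Delta> a lam \<rho> K c"
  proof
    show "a holomorphic_on ball 0 \<rho>" "lam holomorphic_on ball 0 \<rho>"
      using hol_a hol_lam \<rho> by (auto elim!: holomorphic_on_subset)
    \<comment> \<open>The case \<open>N = 0\<close>, excluded above by the division by
      \<open>N\<close>: all three arguments vanish and so does \<open>P\<close>.\<close>
    have Pz: "P t x u v = 0" if "cmod t \<le> 0" "cmod x < \<rho>" "cmod u \<le> 0" "cmod v \<le> 0" for t x u v
      using that poly[of 0 x 0 0] F0[of x] r \<rho> by (simp add: P_def)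
    show "cmod (F (t, x, u, v) - a x * t - lam x * u) \<le> K * N\<^sup>2"
      if H: "cmod t \<le> N" "cmod x < \<rho>" "cmod u \<le> N" "cmod v \<le> N" "N \<le> \<rho>" for t x u v N
    proof (cases "N = 0")
      case True
      then show ?thesis using Pz[of t x u v] H by (simp add: P_def)
    next
      case False
      have "N \<ge> 0" using H(1) norm_ge_zero order_trans by blast
      then have "cmod (P t x u v) \<le> K0 * N\<^sup>2" using H \<rho> False by (intro PB) auto
      also have "\<dots> \<le> K * N\<^sup>2" using K by (intro mult_right_mono) auto
      finally show ?thesis by (simp add: P_def)
    qed
    show "cmod ((F (t, x, u, v) - a x * t - lam x * u) - (F (t, x, u', v') - a x * t - lam x * u'))
          \<le> K * N * (cmod (u - u') + cmod (v - v'))"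
      if H: "cmod t \<le> N" "cmod x < \<rho>" "cmod u \<le> N" "cmod v \<le> N" "cmod u' \<le> N" "cmod v' \<le> N" "N \<le> \<rho>" for t x u v u' v' N
    proof (cases "N = 0")
      case True
      then show ?thesis using Pz[of t x u v] Pz[of t x u' v'] H by (simp add: P_def)
    next
      case False
      have N: "N \<ge> 0" using H(1) norm_ge_zero order_trans by blast
      then have "cmod (P t x u v - P t x u' v') \<le> 4 * K0 * N * (cmod (u - u') + cmod (v - v'))" using H \<rho> False by (intro PL) auto
      also have "\<dots> \<le> K * N * (cmod (u - u') + cmod (v - v'))" using K N by (intro mult_right_mono) auto
      finally show ?thesis by (simp add: P_def)
    qed
    show "cmod ((F (t, x, u, v) - a x * t - lam x * u) - (F (t, x', u, v) - a x' * t - lam x' * u)) \<le> K * N\<^sup>2 * cmod (x - x')"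
      if H: "cmod t \<le> N" "cmod x < \<rho>" "cmod x' < \<rho>" "cmod u \<le> N" "cmod v \<le> N" "N \<le> \<rho>" for t x x' u v N
    proof (cases "N = 0")
      case True
      then show ?thesis using Pz[of t x u v] Pz[of t x' u v] H by (simp add: P_def)
    next
      case False
      have N: "N \<ge> 0" using H(1) norm_ge_zero order_trans by blast
      then have "cmod (P t x u v - P t x' u v) \<le> 2 * K0 / r * N\<^sup>2 * cmod (x - x')" using H \<rho> False by (intro PX) auto
      also have "\<dots> \<le> K * N\<^sup>2 * cmod (x - x')" using K N by (intro mult_right_mono) auto
      finally show ?thesis by (simp add: P_def)
    qed
  qed (use \<rho> K c F poly Rel r in auto)
  then show ?thesis by (rule that)
qed

section \<open>The linear singular equation\<close>

definition cone_dom :: "real \<Rightarrow> real \<Rightarrow> (complex \<times> complex) set" where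
  "cone_dom A R = {(t, x). A * cmod t + cmod x < R}"

lemma open_cone_dom: "open (cone_dom A R)"
  unfolding cone_dom_def case_prod_unfold by (intro open_Collect_less continuous_intros)

text \<open>Comparison of coefficients in powers of \<open>t\<close>: a coefficient
  \<open>b j\<close> of \<open>k\<close> is divided by \<open>j - lam\<close>. Since the real part
  of this divisor is at least \<open>c\<close>, there are no small divisors and the series of
  \<open>z\<close> converges on the whole cone.\<close>

lemma linear_singular_solve:
  assumes k: "k holomorphic2_on cone_dom A R" and A: "A > 0" and lam: "lam holomorphic_on ball 0 R"
    and c: "c > 0" and Re_lam: "\<And>x. cmod x < R \<Longrightarrow> Re (lam x) \<le> - c"
  obtains z where "z holomorphic2_on cone_dom A R"
    "\<And>t x. (t, x) \<in> cone_dom A R \<Longrightarrow> t * du_dt z (t, x) - lam x * z (t, x) = k (t, x)"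
proof -
  define b where "b j x = (deriv ^^ j) (\<lambda>s. k (s, x)) 0 / fact j" for j x
  define e where "e j p = b j (snd p) / (of_nat j - lam (snd p)) * fst p ^ j" for j and p :: "complex \<times> complex"
  have nz: "c \<le> cmod (of_nat j - lam x)" if "cmod x < R" for j x
  proof -
    have "c \<le> Re (of_nat j - lam x)" using Re_lam[OF that] by simp
    also have "\<dots> \<le> cmod (of_nat j - lam x)" by (rule complex_Re_le_cmod)
    finally show ?thesis .
  qed
  then have nz0: "of_nat j - lam x \<noteq> 0" if "x \<in> ball 0 R" for j x
    using c that by (metis mem_ball_0 norm_zero not_less)
  have sub: "cone_dom A R \<subseteq> UNIV \<times> ball 0 R"
    using A by (auto simp: cone_dom_def) (smt (verit) mult_nonneg_nonneg norm_ge_zero)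
  have kj: "(du_dt ^^ j) k holomorphic2_on cone_dom A R" for j
    by (induction j) (auto intro: k holo2_du_dt)
  have kj_eq: "(du_dt ^^ j) k (t, x) = (deriv ^^ j) (\<lambda>s. k (s, x)) t" for j t x
    by (induction j arbitrary: t) (simp_all add: du_dt_def)
  have hol_b: "b j holomorphic_on ball 0 R" for j
  proof -
    have "(\<lambda>y. (du_dt ^^ j) k (0, y)) holomorphic_on ball 0 R"
      by (rule holo2_slices(2)[OF kj]) (auto simp: cone_dom_def)
    then show ?thesis unfolding b_def[abs_def] kj_eq by (intro holomorphic_intros) auto
  qed
  have hol_e: "e j holomorphic2_on cone_dom A R" for j
  proof -
    have "(\<lambda>x. b j x / (of_nat j - lam x)) holomorphic_on ball 0 R"
      by (intro holomorphic_intros hol_b lam nz0)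
    then have "(\<lambda>p. b j (snd p) / (of_nat j - lam (snd p))) holomorphic2_on cone_dom A R"
      by (rule holo2_snd_compose[OF open_cone_dom]) (use sub in auto)
    then show ?thesis unfolding e_def[abs_def]
      by (intro holo2_mult holo2_fst_power open_cone_dom)
  qed
  define f where "f n p = (\<Sum>j<n. e j p)" for n p
  define z where "z p = (\<Sum>j. e j p)" for p
  have hol_f: "f n holomorphic2_on cone_dom A R" for n
    unfolding f_def[abs_def] by (intro holo2_sum open_cone_dom hol_e)
  have ul: "\<exists>d>0. cball p d \<subseteq> cone_dom A R \<and> uniform_limit (cball p d) f z sequentially" if "p \<in> cone_dom A R" for p
  proof -
    obtain t0 x0 where p: "p = (t0, x0)" by (cases p)
    \<comment> \<open>Moving by \<open>2 * d\<close> in \<open>t\<close> and by \<open>d\<close> in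
      \<open>x\<close> uses up half of the gap. The coefficients are then estimated on the circle of
      radius \<open>cmod t0 + 2 * d\<close>, while \<open>t\<close> stays within
      \<open>cmod t0 + d\<close>; the quotient of these radii is the geometric ratio
      \<open>q\<close>.\<close>
    define d where "d = (R - A * cmod t0 - cmod x0) / (2 * (2 * A + 1))"
    have d: "d > 0" using that A by (auto simp: d_def p cone_dom_def)
    have "d * (2 * (2 * A + 1)) = R - A * cmod t0 - cmod x0" using A by (simp add: d_def)
    moreover have "A * d > 0" using A d by simp
    ultimately have dR: "A * (cmod t0 + 2 * d) + (cmod x0 + d) < R" using d by (simp add: algebra_simps)
    define r where "r = cmod t0 + 2 * d"
    have r: "r > 0" using d by (simp add: r_def add_nonneg_pos)
    have incone: "cball 0 r \<times> cball x0 d \<subseteq> cone_dom A R"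
    proof clarify
      fix t x :: complex assume "t \<in> cball 0 r" "x \<in> cball x0 d"
      then have "cmod t \<le> r" "cmod x \<le> cmod x0 + d"
        using norm_triangle_sub[of x x0] by (auto simp: dist_norm norm_minus_commute)
      then have "A * cmod t + cmod x \<le> A * r + (cmod x0 + d)"
        using A by (intro add_mono mult_left_mono) auto
      then show "(t, x) \<in> cone_dom A R" using dR by (simp add: cone_dom_def r_def)
    qed
    have "bounded (k ` (cball 0 r \<times> cball x0 d))"
      by (intro compact_imp_bounded compact_continuous_image compact_Times
            continuous_on_subset[OF holo2_continuous[OF k] incone]) auto
    then obtain M where M: "M > 0" "\<And>p. p \<in> cball 0 r \<times> cball x0 d \<Longrightarrow> cmod (k p) \<le> M"
      unfolding bounded_pos by auto
    define q where "q = (cmod t0 + d) / r"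
    have q: "0 \<le> q" "q < 1" using d r by (auto simp: q_def r_def)
    have in_d: "cmod t \<le> cmod t0 + d \<and> x \<in> cball x0 d" if "(t, x) \<in> cball p d" for t x
      using that dist_fst_le[of p "(t, x)"] dist_snd_le[of p "(t, x)"] norm_triangle_sub[of t t0]
      by (auto simp: p dist_norm norm_minus_commute)
    have est: "cmod (e j (t, x)) \<le> M / c * q ^ j" if "(t, x) \<in> cball p d" for j t x
    proof -
      have x: "x \<in> cball x0 d" and t: "cmod t \<le> cmod t0 + d" using in_d that by auto
      have "(0, x) \<in> cone_dom A R" using incone x r by auto
      then have xR: "cmod x < R" using sub by auto
      have h: "(\<lambda>s. k (s, x)) holomorphic_on cball 0 r"
        using incone x by (intro holo2_slices(1)[OF k]) auto
      have "cmod ((deriv ^^ j) (\<lambda>s. k (s, x)) 0) \<le> fact j * M / r ^ j"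
        by (rule Cauchy_inequality)
          (use h r x M(2) in \<open>auto intro: holomorphic_on_imp_continuous_on holomorphic_on_subset\<close>)
      then have bj: "cmod (b j x) \<le> M / r ^ j"
        by (simp add: b_def norm_divide field_simps)
      have "cmod (e j (t, x)) = cmod (b j x) / cmod (of_nat j - lam x) * cmod t ^ j"
        by (simp add: e_def norm_mult norm_divide norm_power)
      also have "\<dots> \<le> (M / r ^ j) / c * (cmod t0 + d) ^ j"
        using bj nz[OF xR, of j] t c M r by (intro mult_mono frac_le power_mono) auto
      also have "\<dots> = M / c * q ^ j" by (simp add: q_def power_divide)
      finally show ?thesis .
    qed
    have "uniform_limit (cball p d) (\<lambda>n p. \<Sum>j<n. e j p) (\<lambda>p. \<Sum>j. e j p) sequentially"
      by (rule Weierstrass_m_test[where M = "\<lambda>j. M / c * q ^ j"])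
        (use est q in \<open>auto intro!: summable_mult summable_geometric\<close>)
    moreover have "cball p d \<subseteq> cone_dom A R"
    proof clarify
      fix t x assume tx: "(t, x) \<in> cball p d"
      show "(t, x) \<in> cone_dom A R" using in_d[OF tx] incone d by (auto simp: r_def)
    qed
    ultimately show ?thesis using d unfolding f_def[abs_def] z_def[abs_def] by blast
  qed
  note lim = holo2_uniform_limit[OF hol_f ul]
  show ?thesis
  proof (rule that)
    show "z holomorphic2_on cone_dom A R" by (rule lim(1))
    fix t x assume tx: "(t, x) \<in> cone_dom A R"
    then have xR: "cmod x < R" using sub by auto
    have part: "t * du_dt (f n) (t, x) - lam x * f n (t, x) = (\<Sum>j<n. b j x * t ^ j)" for n
    proof -
      have "((\<lambda>s. f n (s, x)) has_field_derivative (\<Sum>j<n. b j x / (of_nat j - lam x) * (of_nat j * t ^ (j - 1)))) (at t)"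
        unfolding f_def e_def using nz0[of x] xR by (auto intro!: derivative_eq_intros sum.cong)
      then have "du_dt (f n) (t, x) = (\<Sum>j<n. b j x / (of_nat j - lam x) * (of_nat j * t ^ (j - 1)))"
        by (simp add: du_dt_def DERIV_imp_deriv)
      then have "t * du_dt (f n) (t, x) - lam x * f n (t, x) =
         (\<Sum>j<n. t * (b j x / (of_nat j - lam x) * (of_nat j * t ^ (j - 1))) - lam x * (b j x / (of_nat j - lam x) * t ^ j))"
        by (simp add: f_def e_def sum_distrib_left sum_subtractf)
      also have "\<dots> = (\<Sum>j<n. b j x * t ^ j)"
      proof (rule sum.cong[OF refl])
        fix j
        \<comment> \<open>The truncated exponent \<open>j - 1\<close> is harmless at
          \<open>j = 0\<close>, where the factor \<open>of_nat j\<close> makes both sides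
          zero.\<close>
        have tj: "t * (of_nat j * t ^ (j - 1)) = of_nat j * t ^ j" by (cases j) auto
        have "t * (B * (of_nat j * t ^ (j - 1))) - L * (B * t ^ j) = B * ((of_nat j - L) * t ^ j)" for B L
          using arg_cong[OF tj, of "(*) B"] by (simp add: algebra_simps)
        then have "t * (b j x / (of_nat j - lam x) * (of_nat j * t ^ (j - 1))) - lam x * (b j x / (of_nat j - lam x) * t ^ j)
           = b j x / (of_nat j - lam x) * ((of_nat j - lam x) * t ^ j)"
          .
        also have "\<dots> = b j x * t ^ j" using nz[OF xR, of j] c by auto
        finally show "t * (b j x / (of_nat j - lam x) * (of_nat j * t ^ (j - 1))) - lam x * (b j x / (of_nat j - lam x) * t ^ j) = b j x * t ^ j" .
      qed
      finally show ?thesis .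
    qed
    have "(\<lambda>n. t * du_dt (f n) (t, x) - lam x * f n (t, x)) \<longlonglongrightarrow> t * du_dt z (t, x) - lam x * z (t, x)"
      by (intro tendsto_intros lim(2,4) tx)
    moreover have "(\<lambda>j. b j x * t ^ j) sums k (t, x)"
    proof -
      have "(\<lambda>s. k (s, x)) holomorphic_on ball 0 ((R - cmod x) / A)"
        by (rule holo2_slices(1)[OF k]) (use A in \<open>auto simp: cone_dom_def field_simps\<close>)
      from holomorphic_power_series[OF this, of t] show ?thesis
        using tx A by (auto simp: b_def cone_dom_def field_simps)
    qed
    then have "(\<lambda>n. t * du_dt (f n) (t, x) - lam x * f n (t, x)) \<longlonglongrightarrow> k (t, x)"
      unfolding part sums_def .
    ultimately show "t * du_dt z (t, x) - lam x * z (t, x) = k (t, x)" by (rule LIMSEQ_unique)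
  qed
qed

section \<open>Estimates along rays towards t = 0\<close>

text \<open>The integrating factor \<open>s powr (- l)\<close> turns the equation into a formula for
  the derivative of \<open>s powr (- l) * y (s * t)\<close>. As \<open>Re l < 0\<close>, the factor
  has modulus at most 1 and tends to 0 with \<open>s\<close>, so no initial value appears.
  \<open>G\<close> is an antiderivative of a majorant of \<open>|q (s * t)| / s\<close>, left for
  each application to choose.\<close>

lemma ray_bound:
  fixes y y' q :: "complex \<Rightarrow> complex" and G G' :: "real \<Rightarrow> real"
  assumes y: "\<And>s. 0 \<le> s \<Longrightarrow> s \<le> 1 \<Longrightarrow> (y has_field_derivative y' (of_real s * t)) (at (of_real s * t))"
    and eq: "\<And>s. 0 < s \<Longrightarrow> s < 1 \<Longrightarrow> of_real s * t * y' (of_real s * t) - l * y (of_real s * t) = q (of_real s * t)"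
    and l: "Re l < 0"
    and G: "continuous_on {0..1} G" "\<And>s. 0 < s \<Longrightarrow> s < 1 \<Longrightarrow> (G has_real_derivative G' s) (at s)"
    and q: "\<And>s. 0 < s \<Longrightarrow> s < 1 \<Longrightarrow> cmod (q (of_real s * t)) \<le> s * G' s"
  shows "cmod (y t) \<le> G 1 - G 0"
proof -
  define \<phi> where "\<phi> s = (of_real s :: complex) powr (- l) * y (of_real s * t)" for s :: real
  define \<phi>' where "\<phi>' s = (of_real s :: complex) powr (- l - 1) * (of_real s * t * y' (of_real s * t) - l * y (of_real s * t))" for s :: real
  have der: "(\<phi> has_vector_derivative \<phi>' s) (at s)" if "0 < s" "s \<le> 1" for s
  proof -
    have "((\<lambda>w. w * t) has_field_derivative t) (at (of_real s))" by (auto intro!: derivative_eq_intros)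
    from DERIV_chain2[OF y this] that
    have 1: "((\<lambda>w. y (w * t)) has_field_derivative y' (of_real s * t) * t) (at (of_real s))" by simp
    have 2: "((\<lambda>w. w powr (- l)) has_field_derivative (- l * of_real s powr (- l - 1))) (at (of_real s :: complex))"
      using that by (intro has_field_derivative_powr) (auto simp: complex_nonpos_Reals_iff)
    have 3: "(of_real s :: complex) powr (- l) = of_real s powr (- l - 1) * of_real s"
      using that by (simp add: powr_diff)
    have "((\<lambda>w. w powr (- l) * y (w * t)) has_field_derivative \<phi>' s) (at (of_real s :: complex))"
      by (rule DERIV_cong[OF DERIV_mult[OF 2 1]]) (simp add: \<phi>'_def 3 algebra_simps)
    from has_vector_derivative_real_field[OF this] show ?thesis unfolding \<phi>_def .
  qed
  have "cmod (\<phi> 1 - \<phi> 0) \<le> G 1 - G 0"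
  proof (rule differentiable_bound_general[where f' = \<phi>' and \<phi>' = G'])
    show "continuous_on {0..1} \<phi>"
      unfolding continuous_on_eq_continuous_within
    proof
      fix s :: real assume s: "s \<in> {0..1}"
      show "continuous (at s within {0..1}) \<phi>"
      proof (cases "s = 0")
        case False
        then have "isCont \<phi> s" using der[of s] s has_vector_derivative_continuous by force
        then show ?thesis by (rule continuous_at_imp_continuous_within)
      next
        case True
        have yc: "continuous (at 0) y" using y[of 0] DERIV_isCont by force
        \<comment> \<open>The convention \<open>0 powr (- l) = 0\<close> gives \<open>\<phi>\<close>
          the value 0 at 0, and this has to be matched with the limit: a positive power of
          \<open>s\<close> times a bounded function.\<close>
        have "((\<lambda>s. s powr (- Re l) * cmod (y (of_real s * t))) \<longlongrightarrow> 0 * cmod (y 0)) (at (0::real) within {0..1})"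
        proof (intro tendsto_mult tendsto_norm)
          show "((\<lambda>s. s powr - Re l) \<longlongrightarrow> 0) (at (0::real) within {0..1})"
            by (rule tendsto_zero_powrI[where b = "- Re l"]) (use l in \<open>auto intro!: tendsto_eq_intros simp: eventually_at_filter\<close>)
          have "((\<lambda>s. of_real s * t) \<longlongrightarrow> 0) (at (0::real) within {0..1})"
            by (auto intro!: tendsto_eq_intros)
          then show "((\<lambda>s. y (of_real s * t)) \<longlongrightarrow> y 0) (at (0::real) within {0..1})"
            using yc isCont_tendsto_compose by blast
        qed
        moreover have "\<forall>\<^sub>F s in at (0::real) within {0..1}. cmod (\<phi> s) = s powr (- Re l) * cmod (y (of_real s * t))"
          unfolding eventually_at_filter by (auto simp: \<phi>_def norm_mult norm_powr_real_powr)
        ultimately have "((\<lambda>s. cmod (\<phi> s)) \<longlongrightarrow> 0) (at 0 within {0..1})"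
          using tendsto_cong by fastforce
        then show ?thesis using True tendsto_norm_zero_cancel[of \<phi>] by (simp add: continuous_within \<phi>_def[of 0])
      qed
    qed
    show "(G has_vector_derivative G' s) (at s)" if "0 < s" "s < 1" for s
      using G(2)[OF that] by (simp add: has_real_derivative_iff_has_vector_derivative)
    show "cmod (\<phi>' s) \<le> G' s" if s: "0 < s" "s < 1" for s
    proof -
      have "0 \<le> s * G' s" using q[OF s] norm_ge_zero order_trans by blast
      then have G'0: "G' s \<ge> 0" using s by (simp add: zero_le_mult_iff)
      have "cmod (\<phi>' s) = s powr (- Re l - 1) * cmod (q (of_real s * t))"
        using s by (simp add: \<phi>'_def eq norm_mult norm_powr_real_powr)
      also have "\<dots> \<le> s powr (- Re l - 1) * (s * G' s)" by (intro mult_left_mono q s) auto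
      also have "\<dots> = s powr (- Re l) * G' s" using s by (simp add: powr_diff)
      also have "\<dots> \<le> 1 * G' s" using s l G'0 by (intro mult_right_mono powr_le1) auto
      finally show ?thesis by simp
    qed
  qed (use G der in auto)
  then show ?thesis by (simp add: \<phi>_def)
qed

text \<open>Replaces the chain rule: Lipschitz bounds of \<open>P\<close> pass through difference
  quotients to a bound on the \<open>x\<close>-derivative of the nonlinear term, and no partial
  derivative of \<open>P\<close> has to be estimated.\<close>

lemma deriv_norm_le_of_increments:
  fixes f g h :: "complex \<Rightarrow> complex"
  assumes "(f has_field_derivative f') (at x)" "(g has_field_derivative g') (at x)" "(h has_field_derivative h') (at x)"
    and "\<forall>\<^sub>F y in at x. cmod (f y - f x) \<le> \<alpha> * cmod (y - x) + \<beta> * (cmod (g y - g x) + cmod (h y - h x))"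
  shows "cmod f' \<le> \<alpha> + \<beta> * (cmod g' + cmod h')"
proof (rule tendsto_le)
  have D: "((\<lambda>y. (f y - f x) / (y - x)) \<longlongrightarrow> f') (at x)" "((\<lambda>y. (g y - g x) / (y - x)) \<longlongrightarrow> g') (at x)"
    "((\<lambda>y. (h y - h x) / (y - x)) \<longlongrightarrow> h') (at x)"
    using assms(1-3) by (simp_all add: has_field_derivative_iff)
  show "((\<lambda>y. cmod ((f y - f x) / (y - x))) \<longlongrightarrow> cmod f') (at x)"
    by (intro tendsto_intros D)
  show "((\<lambda>y. \<alpha> + \<beta> * (cmod ((g y - g x) / (y - x)) + cmod ((h y - h x) / (y - x)))) \<longlongrightarrow> \<alpha> + \<beta> * (cmod g' + cmod h')) (at x)"
    by (intro tendsto_intros D)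
  have "\<forall>\<^sub>F y in at x. y \<noteq> x" by (simp add: eventually_at_filter)
  with assms(4) show "\<forall>\<^sub>F y in at x. cmod ((f y - f x) / (y - x))
      \<le> \<alpha> + \<beta> * (cmod ((g y - g x) / (y - x)) + cmod ((h y - h x) / (y - x)))"
  proof eventually_elim
    case (elim y)
    then have "cmod (y - x) > 0" by simp
    with elim show ?case by (simp add: norm_divide field_simps)
  qed
qed auto

text \<open>The \<open>x\<close>-derivative solves an equation with the same singular operator and
  one more source term, so the estimates along rays apply to it again.\<close>

lemma singular_equation_du_dx:
  assumes z: "z holomorphic2_on S" and lam: "lam holomorphic_on X" "open X" "S \<subseteq> UNIV \<times> X" and k: "k holomorphic2_on S"
    and eq: "\<And>t x. (t, x) \<in> S \<Longrightarrow> t * du_dt z (t, x) - lam x * z (t, x) = k (t, x)" and tx: "(t, x) \<in> S"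
  shows "t * du_dt (du_dx z) (t, x) - lam x * du_dx z (t, x) = du_dx k (t, x) + deriv lam x * z (t, x)"
proof -
  have "(lam has_field_derivative deriv lam x) (at x)"
    using lam tx by (intro holomorphic_derivI) auto
  note D = DERIV_diff[OF DERIV_cmult[OF holo2_partials(2)[OF holo2_du_dt[OF z] tx], of t] DERIV_mult[OF this holo2_partials(2)[OF z tx]]]
  have "open (Pair t -` S)" using holo2_open[OF z] by (intro open_vimage continuous_intros)
  then have "((\<lambda>y. k (t, y)) has_field_derivative t * du_dx (du_dt z) (t, x) - (deriv lam x * z (t, x) + du_dx z (t, x) * lam x)) (at x)"
    using tx by (intro has_field_derivative_transform_within_open[OF D]) (auto simp: eq)
  from DERIV_unique[OF this holo2_partials(2)[OF k tx]] show ?thesis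
    by (simp add: du_dt_du_dx[OF z tx] algebra_simps)
qed

lemma cone_dom_gap: "(t, x) \<in> cone_dom A R \<longleftrightarrow> 0 < R - cmod x - A * cmod t"
  by (auto simp: cone_dom_def)

lemma cone_dom_ray:
  assumes "(t, x) \<in> cone_dom A R" "A \<ge> 0" "0 \<le> s" "s \<le> 1"
  shows "(of_real s * t, x) \<in> cone_dom A R" "R - cmod x - A * cmod t \<le> R - cmod x - A * (s * cmod t)"
proof -
  have "A * (s * cmod t) \<le> A * (1 * cmod t)"
    using assms by (intro mult_left_mono mult_right_mono) auto
  then show "R - cmod x - A * cmod t \<le> R - cmod x - A * (s * cmod t)"
    "(of_real s * t, x) \<in> cone_dom A R"
    using assms(1) \<open>0 \<le> s\<close> by (simp_all add: cone_dom_def norm_mult)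
qed

lemma cone_dom_vertical_ball:
  assumes "(t, x) \<in> cone_dom A R" "\<theta> \<le> 1" "w \<in> ball x (\<theta> * (R - cmod x - A * cmod t))"
  shows "(1 - \<theta>) * (R - cmod x - A * cmod t) \<le> R - cmod w - A * cmod t" "(t, w) \<in> cone_dom A R"
proof -
  have "cmod w - cmod x < \<theta> * (R - cmod x - A * cmod t)"
    using assms(3) norm_triangle_sub[of w x] by (auto simp: dist_norm norm_minus_commute)
  then show "(1 - \<theta>) * (R - cmod x - A * cmod t) \<le> R - cmod w - A * cmod t" "(t, w) \<in> cone_dom A R"
    using assms(1,2) mult_right_mono[OF assms(2), of "R - cmod x - A * cmod t"]
    by (auto simp: cone_dom_gap algebra_simps)
qed

text \<open>The power -1/2 of the gap is integrable along a ray up to the boundary of the cone, so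
  \<open>p\<close> itself gets a bound without singularity; the power -3/2 left by Cauchy's estimate
  for the source integrates back to -1/2. The lemma will be applied to \<open>p = du_dx w\<close>,
  so that it bounds the first two \<open>x\<close>-derivatives of an iterate
  \<open>w\<close>.\<close>

lemma singular_equation_gain:
  assumes p: "p holomorphic2_on cone_dom A R" and q: "q holomorphic2_on cone_dom A R"
    and A: "A > 0" and R: "R \<le> 1" and lam: "lam holomorphic_on ball 0 R"
    and Re_lam: "\<And>x. cmod x < R \<Longrightarrow> Re (lam x) < 0"
    and L: "\<And>x. cmod x < R \<Longrightarrow> cmod (deriv lam x) \<le> L"
    and eq: "\<And>t x. (t, x) \<in> cone_dom A R \<Longrightarrow> t * du_dt p (t, x) - lam x * p (t, x) = q (t, x)"
    and C: "C \<ge> 0" and qC: "\<And>t x. (t, x) \<in> cone_dom A R \<Longrightarrow> cmod (q (t, x)) \<le> C * (cmod t)\<^sup>2 / sqrt (R - cmod x - A * cmod t)"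
    and tx: "(t, x) \<in> cone_dom A R"
  shows "cmod (p (t, x)) \<le> 2 * C / A * cmod t"
    and "cmod (du_dx p (t, x)) \<le> 2 * (C * (4 + L)) / A * cmod t / sqrt (R - cmod x - A * cmod t)"
proof -
  have sub: "cone_dom A R \<subseteq> UNIV \<times> ball 0 R"
    using A by (auto simp: cone_dom_def) (smt (verit) mult_nonneg_nonneg norm_ge_zero)
  have xR: "cmod x < R" if "(t, x) \<in> cone_dom A R" for t x using that sub by auto
  have L0: "L \<ge> 0" using L[OF xR[OF tx]] norm_ge_zero order_trans by blast
  define D where "D t x s = R - cmod x - A * (s * cmod t)" for s :: real and t x :: complex
  have D1: "D t x 1 = R - cmod x - A * cmod t" for t x by (simp add: D_def)
  have D: "0 < D t x 1" "D t x 1 \<le> D t x s" "D t x s \<le> 1" "0 < D t x s" "(of_real s * t, x) \<in> cone_dom A R" 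
     "R - cmod x - A * cmod (of_real s * t) = D t x s" if "(t, x) \<in> cone_dom A R" "0 \<le> s" "s \<le> 1" for t x s
  proof -
    show "0 < D t x 1" "D t x 1 \<le> D t x s" "(of_real s * t, x) \<in> cone_dom A R"
      using cone_dom_ray[OF that(1) _ that(2,3)] A that(1) by (auto simp: D_def cone_dom_gap)
    then show "0 < D t x s" by simp
    show "R - cmod x - A * cmod (of_real s * t) = D t x s" using that by (simp add: D_def norm_mult)
    have "0 \<le> A * (s * cmod t)" using that A by simp
    then show "D t x s \<le> 1" using R norm_ge_zero[of x] unfolding D_def by linarith
  qed
  have dD: "(D t x has_real_derivative - (A * cmod t)) (at s)" for t x s
    unfolding D_def by (auto intro!: derivative_eq_intros)
  have qs: "cmod (q (of_real s * t, x)) \<le> s * (C * (cmod t)\<^sup>2 / sqrt (D t x s))" if "(t, x) \<in> cone_dom A R" "0 < s" "s < 1" for t x s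
  proof -
    have "cmod (q (of_real s * t, x)) \<le> C * (cmod (of_real s * t))\<^sup>2 / sqrt (D t x s)"
      using qC[of "of_real s * t" x] D(5,6)[of t x s] that by simp
    also have "\<dots> = s * (s * (C * (cmod t)\<^sup>2 / sqrt (D t x s)))"
      using that by (simp add: norm_mult power_mult_distrib power2_eq_square)
    also have "\<dots> \<le> s * (1 * (C * (cmod t)\<^sup>2 / sqrt (D t x s)))"
      using that C D(4)[of t x s] by (intro mult_left_mono mult_right_mono) auto
    finally show ?thesis by simp
  qed
  have py: "((\<lambda>s. p (s, x)) has_field_derivative du_dt p (of_real s * t, x)) (at (of_real s * t))"
    if "(t, x) \<in> cone_dom A R" "0 \<le> s" "s \<le> 1" for t x s
    by (rule holo2_partials(1)[OF p D(5)[OF that]])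
  show "cmod (p (t, x)) \<le> 2 * C / A * cmod t"
  proof -
    \<comment> \<open>In \<open>s\<close> the derivative of \<open>sqrt (D t x s)\<close> is
      \<open>- A * cmod t / (2 * sqrt (D t x s))\<close>; this is where one factor
      \<open>cmod t\<close> is traded for \<open>1 / A\<close>.\<close>
    define G where "G s = - (2 * C * cmod t / A) * sqrt (D t x s)" for s
    have "cmod (p (t, x)) \<le> G 1 - G 0"
    proof (rule ray_bound[of "\<lambda>s. p (s, x)" "\<lambda>s. du_dt p (s, x)" t "lam x" "\<lambda>s. q (s, x)" G "\<lambda>s. C * (cmod t)\<^sup>2 / sqrt (D t x s)"])
      show "continuous_on {0..1} G" unfolding G_def D_def by (intro continuous_intros)
      show "(G has_real_derivative C * (cmod t)\<^sup>2 / sqrt (D t x s)) (at s)" if "0 < s" "s < 1" for s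
        unfolding G_def
        by (rule DERIV_cong[OF DERIV_cmult[OF DERIV_chain2[OF DERIV_real_sqrt dD]]])
          (use that D(4)[OF tx, of s] A in \<open>auto simp: power2_eq_square field_simps\<close>)
    qed (use py tx eq D(5)[OF tx] qs Re_lam xR in auto)
    also have "\<dots> \<le> (2 * C * cmod t / A) * sqrt (D t x 0)"
      using C A D(1)[OF tx, of 0] by (simp add: G_def)
    also have "\<dots> \<le> (2 * C * cmod t / A) * 1"
      using C A D(3)[OF tx, of 0] by (intro mult_left_mono) auto
    finally show ?thesis by simp
  qed
  \<comment> \<open>A second bound on \<open>p\<close>, with the gap frozen at its smallest value
    along the ray. It lacks \<open>1 / A\<close> but is quadratic in \<open>t\<close>, as the source
    term \<open>deriv lam x * p\<close> of the differentiated equation must be.\<close>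
  have p2: "cmod (p (t, x)) \<le> C * (cmod t)\<^sup>2 / sqrt (D t x 1)" if tx: "(t, x) \<in> cone_dom A R" for t x
  proof -
    define G where "G s = s * (C * (cmod t)\<^sup>2 / sqrt (D t x 1))" for s
    have "cmod (p (t, x)) \<le> G 1 - G 0"
    proof (rule ray_bound[of "\<lambda>s. p (s, x)" "\<lambda>s. du_dt p (s, x)" t "lam x" "\<lambda>s. q (s, x)" G "\<lambda>s. C * (cmod t)\<^sup>2 / sqrt (D t x 1)"])
      show "continuous_on {0..1} G" unfolding G_def by (intro continuous_intros)
      show "(G has_real_derivative C * (cmod t)\<^sup>2 / sqrt (D t x 1)) (at s)" if "0 < s" "s < 1" for s
        unfolding G_def by (rule DERIV_cong[OF DERIV_cmult_right[OF DERIV_ident]]) (rule mult_1)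
      show "cmod (q (of_real s * t, x)) \<le> s * (C * (cmod t)\<^sup>2 / sqrt (D t x 1))" if "0 < s" "s < 1" for s
      proof -
        have "s * (C * (cmod t)\<^sup>2 / sqrt (D t x s)) \<le> s * (C * (cmod t)\<^sup>2 / sqrt (D t x 1))"
          using that C D[OF tx, of s] by (intro mult_left_mono divide_left_mono) auto
        then show ?thesis using qs[OF tx that] by linarith
      qed
    qed (use py tx eq D(5)[OF tx] Re_lam xR in auto)
    then show ?thesis by (simp only: G_def mult_1 mult_zero_left diff_zero)
  qed
  define C' where "C' = C * (4 + L)"
  have C': "C' \<ge> 0" using C L0 by (simp add: C'_def)
  define q2 where "q2 p' = du_dx q p' + deriv lam (snd p') * p p'" for p'
  have q2C: "cmod (q2 (t, x)) \<le> C' * (cmod t)\<^sup>2 / (D t x 1 * sqrt (D t x 1))" if tx: "(t, x) \<in> cone_dom A R" for t x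
  proof -
    define d where "d = D t x 1"
    have d: "0 < d" "d \<le> 1" using D[OF tx, of 1] by (auto simp: d_def)
    have dd: "d = R - cmod x - A * cmod t" by (simp add: d_def D_def)
    \<comment> \<open>On the vertical disc of half the gap the square root of the gap is at least
      \<open>sqrt d / 2\<close>. This factor 2 and the Cauchy radius \<open>d / 2\<close> make up
      the 4 in \<open>4 + L\<close>.\<close>
    have qw: "cmod (q (t, w)) \<le> 2 * (C * (cmod t)\<^sup>2 / sqrt d)" if "w \<in> ball x (d / 2)" for w
    proof -
      have w: "d / 2 \<le> R - cmod w - A * cmod t" "(t, w) \<in> cone_dom A R"
        using cone_dom_vertical_ball[OF tx, of "1/2" w] that by (auto simp: dd)
      have "sqrt d / 2 = sqrt (d / 4)" by (simp add: real_sqrt_divide)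
      also have "\<dots> \<le> sqrt (R - cmod w - A * cmod t)" using w d by (intro real_sqrt_le_mono) linarith
      finally have "C * (cmod t)\<^sup>2 / sqrt (R - cmod w - A * cmod t) \<le> C * (cmod t)\<^sup>2 / (sqrt d / 2)"
        using C d w by (intro divide_left_mono mult_pos_pos) auto
      then show ?thesis using qC[OF w(2)] by (simp add: mult_ac)
    qed
    have "(\<lambda>y. q (t, y)) holomorphic_on ball x (d / 2)"
      using cone_dom_vertical_ball(2)[OF tx, of "1/2"] by (intro holo2_slices(2)[OF q]) (auto simp: dd)
    then have "cmod (du_dx q (t, x)) \<le> 2 * (C * (cmod t)\<^sup>2 / sqrt d) / (d / 2)"
      unfolding du_dx_def prod.case by (rule deriv_norm_le) (use d qw in auto)
    then have 1: "cmod (du_dx q (t, x)) \<le> 4 * (C * (cmod t)\<^sup>2 / (d * sqrt d))"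
      by (simp add: mult.commute)
    have "cmod (deriv lam x * p (t, x)) \<le> L * (C * (cmod t)\<^sup>2 / sqrt d)"
      unfolding norm_mult using L[OF xR[OF tx]] p2[OF tx] L0 by (intro mult_mono) (auto simp: d_def)
    also have "\<dots> \<le> L * (C * (cmod t)\<^sup>2 / (d * sqrt d))"
      using d C L0 by (intro mult_left_mono divide_left_mono) (auto simp: mult_le_cancel_right1)
    finally have "cmod (q2 (t, x)) \<le> 4 * (C * (cmod t)\<^sup>2 / (d * sqrt d)) + L * (C * (cmod t)\<^sup>2 / (d * sqrt d))"
      unfolding q2_def using 1 by (intro norm_triangle_le) simp
    also have "\<dots> = C' * (cmod t)\<^sup>2 / (d * sqrt d)" by (simp add: C'_def add_divide_distrib[symmetric] algebra_simps)
    finally show ?thesis by (simp add: d_def)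
  qed
  have eq2: "t * du_dt (du_dx p) (t, x) - lam x * du_dx p (t, x) = q2 (t, x)" if "(t, x) \<in> cone_dom A R" for t x
    unfolding q2_def snd_conv using singular_equation_du_dx[OF p lam _ sub q eq that] by simp
  \<comment> \<open>An antiderivative of the power -3/2 of \<open>D t x s\<close>, up to constants;
    its value at \<open>s = 0\<close> has a favourable sign and is dropped.\<close>
  define G where "G s = (2 * C' * cmod t / A) * inverse (sqrt (D t x s))" for s
  have "cmod (du_dx p (t, x)) \<le> G 1 - G 0"
  proof (rule ray_bound[of "\<lambda>s. du_dx p (s, x)" "\<lambda>s. du_dt (du_dx p) (s, x)" t "lam x" "\<lambda>s. q2 (s, x)" G "\<lambda>s. C' * (cmod t)\<^sup>2 / (D t x s * sqrt (D t x s))"])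
    have "sqrt (R - cmod x - A * (s * cmod t)) \<noteq> 0" if "s \<in> {0..1}" for s
      using D(4)[OF tx, of s] that by (auto simp: D_def)
    then show "continuous_on {0..1} G" unfolding G_def D_def by (intro continuous_intros) auto
    show "(G has_real_derivative C' * (cmod t)\<^sup>2 / (D t x s * sqrt (D t x s))) (at s)" if "0 < s" "s < 1" for s
    proof -
      have Ds: "0 < D t x s" using D(4)[OF tx, of s] that by simp
      then have "D t x s = sqrt (D t x s) * sqrt (D t x s)" by simp
      then show ?thesis unfolding G_def
        by (intro DERIV_cong[OF DERIV_cmult[OF DERIV_inverse'[OF DERIV_chain2[OF DERIV_real_sqrt dD]]]])
          (use Ds A in \<open>auto simp: power2_eq_square field_simps\<close>)
    qed
    show "((\<lambda>s. du_dx p (s, x)) has_field_derivative du_dt (du_dx p) (of_real s * t, x)) (at (of_real s * t))"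
      if "0 \<le> s" "s \<le> 1" for s
      by (rule holo2_partials(1)[OF holo2_du_dx[OF p] D(5)[OF tx that]])
    show "cmod (q2 (of_real s * t, x)) \<le> s * (C' * (cmod t)\<^sup>2 / (D t x s * sqrt (D t x s)))" if "0 < s" "s < 1" for s
    proof -
      have s: "0 \<le> s" "s \<le> 1" using that by auto
      have "D (of_real s * t) x 1 = D t x s" using that by (simp add: D_def norm_mult)
      then have "cmod (q2 (of_real s * t, x)) \<le> C' * (cmod (of_real s * t))\<^sup>2 / (D t x s * sqrt (D t x s))"
        using q2C[OF D(5)[OF tx s]] by simp
      also have "\<dots> = s * (s * (C' * (cmod t)\<^sup>2 / (D t x s * sqrt (D t x s))))"
        using that by (simp add: norm_mult power_mult_distrib power2_eq_square)
      also have "\<dots> \<le> s * (1 * (C' * (cmod t)\<^sup>2 / (D t x s * sqrt (D t x s))))"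
        using that C' D(4)[OF tx s] by (intro mult_left_mono mult_right_mono) auto
      finally show ?thesis by simp
    qed
  qed (use eq2 D(5)[OF tx] Re_lam[OF xR[OF tx]] in auto)
  also have "\<dots> \<le> (2 * C' * cmod t / A) * inverse (sqrt (D t x 1))"
    using C' A D(4)[OF tx, of 0] by (simp add: G_def)
  finally show "cmod (du_dx p (t, x)) \<le> 2 * (C * (4 + L)) / A * cmod t / sqrt (R - cmod x - A * cmod t)"
    by (simp add: C'_def D1 divide_inverse mult_ac)
qed

section \<open>Existence of a holomorphic solution\<close>

context briot_bouquet_estimates
begin

section \<open>Domain, constants and invariant set of the iteration\<close>

text \<open>Half of \<open>\<rho>\<close>, so that the closed disc of radius \<open>R\<close> is a
  compact subset of the disc where \<open>a\<close> and \<open>lam\<close> are holomorphic.\<close>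

definition R where "R = \<rho> / 2"

text \<open>\<open>t * U\<^sub>0 x\<close> solves the linear part,
  \<open>t * w_t = a x * t + lam x * w\<close>. The source that remains for \<open>z\<close> is
  therefore quadratic in \<open>t\<close>.\<close>

definition U\<^sub>0 where "U\<^sub>0 x = a x / (1 - lam x)"

text \<open>One bound for four functions, taken with \<open>SOME\<close> to make it a constant of
  the locale; it exists by compactness.\<close>

definition B\<^sub>0 where "B\<^sub>0 = (SOME B. \<forall>x\<in>cball 0 R. cmod (U\<^sub>0 x) \<le> B \<and> cmod (deriv U\<^sub>0 x) \<le> B \<and>
   cmod (deriv (deriv U\<^sub>0) x) \<le> B \<and> cmod (deriv lam x) \<le> B)"

definition C\<^sub>0 where "C\<^sub>0 = B\<^sub>0 + 1"

text \<open>The three summands serve three purposes: \<open>C\<^sub>0\<close> keeps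
  \<open>C\<^sub>0 * cmod t\<close> below \<open>\<rho>\<close> on the cone,
  \<open>K * C\<^sub>0\<^sup>2\<close> reproduces the bound on an iterate, and the last one, twice
  the source constant times \<open>4 + B\<^sub>0\<close>, reproduces the bounds on its two
  \<open>x\<close>-derivatives.\<close>

definition A where "A = C\<^sub>0 + K * C\<^sub>0\<^sup>2 + 2 * ((3 + B\<^sub>0) * (K * C\<^sub>0\<^sup>2)) * (4 + B\<^sub>0)"

abbreviation \<Omega> where "\<Omega> \<equiv> cone_dom A R"

text \<open>The second derivative is included because the nonlinear term contains
  \<open>du_dx z\<close> and is differentiated in \<open>x\<close> once more.\<close>

definition iterates :: "(complex \<times> complex \<Rightarrow> complex) set" where
  "iterates = {z. z holomorphic2_on \<Omega> \<and> (\<forall>t x. (t, x) \<in> \<Omega> \<longrightarrow> cmod (z (t, x)) \<le> cmod t \<and> cmod (du_dx z (t, x)) \<le> cmod t \<and>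
     cmod (du_dx (du_dx z) (t, x)) \<le> cmod t / sqrt (R - cmod x - A * cmod t))}"

definition nonlin :: "(complex \<times> complex \<Rightarrow> complex) \<Rightarrow> complex \<times> complex \<Rightarrow> complex" where
  "nonlin z = (\<lambda>(t, x). P t x (t * U\<^sub>0 x + z (t, x)) (t * deriv U\<^sub>0 x + du_dx z (t, x)))"

lemma R: "0 < R" "R < \<rho>" "R \<le> 1" "ball 0 R \<subseteq> ball 0 \<rho>"
  using pos by (auto simp: R_def)

lemma one_minus_lam:
  assumes "cmod x < \<rho>"
  shows "1 - lam x \<noteq> 0"
proof
  assume "1 - lam x = 0"
  then have "Re (lam x) = 1" by (metis eq_iff_diff_eq_0 one_complex.sel(1))
  then show False using Re_lam[OF assms] pos by simp
qed

lemma hol_U0: "U\<^sub>0 holomorphic_on ball 0 \<rho>"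
  unfolding U\<^sub>0_def[abs_def] by (intro holomorphic_intros hol_a hol_lam one_minus_lam) auto

lemma hol_U0': "deriv U\<^sub>0 holomorphic_on ball 0 \<rho>"
  by (intro holomorphic_deriv hol_U0) auto

lemma B0:
  "cmod x < R \<Longrightarrow> cmod (U\<^sub>0 x) \<le> B\<^sub>0" "cmod x < R \<Longrightarrow> cmod (deriv U\<^sub>0 x) \<le> B\<^sub>0"
  "cmod x < R \<Longrightarrow> cmod (deriv (deriv U\<^sub>0) x) \<le> B\<^sub>0" "cmod x < R \<Longrightarrow> cmod (deriv lam x) \<le> B\<^sub>0" "B\<^sub>0 \<ge> 0"
proof -
  have bd: "\<exists>B. \<forall>x\<in>cball 0 R. cmod (f x) \<le> B" if "f holomorphic_on ball 0 \<rho>" for f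
  proof -
    have "bounded (f ` cball 0 R)"
      by (intro compact_imp_bounded compact_continuous_image holomorphic_on_imp_continuous_on holomorphic_on_subset[OF that])
        (use R in auto)
    then show ?thesis unfolding bounded_iff by auto
  qed
  have hols: "deriv (deriv U\<^sub>0) holomorphic_on ball 0 \<rho>" "deriv lam holomorphic_on ball 0 \<rho>"
    by (intro holomorphic_deriv hol_U0' hol_lam; simp)+
  obtain B1 B2 B3 B4 where B: "\<forall>x\<in>cball 0 R. cmod (U\<^sub>0 x) \<le> B1" "\<forall>x\<in>cball 0 R. cmod (deriv U\<^sub>0 x) \<le> B2"
    "\<forall>x\<in>cball 0 R. cmod (deriv (deriv U\<^sub>0) x) \<le> B3" "\<forall>x\<in>cball 0 R. cmod (deriv lam x) \<le> B4"
    using bd[OF hol_U0] bd[OF hol_U0'] bd[OF hols(1)] bd[OF hols(2)] by metis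
  have "\<forall>x\<in>cball 0 R. cmod (U\<^sub>0 x) \<le> max (max B1 B2) (max B3 B4) \<and> cmod (deriv U\<^sub>0 x) \<le> max (max B1 B2) (max B3 B4) \<and>
   cmod (deriv (deriv U\<^sub>0) x) \<le> max (max B1 B2) (max B3 B4) \<and> cmod (deriv lam x) \<le> max (max B1 B2) (max B3 B4)"
    using B by (auto simp: le_max_iff_disj)
  from someI[where P = "\<lambda>B. \<forall>x\<in>cball 0 R. cmod (U\<^sub>0 x) \<le> B \<and> cmod (deriv U\<^sub>0 x) \<le> B \<and>
   cmod (deriv (deriv U\<^sub>0) x) \<le> B \<and> cmod (deriv lam x) \<le> B", OF this]
  have *: "\<forall>x\<in>cball 0 R. cmod (U\<^sub>0 x) \<le> B\<^sub>0 \<and> cmod (deriv U\<^sub>0 x) \<le> B\<^sub>0 \<and> cmod (deriv (deriv U\<^sub>0) x) \<le> B\<^sub>0 \<and> cmod (deriv lam x) \<le> B\<^sub>0"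
    unfolding B\<^sub>0_def .
  then show "cmod x < R \<Longrightarrow> cmod (U\<^sub>0 x) \<le> B\<^sub>0" "cmod x < R \<Longrightarrow> cmod (deriv U\<^sub>0 x) \<le> B\<^sub>0"
    "cmod x < R \<Longrightarrow> cmod (deriv (deriv U\<^sub>0) x) \<le> B\<^sub>0" "cmod x < R \<Longrightarrow> cmod (deriv lam x) \<le> B\<^sub>0" 
    by simp_all
  show "B\<^sub>0 \<ge> 0" using * R norm_ge_zero[of "U\<^sub>0 0"] by (metis centre_in_cball less_imp_le order_trans)
qed

lemma A: "C\<^sub>0 \<ge> 1" "A \<ge> C\<^sub>0" "A \<ge> K * C\<^sub>0\<^sup>2" "A \<ge> 2 * ((3 + B\<^sub>0) * (K * C\<^sub>0\<^sup>2)) * (4 + B\<^sub>0)" "A \<ge> 1" "A > 0" "C\<^sub>0 > 0" "C\<^sub>0 \<ge> B\<^sub>0"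
proof -
  show C: "C\<^sub>0 \<ge> 1" "C\<^sub>0 > 0" "C\<^sub>0 \<ge> B\<^sub>0" using B0(5) by (auto simp: C\<^sub>0_def)
  have n: "0 \<le> K * C\<^sub>0\<^sup>2" "0 \<le> 2 * ((3 + B\<^sub>0) * (K * C\<^sub>0\<^sup>2)) * (4 + B\<^sub>0)"
    using pos B0(5) by (auto intro!: mult_nonneg_nonneg add_nonneg_nonneg)
  then show "A \<ge> C\<^sub>0" "A \<ge> K * C\<^sub>0\<^sup>2" "A \<ge> 2 * ((3 + B\<^sub>0) * (K * C\<^sub>0\<^sup>2)) * (4 + B\<^sub>0)"
    using C unfolding A_def by linarith+
  then show "A \<ge> 1" "A > 0" using C by linarith+
qed

lemma Omega:
  assumes "(t, x) \<in> \<Omega>"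
  shows "cmod x < R" "cmod x < \<rho>" "A * cmod t < R" "C\<^sub>0 * cmod t \<le> \<rho>" "0 < R - cmod x - A * cmod t" "R - cmod x - A * cmod t \<le> 1" "cmod t \<le> C\<^sub>0 * cmod t"
proof -
  have 1: "0 < R - cmod x - A * cmod t" using assms by (simp add: cone_dom_gap)
  then show "0 < R - cmod x - A * cmod t" .
  have 2: "0 \<le> A * cmod t" using A by simp
  with 1 show 3: "cmod x < R" "A * cmod t < R" using norm_ge_zero[of x] by linarith+
  then show "cmod x < \<rho>" using R by simp
  have "C\<^sub>0 * cmod t \<le> A * cmod t" using A by (intro mult_right_mono) auto
  then show "C\<^sub>0 * cmod t \<le> \<rho>" using 3 R by linarith
  show "R - cmod x - A * cmod t \<le> 1" using 2 R norm_ge_zero[of x] by linarith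
  show "cmod t \<le> C\<^sub>0 * cmod t" using A(1) mult_right_mono[of 1 C\<^sub>0 "cmod t"] by simp
qed

lemma Omega_sub: "\<Omega> \<subseteq> UNIV \<times> ball 0 \<rho>"
  using Omega by auto

lemma iterates_bounds:
  assumes "(t, x) \<in> \<Omega>" "cmod z \<le> cmod t" "cmod v \<le> cmod t"
  shows "cmod (t * U\<^sub>0 x + z) \<le> C\<^sub>0 * cmod t" "cmod (t * deriv U\<^sub>0 x + v) \<le> C\<^sub>0 * cmod t"
proof -
  note xR = Omega(1)[OF assms(1)]
  have "cmod (t * U\<^sub>0 x) \<le> cmod t * B\<^sub>0" "cmod (t * deriv U\<^sub>0 x) \<le> cmod t * B\<^sub>0"
    unfolding norm_mult using B0(1,2)[OF xR] by (intro mult_left_mono; simp)+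
  then show "cmod (t * U\<^sub>0 x + z) \<le> C\<^sub>0 * cmod t" "cmod (t * deriv U\<^sub>0 x + v) \<le> C\<^sub>0 * cmod t"
    using norm_triangle_ineq[of "t * U\<^sub>0 x" z] norm_triangle_ineq[of "t * deriv U\<^sub>0 x" v] assms(2,3)
    by (auto simp: C\<^sub>0_def algebra_simps)
qed

lemma du_dx_base:
  assumes z: "z holomorphic2_on S" and tx: "(t, x) \<in> S" and "cmod x < \<rho>" 
  shows "((\<lambda>y. t * U\<^sub>0 y + z (t, y)) has_field_derivative t * deriv U\<^sub>0 x + du_dx z (t, x)) (at x)"
    and "((\<lambda>y. t * deriv U\<^sub>0 y + du_dx z (t, y)) has_field_derivative t * deriv (deriv U\<^sub>0) x + du_dx (du_dx z) (t, x)) (at x)"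
    and "((\<lambda>s. s * U\<^sub>0 x + z (s, x)) has_field_derivative U\<^sub>0 x + du_dt z (t, x)) (at t)"
proof -
  have D: "(U\<^sub>0 has_field_derivative deriv U\<^sub>0 x) (at x)" "(deriv U\<^sub>0 has_field_derivative deriv (deriv U\<^sub>0) x) (at x)"
    using assms by (auto intro!: holomorphic_derivI[OF hol_U0] holomorphic_derivI[OF hol_U0'])
  show "((\<lambda>y. t * U\<^sub>0 y + z (t, y)) has_field_derivative t * deriv U\<^sub>0 x + du_dx z (t, x)) (at x)"
    by (intro DERIV_add DERIV_cmult D holo2_partials(2)[OF z tx])
  show "((\<lambda>y. t * deriv U\<^sub>0 y + du_dx z (t, y)) has_field_derivative t * deriv (deriv U\<^sub>0) x + du_dx (du_dx z) (t, x)) (at x)"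
    by (intro DERIV_add DERIV_cmult D holo2_partials(2)[OF holo2_du_dx[OF z] tx])
  show "((\<lambda>s. s * U\<^sub>0 x + z (s, x)) has_field_derivative U\<^sub>0 x + du_dt z (t, x)) (at t)"
    by (intro DERIV_add holo2_partials(1)[OF z tx] DERIV_cong[OF DERIV_cmult_right[OF DERIV_ident]]) simp
qed

lemma holo2_base:
  assumes z: "z holomorphic2_on S" and "S \<subseteq> UNIV \<times> ball 0 \<rho>"
  shows "(\<lambda>p. fst p * U\<^sub>0 (snd p) + z p) holomorphic2_on S"
    and "(\<lambda>p. fst p * deriv U\<^sub>0 (snd p) + du_dx z p) holomorphic2_on S"
proof -
  note o = holo2_open[OF z]
  show "(\<lambda>p. fst p * U\<^sub>0 (snd p) + z p) holomorphic2_on S"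
    by (intro holo2_add holo2_mult holo2_fst o z holo2_snd_compose[OF o hol_U0 open_ball assms(2)])
  show "(\<lambda>p. fst p * deriv U\<^sub>0 (snd p) + du_dx z p) holomorphic2_on S"
    by (intro holo2_add holo2_mult holo2_fst o holo2_du_dx z holo2_snd_compose[OF o hol_U0' open_ball assms(2)])
qed

section \<open>One step of the Picard iteration\<close>

text \<open>Everything is measured at the scale \<open>N = C\<^sub>0 * cmod t\<close>. The
  \<open>x\<close>-derivative has three contributions of size \<open>K * N\<^sup>2\<close>, from the
  explicit \<open>x\<close> and from the two arguments of \<open>P\<close>; the one with the second
  derivative is singular at the boundary, and the others are enlarged to match it, whence the
  3.\<close>

lemma nonlin_iterate:
  assumes "z \<in> iterates"
  shows "nonlin z holomorphic2_on \<Omega>"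
    and "\<And>t x. (t, x) \<in> \<Omega> \<Longrightarrow> cmod (nonlin z (t, x)) \<le> K * C\<^sub>0\<^sup>2 * (cmod t)\<^sup>2"
    and "\<And>t x. (t, x) \<in> \<Omega> \<Longrightarrow> cmod (du_dx (nonlin z) (t, x)) \<le> 3 * (K * C\<^sub>0\<^sup>2) * (cmod t)\<^sup>2 / sqrt (R - cmod x - A * cmod t)"
proof -
  have z: "z holomorphic2_on \<Omega>" and zb: "\<And>t x. (t, x) \<in> \<Omega> \<Longrightarrow> cmod (z (t, x)) \<le> cmod t" "\<And>t x. (t, x) \<in> \<Omega> \<Longrightarrow> cmod (du_dx z (t, x)) \<le> cmod t"
    "\<And>t x. (t, x) \<in> \<Omega> \<Longrightarrow> cmod (du_dx (du_dx z) (t, x)) \<le> cmod t / sqrt (R - cmod x - A * cmod t)"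
    using assms by (auto simp: iterates_def)
  define U where "U p = fst p * U\<^sub>0 (snd p) + z p" for p
  define V where "V p = fst p * deriv U\<^sub>0 (snd p) + du_dx z p" for p
  have UV: "U holomorphic2_on \<Omega>" "V holomorphic2_on \<Omega>"
    unfolding U_def[abs_def] V_def[abs_def] by (intro holo2_base z Omega_sub)+
  have UVb: "cmod (U (t, x)) \<le> C\<^sub>0 * cmod t" "cmod (V (t, x)) \<le> C\<^sub>0 * cmod t" if "(t, x) \<in> \<Omega>" for t x
    unfolding U_def V_def using iterates_bounds[OF that zb(1,2)[OF that]] by simp_all
  have nl: "nonlin z = (\<lambda>p. F (fst p, snd p, U p, V p) - a (snd p) * fst p - lam (snd p) * U p)"
    by (auto simp: nonlin_def P_def U_def V_def fun_eq_iff)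
  have nl': "nonlin z (t, x) = P t x (U (t, x)) (V (t, x))" for t x
    by (simp add: nonlin_def U_def V_def)
  have "(\<lambda>p. F (fst p, snd p, U p, V p)) holomorphic2_on \<Omega>"
  proof (rule holo4_compose[OF F UV])
    fix t x assume tx: "(t, x) \<in> \<Omega>"
    show "(t, x, U (t, x), V (t, x)) \<in> \<Delta>"
      using Omega[OF tx] UVb[OF tx] by (intro polydisc) linarith+
  qed
  then show hnl: "nonlin z holomorphic2_on \<Omega>"
    unfolding nl by (intro holo2_diff holo2_mult UV holo2_fst open_cone_dom
      holo2_snd_compose[OF open_cone_dom hol_a open_ball Omega_sub] holo2_snd_compose[OF open_cone_dom hol_lam open_ball Omega_sub])
  show "cmod (nonlin z (t, x)) \<le> K * C\<^sub>0\<^sup>2 * (cmod t)\<^sup>2" if tx: "(t, x) \<in> \<Omega>" for t x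
    using P_bound[of t "C\<^sub>0 * cmod t" x "U (t, x)" "V (t, x)"] Omega[OF tx] UVb[OF tx]
    by (simp add: nl' power_mult_distrib mult.assoc)
  show "cmod (du_dx (nonlin z) (t, x)) \<le> 3 * (K * C\<^sub>0\<^sup>2) * (cmod t)\<^sup>2 / sqrt (R - cmod x - A * cmod t)" if tx: "(t, x) \<in> \<Omega>" for t x
  proof -
    define N where "N = C\<^sub>0 * cmod t"
    define d where "d = sqrt (R - cmod x - A * cmod t)"
    have d: "0 < d" "d \<le> 1" using Omega(5,6)[OF tx] by (auto simp: d_def)
    have N0: "N \<ge> 0" using A by (simp add: N_def)
    have "cmod (du_dx (nonlin z) (t, x)) \<le> K * N\<^sup>2 + K * N * (cmod (t * deriv U\<^sub>0 x + du_dx z (t, x)) + cmod (t * deriv (deriv U\<^sub>0) x + du_dx (du_dx z) (t, x)))"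
    proof (rule deriv_norm_le_of_increments)
      show "((\<lambda>y. nonlin z (t, y)) has_field_derivative du_dx (nonlin z) (t, x)) (at x)"
        by (rule holo2_partials[OF hnl tx])
      show "((\<lambda>y. U (t, y)) has_field_derivative t * deriv U\<^sub>0 x + du_dx z (t, x)) (at x)"
        "((\<lambda>y. V (t, y)) has_field_derivative t * deriv (deriv U\<^sub>0) x + du_dx (du_dx z) (t, x)) (at x)"
        using du_dx_base[OF z tx Omega(2)[OF tx]] unfolding U_def V_def by simp_all
      have "open (Pair t -` \<Omega>)" using open_cone_dom by (intro open_vimage continuous_intros)
      then have "\<forall>\<^sub>F y in nhds x. y \<in> Pair t -` \<Omega>" using tx by (intro eventually_nhds_in_open) auto
      then have "\<forall>\<^sub>F y in at x. (t, y) \<in> \<Omega>" by (simp add: eventually_at_filter eventually_mono)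
      then show "\<forall>\<^sub>F y in at x. cmod (nonlin z (t, y) - nonlin z (t, x)) \<le> K * N\<^sup>2 * cmod (y - x) +
          K * N * (cmod (U (t, y) - U (t, x)) + cmod (V (t, y) - V (t, x)))"
      proof eventually_elim
        case (elim y)
        have "cmod (P t y (U (t, y)) (V (t, y)) - P t x (U (t, y)) (V (t, y))) \<le> K * N\<^sup>2 * cmod (y - x)"
          using Omega[OF tx] Omega[OF elim] UVb[OF elim] by (intro P_lipschitz_x) (auto simp: N_def)
        moreover have "cmod (P t x (U (t, y)) (V (t, y)) - P t x (U (t, x)) (V (t, x))) 
           \<le> K * N * (cmod (U (t, y) - U (t, x)) + cmod (V (t, y) - V (t, x)))"
          using Omega[OF tx] UVb[OF elim] UVb[OF tx] by (intro P_lipschitz) (auto simp: N_def)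
        ultimately show ?case unfolding nl'
          using norm_triangle_ineq[of "P t y (U (t, y)) (V (t, y)) - P t x (U (t, y)) (V (t, y))" "P t x (U (t, y)) (V (t, y)) - P t x (U (t, x)) (V (t, x))"]
          by simp
      qed
    qed
    also have "\<dots> \<le> K * N\<^sup>2 * (1 / d) + K * N * (N * (1 / d) + N * (1 / d))"
    proof -
      have d1: "1 \<le> 1 / d" using d by simp
      have 1: "cmod (t * deriv U\<^sub>0 x + du_dx z (t, x)) \<le> N" 
        unfolding N_def by (rule iterates_bounds(2)[OF tx zb(1)[OF tx] zb(2)[OF tx]])
      have 2: "N * 1 \<le> N * (1 / d)" using N0 d1 by (intro mult_left_mono)
      have "cmod (t * deriv (deriv U\<^sub>0) x) \<le> cmod t * B\<^sub>0"
        unfolding norm_mult using B0(3)[OF Omega(1)[OF tx]] by (intro mult_left_mono) auto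
      also have "\<dots> \<le> cmod t * B\<^sub>0 * (1 / d)"
        using mult_left_mono[OF d1, of "cmod t * B\<^sub>0"] B0(5) by simp
      finally have "cmod (t * deriv (deriv U\<^sub>0) x) + cmod (du_dx (du_dx z) (t, x)) \<le> cmod t * B\<^sub>0 * (1 / d) + cmod t * (1 / d)"
        using zb(3)[OF tx] by (simp add: d_def)
      also have "\<dots> = N * (1 / d)" by (simp add: N_def C\<^sub>0_def algebra_simps add_divide_distrib)
      finally have 3: "cmod (t * deriv (deriv U\<^sub>0) x + du_dx (du_dx z) (t, x)) \<le> N * (1 / d)"
        using norm_triangle_ineq[of "t * deriv (deriv U\<^sub>0) x" "du_dx (du_dx z) (t, x)"] by linarith
      have 4: "K * N\<^sup>2 * 1 \<le> K * N\<^sup>2 * (1 / d)" using d1 pos by (intro mult_left_mono) auto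
      have "K * N * (cmod (t * deriv U\<^sub>0 x + du_dx z (t, x)) + cmod (t * deriv (deriv U\<^sub>0) x + du_dx (du_dx z) (t, x)))
        \<le> K * N * (N * (1 / d) + N * (1 / d))"
        using 1 2 3 N0 pos by (intro mult_left_mono) auto
      with 4 show ?thesis by simp
    qed
    also have "\<dots> = 3 * (K * C\<^sub>0\<^sup>2) * (cmod t)\<^sup>2 / d"
      by (simp add: N_def power2_eq_square)
    finally show ?thesis by (simp add: d_def)
  qed
qed

text \<open>The source \<open>nonlin z\<close> is not singular at the boundary of the cone, so
  \<open>w\<close> itself is bounded by plain integration along the ray. Its derivative
  \<open>du_dx w\<close> solves the differentiated equation with a singular source, and the gain
  lemma for it yields the other two bounds.\<close>

lemma iterate_step:
  assumes "z \<in> iterates"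
  obtains w where "w \<in> iterates" "\<And>t x. (t, x) \<in> \<Omega> \<Longrightarrow> t * du_dt w (t, x) - lam x * w (t, x) = nonlin z (t, x)"
proof -
  note nl = nonlin_iterate[OF assms]
  have lamR: "lam holomorphic_on ball 0 R" using hol_lam R(4) holomorphic_on_subset by blast
  have Rel: "Re (lam x) \<le> - c" if "cmod x < R" for x using Re_lam that R by simp
  then have Rel0: "Re (lam x) < 0" if "cmod x < R" for x using that pos by fastforce
  obtain w where w: "w holomorphic2_on \<Omega>" and eq: "\<And>t x. (t, x) \<in> \<Omega> \<Longrightarrow> t * du_dt w (t, x) - lam x * w (t, x) = nonlin z (t, x)"
    using linear_singular_solve[OF nl(1) A(6) lamR pos(4) Rel] by blast
  define K\<^sub>2 where "K\<^sub>2 = K * C\<^sub>0\<^sup>2"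
  have K2: "K\<^sub>2 > 0" using pos A by (simp add: K\<^sub>2_def)
  have wb: "cmod (w (t, x)) \<le> K\<^sub>2 * (cmod t)\<^sup>2" if tx: "(t, x) \<in> \<Omega>" for t x
  proof -
    have ray: "(of_real s * t, x) \<in> \<Omega>" if "0 \<le> s" "s \<le> 1" for s
      using cone_dom_ray(1)[OF tx _ that] A by simp
    have "cmod (w (t, x)) \<le> 1 * (K\<^sub>2 * (cmod t)\<^sup>2) - 0 * (K\<^sub>2 * (cmod t)\<^sup>2)"
    proof (rule ray_bound[of "\<lambda>s. w (s, x)" "\<lambda>s. du_dt w (s, x)" t "lam x" "\<lambda>s. nonlin z (s, x)" "\<lambda>s. s * (K\<^sub>2 * (cmod t)\<^sup>2)" "\<lambda>s. K\<^sub>2 * (cmod t)\<^sup>2"])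
      show "continuous_on {0..1} (\<lambda>s. s * (K\<^sub>2 * (cmod t)\<^sup>2))" by (intro continuous_intros)
      show "((\<lambda>s. s * (K\<^sub>2 * (cmod t)\<^sup>2)) has_real_derivative K\<^sub>2 * (cmod t)\<^sup>2) (at s)" for s
        by (rule DERIV_cong[OF DERIV_cmult_right[OF DERIV_ident]]) (rule mult_1)
      show "cmod (nonlin z (of_real s * t, x)) \<le> s * (K\<^sub>2 * (cmod t)\<^sup>2)" if "0 < s" "s < 1" for s
      proof -
        have "cmod (nonlin z (of_real s * t, x)) \<le> K\<^sub>2 * (cmod (of_real s * t))\<^sup>2"
          unfolding K\<^sub>2_def using that by (intro nl(2) ray) auto
        also have "\<dots> = s * (s * (K\<^sub>2 * (cmod t)\<^sup>2))"
          using that by (simp add: norm_mult power_mult_distrib power2_eq_square)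
        also have "\<dots> \<le> s * (1 * (K\<^sub>2 * (cmod t)\<^sup>2))"
          using that K2 by (intro mult_left_mono mult_right_mono) auto
        finally show ?thesis by simp
      qed
      show "((\<lambda>s. w (s, x)) has_field_derivative du_dt w (of_real s * t, x)) (at (of_real s * t))" if "0 \<le> s" "s \<le> 1" for s
        by (rule holo2_partials(1)[OF w ray[OF that]])
    qed (use eq ray Rel0 Omega(1)[OF tx] in auto)
    then show ?thesis by simp
  qed
  define q where "q p = du_dx (nonlin z) p + deriv lam (snd p) * w p" for p
  have q: "q holomorphic2_on \<Omega>"
    unfolding q_def[abs_def]
    by (intro holo2_add holo2_mult w holo2_du_dx nl(1) holo2_snd_compose[OF open_cone_dom _ open_ball Omega_sub] holomorphic_deriv hol_lam) auto
  have eq2: "t * du_dt (du_dx w) (t, x) - lam x * du_dx w (t, x) = q (t, x)" if "(t, x) \<in> \<Omega>" for t x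
    unfolding q_def snd_conv
    using singular_equation_du_dx[OF w hol_lam open_ball Omega_sub nl(1) eq that] by simp
  \<comment> \<open>The 3 comes from the \<open>x\<close>-derivative of \<open>nonlin z\<close>, the
    \<open>B\<^sub>0\<close> from the commutator term \<open>deriv lam x * w\<close>.\<close>
  define C where "C = (3 + B\<^sub>0) * K\<^sub>2"
  have C0: "C \<ge> 0" using K2 B0(5) by (simp add: C_def)
  have qC: "cmod (q (t, x)) \<le> C * (cmod t)\<^sup>2 / sqrt (R - cmod x - A * cmod t)" if tx: "(t, x) \<in> \<Omega>" for t x
  proof -
    define d where "d = sqrt (R - cmod x - A * cmod t)"
    have d: "0 < d" "d \<le> 1" using Omega(5,6)[OF tx] by (auto simp: d_def)
    have "cmod (deriv lam x * w (t, x)) \<le> B\<^sub>0 * (K\<^sub>2 * (cmod t)\<^sup>2)"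
      unfolding norm_mult using B0(4)[OF Omega(1)[OF tx]] wb[OF tx] B0(5) by (intro mult_mono) auto
    also have "\<dots> \<le> B\<^sub>0 * (K\<^sub>2 * (cmod t)\<^sup>2) / d"
      using d B0(5) K2 by (simp add: field_simps mult_left_le_one_le)
    finally have "cmod (q (t, x)) \<le> 3 * K\<^sub>2 * (cmod t)\<^sup>2 / d + B\<^sub>0 * (K\<^sub>2 * (cmod t)\<^sup>2) / d"
      unfolding q_def using nl(3)[OF tx] by (intro norm_triangle_le add_mono) (simp_all add: K\<^sub>2_def d_def)
    also have "\<dots> = C * (cmod t)\<^sup>2 / d" by (simp add: C_def add_divide_distrib algebra_simps)
    finally show ?thesis by (simp add: d_def)
  qed
  have Ab: "2 * C * (4 + B\<^sub>0) \<le> A" using A(4) by (simp add: C_def K\<^sub>2_def)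
  have "2 * C * 1 \<le> 2 * C * (4 + B\<^sub>0)" using C0 B0(5) by (intro mult_left_mono) auto
  with Ab have Ab': "2 * C \<le> A" by simp
  note gain = singular_equation_gain[OF holo2_du_dx[OF w] q A(6) R(3) lamR Rel0 B0(4) eq2 C0 qC]
  have "w \<in> iterates"
    unfolding iterates_def
  proof (intro CollectI conjI allI impI)
    fix t x assume tx: "(t, x) \<in> \<Omega>"
    have "K\<^sub>2 * cmod t \<le> A * cmod t" using A(3) by (intro mult_right_mono) (auto simp: K\<^sub>2_def)
    also have "\<dots> \<le> 1" using Omega(3)[OF tx] R by simp
    finally have "(K\<^sub>2 * cmod t) * cmod t \<le> 1 * cmod t" by (intro mult_right_mono) auto
    then show "cmod (w (t, x)) \<le> cmod t" using wb[OF tx] by (simp add: power2_eq_square)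
    have "2 * C / A * cmod t \<le> 1 * cmod t" using Ab' A by (intro mult_right_mono) auto
    then show "cmod (du_dx w (t, x)) \<le> cmod t" using gain(1)[OF _ _ _ _ tx] by simp
    have "2 * (C * (4 + B\<^sub>0)) / A * cmod t / sqrt (R - cmod x - A * cmod t) \<le> 1 * cmod t / sqrt (R - cmod x - A * cmod t)"
      using Ab A Omega(5)[OF tx] by (intro divide_right_mono mult_right_mono) auto
    then show "cmod (du_dx (du_dx w) (t, x)) \<le> cmod t / sqrt (R - cmod x - A * cmod t)"
      using gain(2)[OF _ _ _ _ tx] by simp
  qed (rule w)
  then show ?thesis using that eq by blast
qed

lemma zero_in_iterates: "(\<lambda>_. 0) \<in> iterates"
proof -
  have "du_dx (\<lambda>_. 0) = (\<lambda>_. 0)" by (auto simp: du_dx_def)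
  then show ?thesis using Omega(5) by (auto simp: iterates_def holo2_const open_cone_dom less_imp_le)
qed

section \<open>Convergence of the Picard iterates\<close>

text \<open>The step lemma asserts existence only, and only for members of \<open>iterates\<close>;
  hence the choice, whose defining property becomes available together with membership, by
  induction.\<close>

primrec picard :: "nat \<Rightarrow> complex \<times> complex \<Rightarrow> complex" where
  "picard 0 = (\<lambda>_. 0)"
| "picard (Suc n) = (SOME w. w \<in> iterates \<and> (\<forall>t x. (t, x) \<in> \<Omega> \<longrightarrow> t * du_dt w (t, x) - lam x * w (t, x) = nonlin (picard n) (t, x)))"

lemma picard_step:
  assumes "picard n \<in> iterates"
  shows "picard (Suc n) \<in> iterates \<and> 
    (\<forall>t x. (t, x) \<in> \<Omega> \<longrightarrow> t * du_dt (picard (Suc n)) (t, x) - lam x * picard (Suc n) (t, x) = nonlin (picard n) (t, x))"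
proof -
  obtain w where "w \<in> iterates" "\<And>t x. (t, x) \<in> \<Omega> \<Longrightarrow> t * du_dt w (t, x) - lam x * w (t, x) = nonlin (picard n) (t, x)"
    using iterate_step[OF assms] by blast
  then have "\<exists>w. w \<in> iterates \<and> (\<forall>t x. (t, x) \<in> \<Omega> \<longrightarrow> t * du_dt w (t, x) - lam x * w (t, x) = nonlin (picard n) (t, x))"
    by blast
  from someI_ex[OF this] show ?thesis unfolding picard.simps .
qed

declare picard.simps(2) [simp del]

lemma picard_iterates: "picard n \<in> iterates"
  by (induction n) (use zero_in_iterates picard_step in auto)

lemma picard_eq: 
  "(t, x) \<in> \<Omega> \<Longrightarrow> t * du_dt (picard (Suc n)) (t, x) - lam x * picard (Suc n) (t, x) = nonlin (picard n) (t, x)"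
  using picard_step[OF picard_iterates] by blast

lemma picard:
  "picard n holomorphic2_on \<Omega>"
  "(t, x) \<in> \<Omega> \<Longrightarrow> cmod (picard n (t, x)) \<le> cmod t"
  "(t, x) \<in> \<Omega> \<Longrightarrow> cmod (du_dx (picard n) (t, x)) \<le> cmod t"
  using picard_iterates[of n] by (auto simp: iterates_def)

lemma nonlin_lipschitz:
  assumes "(t, x) \<in> \<Omega>" "cmod (z (t, x)) \<le> cmod t" "cmod (du_dx z (t, x)) \<le> cmod t"
    "cmod (z' (t, x)) \<le> cmod t" "cmod (du_dx z' (t, x)) \<le> cmod t"
  shows "cmod (nonlin z (t, x) - nonlin z' (t, x)) \<le> K * C\<^sub>0 * cmod t * (cmod (z (t, x) - z' (t, x)) + cmod (du_dx z (t, x) - du_dx z' (t, x)))"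
  unfolding nonlin_def prod.case
  using P_lipschitz[of t "C\<^sub>0 * cmod t" x, OF _ _ iterates_bounds[OF assms(1-3)] iterates_bounds[OF assms(1,4,5)]] Omega[OF assms(1)]
  by (simp add: mult.assoc)

definition bidisc :: "real \<Rightarrow> real \<Rightarrow> (complex \<times> complex) set" where
  "bidisc T r = ball 0 T \<times> ball 0 r"

text \<open>\<open>K * C\<^sub>0\<close> is the Lipschitz constant of the nonlinear term per unit of
  \<open>cmod t\<close>; the 4 is 1 for a difference of iterates plus 3 for its
  \<open>x\<close>-derivative.\<close>

definition B\<^sub>1 where "B\<^sub>1 = 4 * K * C\<^sub>0"

lemma B1: "B\<^sub>1 > 0" using pos A by (simp add: B\<^sub>1_def)

lemma bidisc_sub_Omega: "bidisc (R / (2 * A)) (R / 2) \<subseteq> \<Omega>"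
proof (clarsimp simp: bidisc_def cone_dom_def)
  fix t x assume "cmod t < R / (2 * A)" "cmod x * 2 < R"
  then show "A * cmod t + cmod x < R" using A by (simp add: field_simps)
qed

text \<open>Nagumo's device: each step consumes one \<open>x\<close>-derivative of the previous
  difference, and this loss is stored in the growing negative power of the distance
  \<open>R / 2 - cmod x\<close> to the boundary.\<close>

lemma picard_difference:
  assumes "cmod t < R / (2 * A)" "cmod x < R / 2"
  shows "cmod (picard (Suc n) (t, x) - picard n (t, x)) \<le> (B\<^sub>1 * cmod t / (R / 2 - cmod x)) ^ n"
  using assms
proof (induction n arbitrary: t x)
  case 0
  then have tx: "(t, x) \<in> \<Omega>" using bidisc_sub_Omega by (auto simp: bidisc_def)
  have "cmod (picard 1 (t, x)) \<le> cmod t" using picard(2)[OF tx] .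
  also have "\<dots> \<le> 1 * cmod t" by simp
  also have "\<dots> \<le> A * cmod t" using A by (intro mult_right_mono) auto
  also have "\<dots> \<le> 1" using Omega(3)[OF tx] R by simp
  finally show ?case by simp
next
  case (Suc n)
  define r where "r = R / 2"
  have r: "0 < r" "r \<le> 1" using R by (auto simp: r_def)
  have in\<Omega>: "(s, y) \<in> \<Omega>" if "cmod s < R / (2 * A)" "cmod y < r" for s y
    using bidisc_sub_Omega that by (auto simp: bidisc_def r_def)
  define \<Delta> where "\<Delta> p = picard (Suc n) p - picard n p" for p
  define E where "E p = picard (Suc (Suc n)) p - picard (Suc n) p" for p
  have hol: "\<Delta> holomorphic2_on \<Omega>" "E holomorphic2_on \<Omega>"
    unfolding \<Delta>_def[abs_def] E_def[abs_def] by (intro holo2_diff picard(1))+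
  have du: "du_dx \<Delta> p = du_dx (picard (Suc n)) p - du_dx (picard n) p"
    "du_dt E p = du_dt (picard (Suc (Suc n))) p - du_dt (picard (Suc n)) p" if "p \<in> \<Omega>" for p
    unfolding \<Delta>_def[abs_def] E_def[abs_def] by (rule holo2_diff_partials[OF picard(1) picard(1) that])+
  define \<delta> where "\<delta> = r - cmod x"
  have \<delta>: "0 < \<delta>" "\<delta> \<le> 1" using Suc.prems r norm_ge_zero[of x] unfolding \<delta>_def r_def by linarith+
  \<comment> \<open>The Cauchy radius \<open>\<delta> / (n + 1)\<close> costs a factor \<open>n + 1\<close>, which integrating \<open>s ^ n\<close> along the ray gives back.\<close>
  have Dx: "cmod (du_dx \<Delta> (s, x)) \<le> 3 * (real n + 1) / \<delta> * (B\<^sub>1 * cmod s / \<delta>) ^ n" if s: "cmod s < R / (2 * A)" for s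
  proof -
    have xr: "\<delta> * (n / (n + 1)) < r - cmod w" if "w \<in> ball x (\<delta> / (n + 1))" for w
    proof -
      have "cmod (w - x) < \<delta> / (n + 1)" using that by (simp add: dist_norm norm_minus_commute)
      moreover have "\<delta> * (n / (n + 1)) = \<delta> - \<delta> / (n + 1)" by (simp add: field_simps)
      ultimately show ?thesis using norm_triangle_sub[of w x] unfolding \<delta>_def by linarith
    qed
    have sub: "cmod w < r" if "w \<in> ball x (\<delta> / (n + 1))" for w
    proof -
      have "0 \<le> \<delta> * (n / (n + 1))" using \<delta> by simp
      with xr[OF that] show ?thesis by linarith
    qed
    have "cmod (deriv (\<lambda>y. \<Delta> (s, y)) x) \<le> 3 * (B\<^sub>1 * cmod s / \<delta>) ^ n / (\<delta> / (n + 1))"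
    proof (rule deriv_norm_le)
      show "(\<lambda>y. \<Delta> (s, y)) holomorphic_on ball x (\<delta> / (n + 1))"
        using in\<Omega>[OF s] sub by (intro holo2_slices(2)[OF hol(1)]) auto
      fix w assume w: "w \<in> ball x (\<delta> / (n + 1))"
      have "cmod (\<Delta> (s, w)) \<le> (B\<^sub>1 * cmod s / (r - cmod w)) ^ n"
        unfolding \<Delta>_def r_def using s sub[OF w] by (intro Suc.IH) (auto simp: r_def)
      \<comment> \<open>Inside the Cauchy disc the distance to the boundary falls from
        \<open>\<delta>\<close> to no less than \<open>\<delta> * n / (n + 1)\<close>, and the
        \<open>n\<close>-th power of the quotient is at most \<open>exp 1\<close>, hence at most 3.
        For \<open>n = 0\<close> this lower bound is 0, but the power is constant.\<close>
      also have "\<dots> \<le> 3 * (B\<^sub>1 * cmod s / \<delta>) ^ n"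
      proof (cases "n = 0")
        case False
        have "B\<^sub>1 * cmod s / (r - cmod w) \<le> B\<^sub>1 * cmod s / (\<delta> * (n / (n + 1)))"
          using xr[OF w] sub[OF w] \<delta> False B1 by (intro divide_left_mono mult_pos_pos) auto
        also have "\<dots> = (1 + 1 / n) * (B\<^sub>1 * cmod s / \<delta>)"
          using False \<delta> by (simp add: field_simps)
        finally have "(B\<^sub>1 * cmod s / (r - cmod w)) ^ n \<le> ((1 + 1 / n) * (B\<^sub>1 * cmod s / \<delta>)) ^ n"
          using sub[OF w] B1 by (intro power_mono) auto
        also have "\<dots> = (1 + 1 / n) ^ n * (B\<^sub>1 * cmod s / \<delta>) ^ n" by (rule power_mult_distrib)
        also have "(1 + 1 / n) ^ n \<le> exp 1"
          using exp_ge_one_plus_x_over_n_power_n[of n 1] False by simp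
        also have "exp 1 \<le> (3 :: real)" by (rule exp_le)
        finally show ?thesis using B1 \<delta> by (simp add: mult_right_mono)
      qed simp
      finally show "cmod (\<Delta> (s, w)) \<le> 3 * (B\<^sub>1 * cmod s / \<delta>) ^ n" .
    qed (use \<delta> in auto)
    then show ?thesis by (simp add: du_dx_def field_simps)
  qed
  have tx: "(t, x) \<in> \<Omega>" using in\<Omega> Suc.prems by (simp add: r_def)
  have small: "cmod (of_real s * t) < R / (2 * A)" if "0 < s" "s < 1" for s
  proof -
    have "s * cmod t \<le> 1 * cmod t" using that by (intro mult_right_mono) auto
    then show ?thesis using Suc.prems that by (simp add: norm_mult)
  qed
  have ray: "(of_real s * t, x) \<in> \<Omega>" if "0 \<le> s" "s \<le> 1" for s
    using cone_dom_ray(1)[OF tx _ that] A by simp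
  define X where "X = B\<^sub>1 * cmod t / \<delta>"
  have X: "X \<ge> 0" using B1 \<delta> by (simp add: X_def)
  define q where "q p = nonlin (picard (Suc n)) p - nonlin (picard n) p" for p
  have qb: "cmod (q (of_real s * t, x)) \<le> s * (X ^ Suc n * (real (Suc n) * s ^ n))" if s: "0 < s" "s < 1" for s
  proof -
    have p: "(of_real s * t, x) \<in> \<Omega>" using ray s by simp
    define Y where "Y = (B\<^sub>1 * cmod (of_real s * t) / \<delta>) ^ n"
    have Y: "Y = s ^ n * X ^ n" using s by (simp add: Y_def X_def norm_mult power_divide power_mult_distrib)
    have Y0: "Y \<ge> 0" using B1 \<delta> by (simp add: Y_def)
    have "cmod (\<Delta> (of_real s * t, x)) \<le> Y"
      unfolding \<Delta>_def Y_def \<delta>_def r_def using small[OF s] Suc.prems by (intro Suc.IH)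
    also have "\<dots> \<le> (real n + 1) / \<delta> * Y"
    proof -
      have "1 * Y \<le> (real n + 1) / \<delta> * Y" using \<delta> Y0 by (intro mult_right_mono) (auto simp: field_simps)
      then show ?thesis by simp
    qed
    finally have "cmod (\<Delta> (of_real s * t, x)) + cmod (du_dx \<Delta> (of_real s * t, x)) \<le> (real n + 1) / \<delta> * Y + 3 * (real n + 1) / \<delta> * Y"
      using Dx[OF small[OF s]] unfolding Y_def by (intro add_mono)
    also have "\<dots> = 4 * (real n + 1) / \<delta> * Y" by (simp add: add_divide_distrib[symmetric] algebra_simps)
    finally have sum: "cmod (\<Delta> (of_real s * t, x)) + cmod (du_dx \<Delta> (of_real s * t, x)) \<le> 4 * (real n + 1) / \<delta> * Y" .
    have "cmod (q (of_real s * t, x)) \<le> K * C\<^sub>0 * cmod (of_real s * t) * (cmod (\<Delta> (of_real s * t, x)) + cmod (du_dx \<Delta> (of_real s * t, x)))"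
      unfolding q_def du(1)[OF p] \<Delta>_def by (intro nonlin_lipschitz p picard)
    also have "\<dots> \<le> K * C\<^sub>0 * cmod (of_real s * t) * (4 * (real n + 1) / \<delta> * Y)"
      using sum pos A by (intro mult_left_mono) auto
    also have "\<dots> = s * (X ^ Suc n * (real (Suc n) * s ^ n))"
      using s \<delta> by (simp add: Y X_def B\<^sub>1_def norm_mult field_simps)
    finally show ?thesis .
  qed
  have "cmod (E (t, x)) \<le> X ^ Suc n * 1 ^ Suc n - X ^ Suc n * 0 ^ Suc n"
  proof (rule ray_bound[of "\<lambda>s. E (s, x)" "\<lambda>s. du_dt E (s, x)" t "lam x" "\<lambda>s. q (s, x)" "\<lambda>s. X ^ Suc n * s ^ Suc n" "\<lambda>s. X ^ Suc n * (real (Suc n) * s ^ n)"])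
    show "((\<lambda>s. E (s, x)) has_field_derivative du_dt E (of_real s * t, x)) (at (of_real s * t))" if "0 \<le> s" "s \<le> 1" for s
      by (rule holo2_partials(1)[OF hol(2) ray[OF that]])
    show "of_real s * t * du_dt E (of_real s * t, x) - lam x * E (of_real s * t, x) = q (of_real s * t, x)" if "0 < s" "s < 1" for s
    proof -
      have p: "(of_real s * t, x) \<in> \<Omega>" using ray that by simp
      show ?thesis using picard_eq[OF p, of "Suc n"] picard_eq[OF p, of n]
        unfolding q_def du(2)[OF p] E_def by (simp only: algebra_simps)
    qed
    show "Re (lam x) < 0" using Re_lam[OF Omega(2)[OF tx]] pos by simp
    show "continuous_on {0..1} (\<lambda>s. X ^ Suc n * s ^ Suc n)" by (intro continuous_intros)
    show "((\<lambda>s. X ^ Suc n * s ^ Suc n) has_real_derivative X ^ Suc n * (real (Suc n) * s ^ n)) (at s)" for s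
      by (rule DERIV_cmult, rule DERIV_cong[OF DERIV_pow]) simp
  qed (rule qb)
  then show ?case by (simp add: E_def X_def \<delta>_def r_def)
qed

lemma holomorphic_solution_exists:
  obtains T r C w where "0 < T" "0 < r" "r \<le> \<rho>" "0 < C" "C * T \<le> \<rho>"
    "w holomorphic2_on (ball 0 T \<times> ball 0 r)"
    "\<And>t x. cmod t < T \<Longrightarrow> cmod x < r \<Longrightarrow> cmod (w (t, x)) \<le> C * cmod t"
    "\<And>t x. cmod t < T \<Longrightarrow> cmod x < r \<Longrightarrow> cmod (du_dx w (t, x)) \<le> C * cmod t"
    "\<And>t x. cmod t < T \<Longrightarrow> cmod x < r \<Longrightarrow> t * du_dt w (t, x) = F (t, x, w (t, x), du_dx w (t, x))"
proof -
  \<comment> \<open>With \<open>cmod x < R / 4\<close> the second bound makes the ratio in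
    \<open>picard_difference\<close> at most \<open>(R / 8) / (R / 4) = 1 / 2\<close>.\<close>
  define T where "T = min (R / (2 * A)) (R / (8 * B\<^sub>1))"
  define S where "S = bidisc T (R / 4)"
  have T: "0 < T" "T \<le> R / (2 * A)" "T \<le> R / (8 * B\<^sub>1)" using R A B1 by (auto simp: T_def)
  have S\<Omega>: "S \<subseteq> \<Omega>" using bidisc_sub_Omega T R by (auto simp: S_def bidisc_def)
  have "open S" by (simp add: S_def bidisc_def open_Times)
  have hp: "picard n holomorphic2_on S" for n by (rule holo2_subset[OF picard(1) \<open>open S\<close> S\<Omega>])
  have small: "cmod (picard (Suc n) p - picard n p) \<le> (1 / 2) ^ n" if "p \<in> S" for n p
  proof -
    obtain t x where p: "p = (t, x)" by (cases p)
    have tx: "cmod t < T" "cmod x < R / 4" using that by (auto simp: p S_def bidisc_def)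
    have "B\<^sub>1 * cmod t \<le> B\<^sub>1 * (R / (8 * B\<^sub>1))" using tx T B1 by (intro mult_left_mono) auto
    also have "\<dots> = R / 8" using B1 by simp
    finally have 1: "B\<^sub>1 * cmod t \<le> R / 8" .
    have "cmod (picard (Suc n) p - picard n p) \<le> (B\<^sub>1 * cmod t / (R / 2 - cmod x)) ^ n"
      unfolding p using tx T R by (intro picard_difference) auto
    also have "\<dots> \<le> ((R / 8) / (R / 4)) ^ n"
      using 1 tx R B1 by (intro power_mono frac_le) auto
    finally show ?thesis using R by simp
  qed
  \<comment> \<open>The limit is written as a telescoping series so that the geometric majorant
    gives uniform convergence.\<close>
  define z where "z p = (\<Sum>n. picard (Suc n) p - picard n p)" for p
  have "uniform_limit S (\<lambda>n p. \<Sum>i<n. picard (Suc i) p - picard i p) z sequentially"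
    unfolding z_def[abs_def]
    by (rule Weierstrass_m_test[where M = "\<lambda>n. (1 / 2) ^ n"]) (use small in \<open>auto intro!: summable_geometric\<close>)
  moreover have "(\<Sum>i<n. picard (Suc i) p - picard i p) = picard n p" for n p
    using sum_lessThan_telescope[of "\<lambda>i. picard i p" n] by simp
  ultimately have ul: "uniform_limit S picard z sequentially" by simp
  have ul2: "\<exists>d>0. cball p d \<subseteq> S \<and> uniform_limit (cball p d) picard z sequentially" if "p \<in> S" for p
    using \<open>open S\<close> that uniform_limit_on_subset[OF ul] open_contains_cball by metis
  have lim: "z holomorphic2_on S" "p \<in> S \<Longrightarrow> (\<lambda>n. du_dt (picard n) p) \<longlonglongrightarrow> du_dt z p"
    "p \<in> S \<Longrightarrow> (\<lambda>n. du_dx (picard n) p) \<longlonglongrightarrow> du_dx z p" "p \<in> S \<Longrightarrow> (\<lambda>n. picard n p) \<longlonglongrightarrow> z p" for p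
    using holo2_uniform_limit[OF hp ul2] by blast+
  have zb: "cmod (z (t, x)) \<le> cmod t" "cmod (du_dx z (t, x)) \<le> cmod t" if tx: "(t, x) \<in> S" for t x
  proof -
    have p: "(t, x) \<in> \<Omega>" using S\<Omega> that by blast
    show "cmod (z (t, x)) \<le> cmod t"
      by (rule LIMSEQ_le_const2[OF tendsto_norm[OF lim(4)[OF that]]]) (use picard(2)[OF p] in auto)
    show "cmod (du_dx z (t, x)) \<le> cmod t"
      by (rule LIMSEQ_le_const2[OF tendsto_norm[OF lim(3)[OF that]]]) (use picard(3)[OF p] in auto)
  qed
  have zeq: "t * du_dt z (t, x) - lam x * z (t, x) = nonlin z (t, x)" if tx: "(t, x) \<in> S" for t x
  proof -
    have p: "(t, x) \<in> \<Omega>" using S\<Omega> that by blast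
    \<comment> \<open>The iterates and their \<open>x\<close>-derivatives converge pointwise, which
      is enough to pass to the limit in the nonlinear term by its Lipschitz bound.\<close>
    have "(\<lambda>n. K * C\<^sub>0 * cmod t * (cmod (picard n (t, x) - z (t, x)) + cmod (du_dx (picard n) (t, x) - du_dx z (t, x)))) \<longlonglongrightarrow>
      K * C\<^sub>0 * cmod t * (cmod (z (t, x) - z (t, x)) + cmod (du_dx z (t, x) - du_dx z (t, x)))"
      by (intro tendsto_intros lim(3,4) tx)
    then have 0: "(\<lambda>n. K * C\<^sub>0 * cmod t * (cmod (picard n (t, x) - z (t, x)) + cmod (du_dx (picard n) (t, x) - du_dx z (t, x)))) \<longlonglongrightarrow> 0"
      by (simp only: diff_self norm_zero add_0_right mult_zero_right)
    have "(\<lambda>n. nonlin (picard n) (t, x) - nonlin z (t, x)) \<longlonglongrightarrow> 0"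
      by (rule Lim_null_comparison[OF always_eventually 0]) (rule allI, rule nonlin_lipschitz[OF p picard(2,3)[OF p] zb[OF tx]])
    then have 1: "(\<lambda>n. nonlin (picard n) (t, x)) \<longlonglongrightarrow> nonlin z (t, x)"
      by (rule LIM_zero_cancel)
    have "(\<lambda>n. t * du_dt (picard (Suc n)) (t, x) - lam x * picard (Suc n) (t, x)) \<longlonglongrightarrow> t * du_dt z (t, x) - lam x * z (t, x)"
      by (intro tendsto_intros LIMSEQ_Suc[OF lim(2)[OF tx]] LIMSEQ_Suc[OF lim(4)[OF tx]])
    then show ?thesis using 1 unfolding picard_eq[OF p] by (rule LIMSEQ_unique)
  qed
  define w where "w p = fst p * U\<^sub>0 (snd p) + z p" for p
  have Ssub: "S \<subseteq> UNIV \<times> ball 0 \<rho>" using S\<Omega> Omega_sub by blast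
  have xr: "cmod x < \<rho>" if "(t, x) \<in> S" for t x using that Ssub by auto
  have wx: "du_dx w (t, x) = t * deriv U\<^sub>0 x + du_dx z (t, x)" "du_dt w (t, x) = U\<^sub>0 x + du_dt z (t, x)" if tx: "(t, x) \<in> S" for t x
    using DERIV_imp_deriv[OF du_dx_base(1)[OF lim(1) tx xr[OF tx]]] DERIV_imp_deriv[OF du_dx_base(3)[OF lim(1) tx xr[OF tx]]]
    by (simp_all add: du_dx_def du_dt_def w_def)
  have inS: "(t, x) \<in> S" if "cmod t < T" "cmod x < R / 4" for t x using that by (simp add: S_def bidisc_def)
  show ?thesis
  proof (rule that[of T "R / 4" C\<^sub>0 w])
    show "w holomorphic2_on ball 0 T \<times> ball 0 (R / 4)"
      using holo2_base(1)[OF lim(1) Ssub] unfolding w_def[abs_def] S_def bidisc_def .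
    have "C\<^sub>0 * T \<le> A * (R / (2 * A))" using A T by (intro mult_mono) auto
    then show "C\<^sub>0 * T \<le> \<rho>" using A R by simp
    fix t x assume "cmod t < T" "cmod x < R / 4"
    note tx = inS[OF this]
    have p: "(t, x) \<in> \<Omega>" using S\<Omega> tx by blast
    show "cmod (w (t, x)) \<le> C\<^sub>0 * cmod t" "cmod (du_dx w (t, x)) \<le> C\<^sub>0 * cmod t"
      using iterates_bounds[OF p zb[OF tx]] unfolding wx[OF tx] w_def by simp_all
    have "U\<^sub>0 x = a x + lam x * U\<^sub>0 x"
      using one_minus_lam[OF xr[OF tx]] by (simp add: U\<^sub>0_def field_simps)
    then have U: "t * U\<^sub>0 x = a x * t + lam x * (t * U\<^sub>0 x)"
      by (metis distrib_left mult.left_commute mult.commute)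
    \<comment> \<open>Adds the equation of \<open>z\<close> to the identity for
      \<open>t * U\<^sub>0 x\<close>; with the derivatives abstracted to variables this is ring
      algebra.\<close>
    have alg: "p + d = f" if "d - l * q = f - b - l * (p + q)" "p = b + l * p" for p d f l q b :: complex
      using that by algebra
    show "t * du_dt w (t, x) = F (t, x, w (t, x), du_dx w (t, x))"
      using alg[OF zeq[OF tx, unfolded nonlin_def P_def prod.case] U]
      unfolding wx[OF tx] w_def fst_conv snd_conv by (simp only: distrib_left)
  qed (use T R A in auto)
qed

end

section \<open>Uniqueness\<close>

text \<open>Splits \<open>z\<close> in the proportion \<open>p : q\<close>. It turns the
  differential inequality at a point into an equation with a zeroth-order error and an error
  proportional to the \<open>x\<close>-derivative.\<close>

lemma complex_split_norm:
  assumes "cmod z \<le> p + q" "0 \<le> p" "0 \<le> q"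
  obtains z1 z2 where "z = z1 + z2" "cmod z1 \<le> p" "cmod z2 \<le> q"
proof (cases "p + q = 0")
  case True
  then show ?thesis using assms by (intro that[of 0 0]) auto
next
  case False
  then have pq: "p + q > 0" using assms by simp
  have 1: "cmod z / (p + q) \<le> 1" using assms pq by simp
  show ?thesis
  proof (rule that[of "of_real (p / (p + q)) * z" "of_real (q / (p + q)) * z"])
    have "of_real (p / (p + q)) + of_real (q / (p + q)) = (1 :: complex)"
      using pq by (simp only: of_real_add[symmetric] add_divide_distrib[symmetric]) simp
    then show "z = of_real (p / (p + q)) * z + of_real (q / (p + q)) * z"
      by (simp only: distrib_right[symmetric]) simp
    have "p * (cmod z / (p + q)) \<le> p * 1" "q * (cmod z / (p + q)) \<le> q * 1"
      using 1 assms by (intro mult_left_mono; simp)+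
    then show "cmod (of_real (p / (p + q)) * z) \<le> p" "cmod (of_real (q / (p + q)) * z) \<le> q"
      using assms pq by (simp_all only: norm_mult norm_of_real) (simp_all add: mult.commute)
  qed
qed

text \<open>The characteristic is used only at a maximum point, as a straight line with the slope
  \<open>\<beta>\<close> found there, so no flow has to be constructed. Of the margin
  \<open>2 * e\<close> in \<open>lam\<close>, one \<open>e\<close> absorbs the zeroth-order error
  and the other makes the increase strict.\<close>

lemma transport_max_principle:
  fixes w :: "complex \<times> complex \<Rightarrow> complex" and lam :: "complex \<Rightarrow> complex" and r b e c t\<^sub>0 t\<^sub>1 M :: real
  assumes w: "w holomorphic2_on S" and t01: "0 < t\<^sub>0" "t\<^sub>0 < t\<^sub>1" and b: "0 \<le> b" and e: "0 < e"
    and S: "\<And>t x. t\<^sub>0 \<le> t \<Longrightarrow> t \<le> t\<^sub>1 \<Longrightarrow> cmod x \<le> r + b * (t\<^sub>1 - t) \<Longrightarrow> (of_real t, x) \<in> S"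
    and lam: "\<And>t x. t\<^sub>0 \<le> t \<Longrightarrow> t \<le> t\<^sub>1 \<Longrightarrow> cmod x \<le> r + b * (t\<^sub>1 - t) \<Longrightarrow> Re (lam x) \<le> - (c + 2 * e)"
    and ineq: "\<And>t x. t\<^sub>0 \<le> t \<Longrightarrow> t \<le> t\<^sub>1 \<Longrightarrow> cmod x \<le> r + b * (t\<^sub>1 - t) \<Longrightarrow>
       cmod (of_real t * du_dt w (of_real t, x) - lam x * w (of_real t, x)) \<le> e * cmod (w (of_real t, x)) + b * t * cmod (du_dx w (of_real t, x))"
    and M: "\<And>x. cmod x \<le> r + b * (t\<^sub>1 - t\<^sub>0) \<Longrightarrow> cmod (w (of_real t\<^sub>0, x)) \<le> M"
    and x1: "cmod x\<^sub>1 \<le> r"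
  shows "cmod (w (of_real t\<^sub>1, x\<^sub>1)) \<le> (t\<^sub>0 / t\<^sub>1) powr c * M"
proof -
  define X where "X = {p :: real \<times> complex. t\<^sub>0 \<le> fst p \<and> fst p \<le> t\<^sub>1 \<and> cmod (snd p) \<le> r + b * (t\<^sub>1 - fst p)}"
  \<comment> \<open>The square makes the modulus differentiable as an inner product; the exponent
    \<open>2 * c\<close> matches it, so that the square root taken at the end leaves
    \<open>c\<close>.\<close>
  define g where "g p = fst p powr (2 * c) * (cmod (w (of_real (fst p), snd p)))\<^sup>2" for p :: "real \<times> complex"
  have "compact X"
  proof -
    have "closed X" unfolding X_def by (intro closed_Collect_conj closed_Collect_le continuous_intros)
    moreover have "X \<subseteq> {t\<^sub>0..t\<^sub>1} \<times> cball 0 (r + b * (t\<^sub>1 - t\<^sub>0))"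
    proof
      fix p assume p: "p \<in> X"
      then have "b * (t\<^sub>1 - fst p) \<le> b * (t\<^sub>1 - t\<^sub>0)" using b by (intro mult_left_mono) (auto simp: X_def)
      with p show "p \<in> {t\<^sub>0..t\<^sub>1} \<times> cball 0 (r + b * (t\<^sub>1 - t\<^sub>0))" by (cases p) (auto simp: X_def)
    qed
    moreover have "bounded ({t\<^sub>0..t\<^sub>1} \<times> cball (0 :: complex) (r + b * (t\<^sub>1 - t\<^sub>0)))" by (intro bounded_Times) auto
    ultimately show ?thesis using bounded_subset compact_eq_bounded_closed by blast
  qed
  moreover have p1: "(t\<^sub>1, x\<^sub>1) \<in> X" using t01 x1 by (simp add: X_def)
  moreover have "continuous_on X g"
    unfolding g_def
    by (intro continuous_intros continuous_on_compose2[OF holo2_continuous[OF w]])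
      (use S t01 in \<open>auto simp: X_def\<close>)
  ultimately obtain p where p: "p \<in> X" "\<And>q. q \<in> X \<Longrightarrow> g q \<le> g p"
    using continuous_attains_sup[of X g] by blast
  obtain \<tau> \<xi> where p_eq: "p = (\<tau>, \<xi>)" by (cases p)
  have \<tau>: "t\<^sub>0 \<le> \<tau>" "\<tau> \<le> t\<^sub>1" "cmod \<xi> \<le> r + b * (t\<^sub>1 - \<tau>)" "0 < \<tau>" using p(1) t01 by (auto simp: X_def p_eq)
  have M0: "M \<ge> 0"
  proof -
    have "0 \<le> b * (t\<^sub>1 - t\<^sub>0)" using b t01 by simp
    then have "cmod (0 :: complex) \<le> r + b * (t\<^sub>1 - t\<^sub>0)" using x1 norm_ge_zero[of x\<^sub>1] unfolding norm_zero by linarith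
    from M[OF this] show ?thesis by (rule order_trans[OF norm_ge_zero])
  qed
  have "g p \<le> t\<^sub>0 powr (2 * c) * M\<^sup>2"
  proof (cases "\<tau> = t\<^sub>0 \<or> w (of_real \<tau>, \<xi>) = 0")
    case True
    then show ?thesis
    proof
      assume "\<tau> = t\<^sub>0"
      then show ?thesis using M[of \<xi>] \<tau> by (auto simp: g_def p_eq intro!: mult_left_mono power_mono)
    qed (simp add: g_def p_eq)
  next
    case False
    then have \<tau>0: "t\<^sub>0 < \<tau>" and nz: "w (of_real \<tau>, \<xi>) \<noteq> 0" using \<tau> by auto
    define W where "W = w (of_real \<tau>, \<xi>)"
    define W\<^sub>t where "W\<^sub>t = du_dt w (of_real \<tau>, \<xi>)"
    define W\<^sub>x where "W\<^sub>x = du_dx w (of_real \<tau>, \<xi>)"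
    have "cmod (of_real \<tau> * W\<^sub>t - lam \<xi> * W) \<le> e * cmod W + b * \<tau> * cmod W\<^sub>x"
      unfolding W_def W\<^sub>t_def W\<^sub>x_def using ineq \<tau> by blast
    then obtain E1 E2 where E: "of_real \<tau> * W\<^sub>t - lam \<xi> * W = E1 + E2" "cmod E1 \<le> e * cmod W" "cmod E2 \<le> b * \<tau> * cmod W\<^sub>x"
      using complex_split_norm[of "of_real \<tau> * W\<^sub>t - lam \<xi> * W" "e * cmod W" "b * \<tau> * cmod W\<^sub>x"] e b \<tau> by auto
    \<comment> \<open>If \<open>W\<^sub>x = 0\<close>, division by zero gives
      \<open>\<beta> = 0\<close>, which is correct because then \<open>E2 = 0\<close>.\<close>
    define \<beta> where "\<beta> = E2 / (of_real \<tau> * W\<^sub>x)"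
    have "E2 = of_real \<tau> * \<beta> * W\<^sub>x \<and> cmod \<beta> \<le> b"
    proof (cases "W\<^sub>x = 0")
      case True
      then show ?thesis using E(3) b by (auto simp: \<beta>_def)
    next
      case False
      then show ?thesis using E(3) \<tau> by (auto simp: \<beta>_def norm_divide norm_mult field_simps)
    qed
    then have \<beta>: "E2 = of_real \<tau> * \<beta> * W\<^sub>x" "cmod \<beta> \<le> b" by auto
    \<comment> \<open>The derivative of \<open>w\<close> in the backward direction
      \<open>(-1, \<beta>)\<close>. The term \<open>E2\<close> cancels in it and leaves
      \<open>\<tau> * W' = - (lam \<xi> * W + E1)\<close>, whose inner product with \<open>W\<close>
      has a sign.\<close>
    define W' where "W' = - W\<^sub>t + \<beta> * W\<^sub>x"
    define \<omega> where "\<omega> h = w (of_real (\<tau> - h), \<xi> + of_real h * \<beta>)" for h :: real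
    have inS: "(of_real \<tau>, \<xi>) \<in> S" using S \<tau> by blast
    have "(\<omega> has_derivative (\<lambda>h. h *\<^sub>R W')) (at 0)"
    proof -
      have "((\<lambda>h. (complex_of_real (\<tau> - h), \<xi> + of_real h * \<beta>)) has_derivative (\<lambda>h. (- of_real h, of_real h * \<beta>))) (at 0)"
        by (auto intro!: derivative_eq_intros)
      from has_derivative_compose[OF this, of w "\<lambda>(h, k). W\<^sub>t * h + W\<^sub>x * k"] holo2_has_derivative[OF w inS]
      have "(\<omega> has_derivative (\<lambda>h. W\<^sub>t * - of_real h + W\<^sub>x * (of_real h * \<beta>))) (at 0)"
        by (simp add: \<omega>_def[abs_def] W\<^sub>t_def W\<^sub>x_def)
      moreover have "(\<lambda>h. W\<^sub>t * - of_real h + W\<^sub>x * (of_real h * \<beta>)) = (\<lambda>h. h *\<^sub>R W')"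
        by (auto simp: W'_def scaleR_conv_of_real algebra_simps)
      ultimately show ?thesis by simp
    qed
    from has_derivative_inner[OF this this]
    have "((\<lambda>h. \<omega> h \<bullet> \<omega> h) has_derivative (\<lambda>h. W \<bullet> (h *\<^sub>R W') + (h *\<^sub>R W') \<bullet> W)) (at 0)"
      by (simp add: \<omega>_def W_def)
    moreover have "(\<lambda>h. W \<bullet> (h *\<^sub>R W') + (h *\<^sub>R W') \<bullet> W) = (*) (2 * (W \<bullet> W'))"
      by (auto simp: inner_commute)
    ultimately have "((\<lambda>h. \<omega> h \<bullet> \<omega> h) has_real_derivative 2 * (W \<bullet> W')) (at 0)"
      by (simp add: has_field_derivative_def)
    moreover have "((\<lambda>h. (\<tau> - h) powr (2 * c)) has_real_derivative - (2 * c * \<tau> powr (2 * c - 1))) (at 0)"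
      using \<tau>(4) by (auto intro!: derivative_eq_intros)
    ultimately have der: "((\<lambda>h. (\<tau> - h) powr (2 * c) * (\<omega> h \<bullet> \<omega> h)) has_real_derivative
        \<tau> powr (2 * c) * (2 * (W \<bullet> W')) + - (2 * c * \<tau> powr (2 * c - 1)) * (W \<bullet> W)) (at 0)"
      by (intro DERIV_cong[OF DERIV_mult]) (auto simp: \<omega>_def W_def algebra_simps)
    have "of_real \<tau> * W' = - (lam \<xi> * W + E1)"
      using E(1) unfolding \<beta>(1) W'_def by (simp add: algebra_simps) 
    then have "\<tau> * (W \<bullet> W') = - (W \<bullet> (lam \<xi> * W) + W \<bullet> E1)"
      by (metis inner_add_right inner_minus_right inner_scaleR_right scaleR_conv_of_real)
    moreover have "W \<bullet> (lam \<xi> * W) = Re (lam \<xi>) * (cmod W)\<^sup>2"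
      unfolding cmod_power2 by (simp add: inner_complex_def algebra_simps power2_eq_square)
    moreover have "Re (lam \<xi>) * (cmod W)\<^sup>2 \<le> - (c + 2 * e) * (cmod W)\<^sup>2"
      using lam[OF \<tau>(1-3)] by (intro mult_right_mono) auto
    moreover have "W \<bullet> E1 \<le> e * (cmod W)\<^sup>2"
    proof -
      have "W \<bullet> E1 \<le> cmod W * cmod E1" by (rule norm_cauchy_schwarz)
      also have "\<dots> \<le> cmod W * (e * cmod W)" using E(2) by (intro mult_left_mono) auto
      finally show ?thesis by (simp add: power2_eq_square mult_ac)
    qed
    ultimately have "\<tau> * (W \<bullet> W') \<ge> (c + e) * (cmod W)\<^sup>2" by (simp add: algebra_simps)
    moreover have "e * (cmod W)\<^sup>2 > 0" using nz e by (simp add: W_def)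
    ultimately have "\<tau> * (W \<bullet> W') - c * (cmod W)\<^sup>2 > 0" by (simp add: algebra_simps)
    then have "2 * \<tau> powr (2 * c - 1) * (\<tau> * (W \<bullet> W') - c * (cmod W)\<^sup>2) > 0" using \<tau> by simp
    moreover have "\<tau> powr (2 * c) = \<tau> powr (2 * c - 1) * \<tau>" using \<tau> by (simp add: powr_diff)
    ultimately have "\<tau> powr (2 * c) * (2 * (W \<bullet> W')) + - (2 * c * \<tau> powr (2 * c - 1)) * (W \<bullet> W) > 0"
      by (simp add: power2_norm_eq_inner algebra_simps)
    from DERIV_pos_inc_right[OF der this] obtain d where d: "d > 0" 
      "\<And>h. 0 < h \<Longrightarrow> h < d \<Longrightarrow> \<tau> powr (2 * c) * (\<omega> 0 \<bullet> \<omega> 0) < (\<tau> - h) powr (2 * c) * (\<omega> h \<bullet> \<omega> h)"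
      by auto
    \<comment> \<open>One step backwards along the characteristic through the maximum point stays in \<open>X\<close>, because the slope of its
       lateral boundary is at least \<open>\<bar>\<beta>\<bar>\<close>, and increases \<open>g\<close>.\<close>
    define h where "h = min (d / 2) (\<tau> - t\<^sub>0)"
    have h: "0 < h" "h < d" "h \<le> \<tau> - t\<^sub>0" using d \<tau>0 by (auto simp: h_def)
    have "cmod (\<xi> + of_real h * \<beta>) \<le> cmod \<xi> + h * cmod \<beta>"
      using h norm_triangle_ineq[of \<xi> "of_real h * \<beta>"] by (simp add: norm_mult)
    also have "\<dots> \<le> r + b * (t\<^sub>1 - \<tau>) + h * b" using \<tau> h \<beta> by (intro add_mono mult_left_mono) auto
    finally have "(\<tau> - h, \<xi> + of_real h * \<beta>) \<in> X" using \<tau> h by (simp add: X_def algebra_simps)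
    from p(2)[OF this] d(2)[OF h(1,2)] have False
      by (simp add: g_def p_eq \<omega>_def power2_norm_eq_inner)
    then show ?thesis ..
  qed
  with p(2)[OF p1] have le: "t\<^sub>1 powr (2 * c) * (cmod (w (of_real t\<^sub>1, x\<^sub>1)))\<^sup>2 \<le> t\<^sub>0 powr (2 * c) * M\<^sup>2"
    by (simp add: g_def)
  have "0 < t\<^sub>1" using t01 by simp
  have sq: "s powr (2 * c) * y\<^sup>2 = (s powr c * y)\<^sup>2" if "s > 0" for s y :: real
    using that unfolding power2_eq_square mult_2 powr_add by (simp only: mult_ac)
  have "(t\<^sub>1 powr c * cmod (w (of_real t\<^sub>1, x\<^sub>1)))\<^sup>2 \<le> (t\<^sub>0 powr c * M)\<^sup>2"
    using le unfolding sq[OF t01(1)] sq[OF \<open>0 < t\<^sub>1\<close>] .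
  then have "t\<^sub>1 powr c * cmod (w (of_real t\<^sub>1, x\<^sub>1)) \<le> t\<^sub>0 powr c * M"
    by (rule power2_le_imp_le) (use M0 in simp)
  then have "cmod (w (of_real t\<^sub>1, x\<^sub>1)) \<le> t\<^sub>0 powr c * M / t\<^sub>1 powr c"
    using \<open>0 < t\<^sub>1\<close> by (subst pos_le_divide_eq) (simp_all add: mult.commute)
  then show ?thesis using t01(1) \<open>0 < t\<^sub>1\<close> by (simp add: powr_divide)
qed

section \<open>Comparison of two solutions\<close>

context briot_bouquet_estimates
begin

text \<open>The term \<open>a x * t\<close> cancels in the difference and \<open>lam\<close> moves
  to the left, which leaves the Lipschitz bound of \<open>P\<close> at scale
  \<open>N\<close>.\<close>

lemma difference_of_solutions:
  assumes u: "u holomorphic2_on S" and w: "w holomorphic2_on S" and tx: "(t, x) \<in> S"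
    and equ: "t * du_dt u (t, x) = F (t, x, u (t, x), du_dx u (t, x))"
    and eqw: "t * du_dt w (t, x) = F (t, x, w (t, x), du_dx w (t, x))"
    and N: "cmod t \<le> N" "cmod x < \<rho>" "cmod (u (t, x)) \<le> N" "cmod (du_dx u (t, x)) \<le> N" "cmod (w (t, x)) \<le> N" "cmod (du_dx w (t, x)) \<le> N" "N \<le> \<rho>"
  shows "cmod (t * du_dt (\<lambda>p. u p - w p) (t, x) - lam x * (u (t, x) - w (t, x)))
     \<le> K * N * cmod (u (t, x) - w (t, x)) + K * N * cmod (du_dx (\<lambda>p. u p - w p) (t, x))"
proof -
  have "t * du_dt (\<lambda>p. u p - w p) (t, x) - lam x * (u (t, x) - w (t, x)) = P t x (u (t, x)) (du_dx u (t, x)) - P t x (w (t, x)) (du_dx w (t, x))"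
    using equ eqw by (simp add: holo2_diff_partials[OF u w tx] P_def algebra_simps)
  with P_lipschitz[OF N(1-4) N(5,6) N(7)] show ?thesis
    by (simp only: holo2_diff_partials(2)[OF u w tx] distrib_left)
qed

end

context briot_bouquet_estimates
begin

text \<open>Two uses of the maximum principle. In the first, \<open>t\<^sub>0 / t\<close> is fixed
  and each step improves the bound on a slightly smaller disc; in the second,
  \<open>v = O(t)\<close> makes the slope of the domain independent of \<open>t\<^sub>0\<close>,
  which may then tend to 0.\<close>

lemma solution_unique:
  assumes u: "u holomorphic2_on S" and w: "w holomorphic2_on S" and sub: "seg_disc \<sigma>\<^sub>0 r\<^sub>0 \<subseteq> S"
    and pos0: "0 < \<sigma>\<^sub>0" "0 < r\<^sub>0" "r\<^sub>0 \<le> \<rho>" "0 < C"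
    and wb: "\<And>t x. (t, x) \<in> seg_disc \<sigma>\<^sub>0 r\<^sub>0 \<Longrightarrow> cmod (w (t, x)) \<le> C * cmod t \<and> cmod (du_dx w (t, x)) \<le> C * cmod t"
    and equ: "\<And>t x. (t, x) \<in> seg_disc \<sigma>\<^sub>0 r\<^sub>0 \<Longrightarrow> t * du_dt u (t, x) = F (t, x, u (t, x), du_dx u (t, x))"
    and eqw: "\<And>t x. (t, x) \<in> seg_disc \<sigma>\<^sub>0 r\<^sub>0 \<Longrightarrow> t * du_dt w (t, x) = F (t, x, w (t, x), du_dx w (t, x))"
    and small: "\<And>\<epsilon> r. 0 < \<epsilon> \<Longrightarrow> 0 < r \<Longrightarrow> \<exists>s \<sigma>. 0 < s \<and> s < r \<and> 0 < \<sigma> \<and> (\<forall>p\<in>seg_disc \<sigma> s. cmod (u p) \<le> \<epsilon> * s\<^sup>2)"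
  obtains T r where "0 < T" "0 < r" "T \<le> \<sigma>\<^sub>0" "r \<le> r\<^sub>0" "\<And>p. p \<in> seg_disc T r \<Longrightarrow> u p = w p"
proof -
  \<comment> \<open>Half of the rate \<open>c\<close> is kept as decay \<open>c'\<close>, the other
    half becomes the margin \<open>2 * e\<close> of the maximum principle.\<close>
  define e where "e = c / 4"
  define c' where "c' = c / 2"
  have ec: "0 < e" "0 < c'" "c' + 2 * e = c" using pos by (auto simp: e_def c'_def)
  \<comment> \<open>The ratio \<open>t\<^sub>0 / t\<close> for which the decay factor
    \<open>(t\<^sub>0 / t) powr c'\<close> is exactly 1/4.\<close>
  define \<kappa> where "\<kappa> = (1 / 4 :: real) powr (1 / c')"
  have \<kappa>: "0 < \<kappa>" "\<kappa> < 1" "\<kappa> powr c' = 1 / 4"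
    using ec by (auto simp: \<kappa>_def powr_powr powr01_less_one)
  \<comment> \<open>With \<open>N = 20 * \<epsilon> * s * q\<close> below, the three bounds say that
    the drift of a step is at most \<open>\<delta>\<close> (160 is 20 times 8), that
    \<open>K * N \<le> e\<close>, and that \<open>N \<le> \<rho>\<close>.\<close>
  define \<epsilon> where "\<epsilon> = min (min (\<kappa> / (160 * K)) (e / (20 * K))) (\<rho> / 20)"
  have \<epsilon>: "0 < \<epsilon>" "20 * K * \<epsilon> \<le> \<kappa> / 8" "20 * K * \<epsilon> \<le> e" "20 * \<epsilon> \<le> \<rho>"
  proof -
    show "0 < \<epsilon>" using \<kappa> ec pos by (simp add: \<epsilon>_def)
    have "\<epsilon> \<le> \<kappa> / (160 * K)" "\<epsilon> \<le> e / (20 * K)" "\<epsilon> \<le> \<rho> / 20" by (auto simp: \<epsilon>_def)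
    then show "20 * K * \<epsilon> \<le> \<kappa> / 8" "20 * K * \<epsilon> \<le> e" "20 * \<epsilon> \<le> \<rho>" using pos by (simp_all add: field_simps)
  qed
  obtain s \<sigma>\<^sub>1 where s: "0 < s" "s < min r\<^sub>0 1" and \<sigma>1: "0 < \<sigma>\<^sub>1" "\<And>p. p \<in> seg_disc \<sigma>\<^sub>1 s \<Longrightarrow> cmod (u p) \<le> \<epsilon> * s\<^sup>2"
    using small[OF \<epsilon>(1), of "min r\<^sub>0 1"] pos0 by auto
  have s': "s < r\<^sub>0" "s < 1" "s < \<rho>" using s pos0 by auto
  \<comment> \<open>Makes \<open>t\<close> and the bound \<open>C * t\<close> of \<open>w\<close>
    together no larger than the bound \<open>\<epsilon> * s\<^sup>2\<close> of
    \<open>u\<close>.\<close>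
  define \<sigma> where "\<sigma> = min (min \<sigma>\<^sub>0 \<sigma>\<^sub>1) (\<epsilon> * s\<^sup>2 / (C + 1))"
  have \<sigma>: "0 < \<sigma>" "\<sigma> \<le> \<sigma>\<^sub>0" "\<sigma> \<le> \<sigma>\<^sub>1" "(C + 1) * \<sigma> \<le> \<epsilon> * s\<^sup>2"
  proof -
    show "0 < \<sigma>" "\<sigma> \<le> \<sigma>\<^sub>0" "\<sigma> \<le> \<sigma>\<^sub>1" using pos0 \<sigma>1 \<epsilon> s by (auto simp: \<sigma>_def)
    have "\<sigma> \<le> \<epsilon> * s\<^sup>2 / (C + 1)" by (simp add: \<sigma>_def)
    then show "(C + 1) * \<sigma> \<le> \<epsilon> * s\<^sup>2" using pos0 by (simp add: field_simps)
  qed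
  define v where "v p = u p - w p" for p
  have v: "v holomorphic2_on S" unfolding v_def[abs_def] by (rule holo2_diff[OF u w])
  have seg: "(of_real t, x) \<in> seg_disc \<sigma>' r'" if "0 < t" "t < \<sigma>'" "cmod x < r'" for t x \<sigma>' r'
    using that by (auto simp: seg_disc_def)
  have inS: "(of_real t, x) \<in> S" if "0 < t" "t < \<sigma>" "cmod x < s" for t x
    using seg[of t \<sigma>\<^sub>0 x r\<^sub>0] sub that \<sigma> s' by auto
  have wb': "cmod (w (of_real t, x)) \<le> C * t" "cmod (du_dx w (of_real t, x)) \<le> C * t" if "0 < t" "t < \<sigma>" "cmod x < s" for t x
    using wb[of "of_real t" x] seg[of t \<sigma>\<^sub>0 x r\<^sub>0] that \<sigma> s' by auto
  have vx: "du_dx v (of_real t, x) = du_dx u (of_real t, x) - du_dx w (of_real t, x)" if "0 < t" "t < \<sigma>" "cmod x < s" for t x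
    unfolding v_def[abs_def] by (rule holo2_diff_partials[OF u w inS[OF that]])
  have cauchy: "cmod (du_dx v (of_real t, x)) \<le> B / d"
    if "0 < t" "t < \<sigma>" "0 < d" "cmod x + d \<le> s" and B: "\<And>y. cmod y < cmod x + d \<Longrightarrow> cmod (v (of_real t, y)) \<le> B" for t x B d
  proof -
    have sub: "cmod y < cmod x + d" if "y \<in> ball x d" for y
      using that norm_triangle_sub[of y x] by (auto simp: dist_norm norm_minus_commute)
    then have "(\<lambda>y. v (of_real t, y)) holomorphic_on ball x d"
      using that inS by (intro holo2_slices(2)[OF v]) fastforce
    then show ?thesis unfolding du_dx_def prod.case using sub B that by (intro deriv_norm_le) auto
  qed
  have ineq: "cmod (of_real t * du_dt v (of_real t, x) - lam x * v (of_real t, x)) \<le> e * cmod (v (of_real t, x)) + b * t * cmod (du_dx v (of_real t, x))"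
    if t: "0 < t" "t < \<sigma>" "cmod x < s" and vb: "cmod (v (of_real t, x)) \<le> N - C * t" "cmod (du_dx v (of_real t, x)) \<le> N - C * t"
      and N: "t \<le> N" "C * t \<le> N" "N \<le> \<rho>" "K * N \<le> e" "K * N \<le> b * t" for t x N b
  proof -
    have "cmod (u (of_real t, x)) \<le> N" "cmod (du_dx u (of_real t, x)) \<le> N"
      using vb wb'[OF t] norm_triangle_ineq[of "v (of_real t, x)" "w (of_real t, x)"] 
        norm_triangle_ineq[of "du_dx v (of_real t, x)" "du_dx w (of_real t, x)"]
      by (simp_all add: v_def vx[OF t])
    moreover have "cmod (w (of_real t, x)) \<le> N" "cmod (du_dx w (of_real t, x)) \<le> N"
      using wb'[OF t] N by linarith+
    ultimately have "cmod (of_real t * du_dt v (of_real t, x) - lam x * v (of_real t, x)) \<le> K * N * cmod (v (of_real t, x)) + K * N * cmod (du_dx v (of_real t, x))"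
      unfolding v_def[abs_def] using t s' N \<sigma> by (intro difference_of_solutions[OF u w inS[OF t]] equ eqw seg) auto
    also have "\<dots> \<le> e * cmod (v (of_real t, x)) + b * t * cmod (du_dx v (of_real t, x))"
      using N by (intro add_mono mult_right_mono) auto
    finally show ?thesis .
  qed
  define s\<^sub>n where "s\<^sub>n n = s * (1 / 2 + 1 / 2 ^ Suc n)" for n
  have sn: "s\<^sub>n n \<le> s" "s / 2 < s\<^sub>n n" "s\<^sub>n n - s\<^sub>n (Suc n) = s / 2 ^ n / 4" for n
    using s by (auto simp: s\<^sub>n_def field_simps self_le_power)
  \<comment> \<open>The margin between successive discs halves with \<open>n\<close>, and Cauchy's
    estimate and the drift each cost one such factor; this is why the bound has to drop by 4. The
    range of \<open>t\<close> is halved because \<open>N\<close>, which also halves, must dominate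
    \<open>t\<close> and \<open>w\<close>.\<close>
  have claim: "cmod (v (of_real t, x)) \<le> 2 * \<epsilon> * s\<^sup>2 / 4 ^ n" if "0 < t" "t < \<sigma> / 2 ^ n" "cmod x < s\<^sub>n n" for n t x
    using that
  proof (induction n arbitrary: t x)
    case 0
    then have t: "0 < t" "t < \<sigma>" "cmod x < s" by (auto simp: s\<^sub>n_def)
    have "cmod (u (of_real t, x)) \<le> \<epsilon> * s\<^sup>2" using t \<sigma> by (intro \<sigma>1(2) seg) auto
    moreover have "C * t \<le> (C + 1) * \<sigma>" using t pos0 by (intro mult_mono) auto
    then have "cmod (w (of_real t, x)) \<le> \<epsilon> * s\<^sup>2" using wb'(1)[OF t] \<sigma> by linarith
    ultimately show ?case using norm_triangle_ineq4[of "u (of_real t, x)" "w (of_real t, x)"] by (simp add: v_def)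
  next
    case (Suc n)
    define q where "q = 1 / (2 :: real) ^ n"
    have q: "0 < q" "q \<le> 1" by (auto simp: q_def)
    \<comment> \<open>Half of the loss of radius in this step: one \<open>\<delta>\<close> is spent
      on the drift of the characteristics, the other is the radius for Cauchy's estimate.\<close>
    define \<delta> where "\<delta> = s * q / 8"
    have \<delta>: "0 < \<delta>" "s\<^sub>n (Suc n) = s\<^sub>n n - 2 * \<delta>" using s q sn(3)[of n] by (auto simp: \<delta>_def q_def)
    define M where "M = 2 * \<epsilon> * s\<^sup>2 / 4 ^ n"
    have M_eq: "M = 2 * \<epsilon> * s\<^sup>2 * q\<^sup>2" by (simp add: M_def q_def power_divide power2_eq_square flip: power_mult_distrib)
    have "\<sigma> / 2 ^ Suc n \<le> \<sigma> / 2 ^ n" using \<sigma> by (intro divide_left_mono power_increasing) auto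
    then have "t < \<sigma> / 2 ^ n" using Suc.prems by linarith
    moreover have "\<sigma> * q \<le> \<sigma> * 1" using q \<sigma> by (intro mult_left_mono) auto
    ultimately have tn: "0 < t" "t < \<sigma> * q" "\<sigma> * q \<le> \<sigma>" using Suc.prems by (simp_all add: q_def)
    \<comment> \<open>Cauchy's estimate \<open>M / \<delta>\<close> for the derivative of
      \<open>v\<close> equals \<open>16 * \<epsilon> * s * q\<close>, and
      \<open>C * \<tau> + \<tau>\<close> adds at most \<open>\<epsilon> * s * q\<close>; 20 leaves
      some room.\<close>
    define N where "N = 20 * \<epsilon> * s * q"
    define t\<^sub>0 where "t\<^sub>0 = \<kappa> * t"
    \<comment> \<open>The smallest constant with \<open>K * N \<le> b * \<tau>\<close> for all
      \<open>\<tau> \<ge> t\<^sub>0\<close>.\<close>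
    define b where "b = K * N / t\<^sub>0"
    have t0: "0 < t\<^sub>0" "t\<^sub>0 < t" using tn \<kappa> by (auto simp: t\<^sub>0_def)
    have N0: "N > 0" using \<epsilon> s q by (simp add: N_def)
    have sq: "s * q \<le> 1" using s' s q by (intro mult_le_one) auto
    have b0: "b \<ge> 0" using N0 pos t0 by (simp add: b_def)
    have bt: "b * t \<le> \<delta>"
    proof -
      have "b * t = (20 * K * \<epsilon>) / \<kappa> * (s * q)" using tn by (simp add: b_def t\<^sub>0_def N_def)
      also have "\<dots> \<le> (\<kappa> / 8) / \<kappa> * (s * q)" using \<epsilon> \<kappa> s q by (intro mult_right_mono divide_right_mono) auto
      finally show ?thesis using \<kappa> by (simp add: \<delta>_def)
    qed
    have est: "cmod (v (of_real \<tau>, y)) \<le> M" "cmod (du_dx v (of_real \<tau>, y)) \<le> 16 * \<epsilon> * s * q" "cmod y < s" "\<tau> < \<sigma>" "0 < \<tau>"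
      if \<tau>: "t\<^sub>0 \<le> \<tau>" "\<tau> \<le> t" "cmod y \<le> cmod x + b * (t - \<tau>)" for \<tau> y
    proof -
      have "b * (t - \<tau>) \<le> b * t" using b0 t0 \<tau> by (intro mult_left_mono) auto
      then have y: "cmod y < s\<^sub>n n - \<delta>" using \<tau>(3) bt Suc.prems(3) \<delta> by simp
      show ys: "cmod y < s" using y \<delta> sn(1)[of n] by linarith
      show ts: "\<tau> < \<sigma>" "0 < \<tau>" using \<tau> tn t0 by linarith+
      have IH: "cmod (v (of_real \<tau>, y')) \<le> M" if "cmod y' < s\<^sub>n n" for y'
        unfolding M_def using \<tau> tn t0 that by (intro Suc.IH) (auto simp: q_def)
      show "cmod (v (of_real \<tau>, y)) \<le> M" using y \<delta> by (intro IH) linarith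
      have "cmod (du_dx v (of_real \<tau>, y)) \<le> M / \<delta>"
        using ts y \<delta> sn(1)[of n] by (intro cauchy IH) linarith+
      also have "\<dots> = 16 * \<epsilon> * s * q" using s q by (simp add: M_eq \<delta>_def power2_eq_square)
      finally show "cmod (du_dx v (of_real \<tau>, y)) \<le> 16 * \<epsilon> * s * q" .
    qed
    have M_le: "M \<le> 2 * \<epsilon> * s * q"
    proof -
      have "(2 * \<epsilon> * s * q) * (s * q) \<le> (2 * \<epsilon> * s * q) * 1" using sq \<epsilon> s q by (intro mult_left_mono) auto
      then show ?thesis by (simp add: M_eq power2_eq_square mult_ac)
    qed
    have Ct: "(C + 1) * \<tau> \<le> \<epsilon> * s * q" if "0 < \<tau>" "\<tau> \<le> t" for \<tau>
    proof -
      have "(C + 1) * \<tau> \<le> (C + 1) * (\<sigma> * q)" using that tn pos0 by (intro mult_left_mono) auto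
      also have "\<dots> \<le> \<epsilon> * s\<^sup>2 * q" using mult_right_mono[OF \<sigma>(4), of q] q by (simp add: mult_ac)
      also have "\<dots> \<le> \<epsilon> * (s * 1) * q" unfolding power2_eq_square using \<epsilon> s s' q by (intro mult_right_mono mult_left_mono) auto
      finally show ?thesis by simp
    qed
    have "cmod (v (of_real t, x)) \<le> (t\<^sub>0 / t) powr c' * M"
    proof (rule transport_max_principle[OF v t0 b0 ec(1), where r = "cmod x" and lam = lam])
      fix \<tau> y assume \<tau>: "t\<^sub>0 \<le> \<tau>" "\<tau> \<le> t" "cmod y \<le> cmod x + b * (t - \<tau>)"
      note est = est[OF \<tau>]
      show "(of_real \<tau>, y) \<in> S" using est by (intro inS)
      show "Re (lam y) \<le> - (c' + 2 * e)" unfolding ec(3) using est s' by (intro Re_lam) simp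
      have pm: "0 < \<epsilon> * s * q" using \<epsilon> s q by simp
      have C1: "C * \<tau> + \<tau> \<le> \<epsilon> * s * q" using Ct[of \<tau>] \<tau> est by (simp add: algebra_simps)
      have C2: "0 < C * \<tau>" using est pos0 by simp
      have n1: "N = 20 * (\<epsilon> * s * q)" by (simp add: N_def)
      have m1: "M \<le> 2 * (\<epsilon> * s * q)" using M_le by simp
      have m2: "cmod (du_dx v (of_real \<tau>, y)) \<le> 16 * (\<epsilon> * s * q)" using est(2) by simp
      have KN: "20 * \<epsilon> * (s * q) \<le> 20 * \<epsilon> * 1" using sq \<epsilon> by (intro mult_left_mono) auto
      have "K * N = K * (20 * \<epsilon> * (s * q))" by (simp add: N_def)
      also have "\<dots> \<le> K * (20 * \<epsilon> * 1)" using pos by (intro mult_left_mono[OF KN]) simp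
      also have "\<dots> \<le> e" using \<epsilon>(3) by simp
      finally have KNe: "K * N \<le> e" .
      have "K * N = b * t\<^sub>0" using t0 by (simp add: b_def)
      also have "\<dots> \<le> b * \<tau>" using \<tau> b0 by (intro mult_left_mono)
      finally have KNb: "K * N \<le> b * \<tau>" .
      show "cmod (of_real \<tau> * du_dt v (of_real \<tau>, y) - lam y * v (of_real \<tau>, y)) \<le> e * cmod (v (of_real \<tau>, y)) + b * \<tau> * cmod (du_dx v (of_real \<tau>, y))"
      proof (rule ineq[OF est(5,4,3), where N = N])
        show "cmod (v (of_real \<tau>, y)) \<le> N - C * \<tau>" using est(1) m1 C1 est(5) pm unfolding n1 by linarith
        show "cmod (du_dx v (of_real \<tau>, y)) \<le> N - C * \<tau>" using m2 C1 est(5) pm unfolding n1 by linarith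
        show "\<tau> \<le> N" "C * \<tau> \<le> N" using C1 C2 est(5) pm unfolding n1 by linarith+
        show "N \<le> \<rho>" using KN \<epsilon>(4) by (simp add: N_def)
      qed (rule KNe KNb)+
    next
      fix y assume "cmod y \<le> cmod x + b * (t - t\<^sub>0)"
      then show "cmod (v (of_real t\<^sub>0, y)) \<le> M" using t0 by (intro est) auto
    qed simp
    also have "(t\<^sub>0 / t) powr c' = 1 / 4" using tn \<kappa> by (simp add: t\<^sub>0_def)
    finally show ?case by (simp add: M_def)
  qed
  define M\<^sub>1 where "M\<^sub>1 = 4 * \<epsilon> * s\<^sup>2 / \<sigma>"
  have M1: "M\<^sub>1 > 0" using \<epsilon> s \<sigma> by (simp add: M\<^sub>1_def)
  \<comment> \<open>The least \<open>n\<close> with \<open>\<sigma> / 2 ^ Suc n \<le> t\<close>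
    places \<open>t\<close> in a dyadic interval. Of the factor \<open>1 / 4 ^ n\<close> only
    \<open>1 / 2 ^ n\<close> is kept, since a linear bound in \<open>t\<close> is the goal.\<close>
  have lin: "cmod (v (of_real t, x)) \<le> M\<^sub>1 * t" if t: "0 < t" "t < \<sigma>" "cmod x < s / 2" for t x
  proof -
    define Q where "Q n \<longleftrightarrow> \<sigma> / 2 ^ Suc n \<le> t" for n
    have "\<exists>n. Q n"
    proof -
      obtain n where "\<sigma> / t < 2 ^ n" using real_arch_pow[of 2 "\<sigma> / t"] by auto
      then have "\<sigma> / 2 ^ n \<le> t" using t by (simp add: field_simps)
      moreover have "\<sigma> / 2 ^ Suc n \<le> \<sigma> / 2 ^ n" using \<sigma> by (intro divide_left_mono power_increasing) auto
      ultimately show ?thesis unfolding Q_def by (intro exI[of _ n]) simp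
    qed
    then have "Q (LEAST n. Q n)" by (rule LeastI_ex)
    moreover define n where "n = (LEAST n. Q n)"
    ultimately have Qn: "Q n" by simp
    have tn: "t < \<sigma> / 2 ^ n"
    proof (cases n)
      case 0
      then show ?thesis using t by simp
    next
      case (Suc m)
      then have "\<not> Q m" unfolding n_def using not_less_Least by (metis lessI)
      then show ?thesis by (simp add: Q_def Suc)
    qed
    have "cmod (v (of_real t, x)) \<le> 2 * \<epsilon> * s\<^sup>2 / 4 ^ n"
      using t tn sn(2)[of n] by (intro claim) auto
    also have "\<dots> \<le> 2 * \<epsilon> * s\<^sup>2 / 2 ^ n"
      using \<epsilon> by (intro divide_left_mono power_mono) auto
    also have "\<dots> = M\<^sub>1 * (\<sigma> / 2 ^ Suc n)" using \<sigma> by (simp add: M\<^sub>1_def)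
    also have "\<dots> \<le> M\<^sub>1 * t" using M1 Qn by (intro mult_left_mono) (auto simp: Q_def)
    finally show ?thesis .
  qed
  \<comment> \<open>Now \<open>N = C\<^sub>2 * \<tau>\<close> dominates \<open>\<tau>\<close>, both
    solutions and their \<open>x\<close>-derivatives; \<open>s / 4\<close> is the Cauchy radius
    between the disc of radius \<open>s / 4\<close> and the disc of radius \<open>s / 2\<close> of
    the linear bound.\<close>
  define C\<^sub>2 where "C\<^sub>2 = 1 + C + M\<^sub>1 + M\<^sub>1 / (s / 4)"
  have C2: "C\<^sub>2 > 0" "C\<^sub>2 \<ge> 1" "C\<^sub>2 \<ge> C" "C\<^sub>2 - C \<ge> M\<^sub>1" "C\<^sub>2 - C \<ge> M\<^sub>1 / (s / 4)"
  proof -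
    have "0 < M\<^sub>1 / (s / 4)" using M1 s by simp
    then show "C\<^sub>2 > 0" "C\<^sub>2 \<ge> 1" "C\<^sub>2 \<ge> C" "C\<^sub>2 - C \<ge> M\<^sub>1" "C\<^sub>2 - C \<ge> M\<^sub>1 / (s / 4)"
      using M1 pos0 unfolding C\<^sub>2_def by linarith+
  qed
  \<comment> \<open>The last three entries give \<open>N \<le> \<rho>\<close>,
    \<open>K * N \<le> e\<close>, and a total drift of at most \<open>s / 8\<close>, so that
    characteristics from the disc of radius \<open>s / 8\<close> stay in the one of radius
    \<open>s / 4\<close>.\<close>
  define T where "T = min \<sigma> (min (min (\<rho> / C\<^sub>2) (e / (K * C\<^sub>2))) (s / (8 * K * C\<^sub>2)))"
  have T: "0 < T" "T \<le> \<sigma>" "C\<^sub>2 * T \<le> \<rho>" "K * C\<^sub>2 * T \<le> e" "K * C\<^sub>2 * T \<le> s / 8"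
  proof -
    show "0 < T" "T \<le> \<sigma>" using \<sigma> pos C2 ec s by (auto simp: T_def)
    have "T \<le> \<rho> / C\<^sub>2" "T \<le> e / (K * C\<^sub>2)" "T \<le> s / (8 * K * C\<^sub>2)" by (auto simp: T_def)
    then show "C\<^sub>2 * T \<le> \<rho>" "K * C\<^sub>2 * T \<le> e" "K * C\<^sub>2 * T \<le> s / 8" using C2 pos by (simp_all add: field_simps)
  qed
  have zero: "v (of_real t, x) = 0" if t: "0 < t" "t < T" "cmod x < s / 8" for t x
  proof -
    define b where "b = K * C\<^sub>2"
    have b0: "b \<ge> 0" using pos C2 by (simp add: b_def)
    have le: "cmod (v (of_real t, x)) \<le> M\<^sub>1 * t\<^sub>0" if t0: "0 < t\<^sub>0" "t\<^sub>0 < t" for t\<^sub>0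
    proof -
      have y: "cmod y < s / 4" "\<tau> < \<sigma>" "0 < \<tau>" "cmod y < s" "cmod y < s / 2"
        if \<tau>: "t\<^sub>0 \<le> \<tau>" "\<tau> \<le> t" "cmod y \<le> cmod x + b * (t - \<tau>)" for \<tau> y
      proof -
        have "b * (t - \<tau>) \<le> b * T" using b0 t t0 \<tau> by (intro mult_left_mono) auto
        then show "cmod y < s / 4" "\<tau> < \<sigma>" "0 < \<tau>" "cmod y < s" "cmod y < s / 2" using \<tau> t T t0 s by (auto simp: b_def)
      qed
      have "cmod (v (of_real t, x)) \<le> (t\<^sub>0 / t) powr c' * (M\<^sub>1 * t\<^sub>0)"
      proof (rule transport_max_principle[OF v t0 b0 ec(1), where r = "cmod x" and lam = lam])
        fix \<tau> y assume \<tau>: "t\<^sub>0 \<le> \<tau>" "\<tau> \<le> t" "cmod y \<le> cmod x + b * (t - \<tau>)"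
        note y = y[OF \<tau>]
        show "(of_real \<tau>, y) \<in> S" using y by (intro inS)
        show "Re (lam y) \<le> - (c' + 2 * e)" unfolding ec(3) using y s' by (intro Re_lam) simp
        have mono: "X * \<tau> \<le> Y" if "X * T \<le> Y" "0 \<le> X" for X Y
          using that \<tau> t mult_left_mono[of \<tau> T X] by auto
        show "cmod (of_real \<tau> * du_dt v (of_real \<tau>, y) - lam y * v (of_real \<tau>, y)) \<le> e * cmod (v (of_real \<tau>, y)) + b * \<tau> * cmod (du_dx v (of_real \<tau>, y))"
        proof (rule ineq[OF y(3,2,4), where N = "C\<^sub>2 * \<tau>"])
          have "M\<^sub>1 * \<tau> \<le> (C\<^sub>2 - C) * \<tau>" "M\<^sub>1 / (s / 4) * \<tau> \<le> (C\<^sub>2 - C) * \<tau>" using C2 y by (intro mult_right_mono; simp)+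
          moreover have "cmod (v (of_real \<tau>, y)) \<le> M\<^sub>1 * \<tau>" using y by (intro lin)
          moreover have "cmod (du_dx v (of_real \<tau>, y)) \<le> (M\<^sub>1 * \<tau>) / (s / 4)"
            using y s by (intro cauchy lin) auto
          ultimately show "cmod (v (of_real \<tau>, y)) \<le> C\<^sub>2 * \<tau> - C * \<tau>" "cmod (du_dx v (of_real \<tau>, y)) \<le> C\<^sub>2 * \<tau> - C * \<tau>"
            by (simp_all add: algebra_simps)
          show "\<tau> \<le> C\<^sub>2 * \<tau>" "C * \<tau> \<le> C\<^sub>2 * \<tau>" using C2 y mult_right_mono[of 1 C\<^sub>2 \<tau>] by (auto intro: mult_right_mono)
          show "C\<^sub>2 * \<tau> \<le> \<rho>" using T C2 by (intro mono) auto
          have "K * C\<^sub>2 * \<tau> \<le> e" using T C2 pos by (intro mono) auto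
          then show "K * (C\<^sub>2 * \<tau>) \<le> e" by (simp add: mult.assoc)
          show "K * (C\<^sub>2 * \<tau>) \<le> b * \<tau>" by (simp add: b_def)
        qed
      next
        fix z assume "cmod z \<le> cmod x + b * (t - t\<^sub>0)"
        then show "cmod (v (of_real t\<^sub>0, z)) \<le> M\<^sub>1 * t\<^sub>0" using t0 y[of t\<^sub>0 z] by (intro lin) auto
      qed simp
      also have "\<dots> \<le> 1 * (M\<^sub>1 * t\<^sub>0)" using t0 M1 ec by (intro mult_right_mono powr_le1) auto
      finally show ?thesis by simp
    qed
    \<comment> \<open>The point \<open>(t, x)\<close> and the disc are fixed while
      \<open>t\<^sub>0\<close> tends to 0, and the bound \<open>M\<^sub>1 * t\<^sub>0\<close>
      vanishes in the limit.\<close>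
    have "cmod (v (of_real t, x)) / M\<^sub>1 \<le> t\<^sub>0" if "0 < t\<^sub>0" "t\<^sub>0 < t" for t\<^sub>0
      using le[OF that] M1 by (simp add: pos_divide_le_eq mult.commute)
    then have "cmod (v (of_real t, x)) / M\<^sub>1 \<le> 0" by (rule dense_ge_bounded[OF t(1)])
    then show ?thesis using M1 by (simp add: field_simps)
  qed
  show ?thesis
  proof (rule that[of T "s / 8"])
    show "u p = w p" if "p \<in> seg_disc T (s / 8)" for p
      using zero that by (auto simp: seg_disc_def v_def)
  qed (use T \<sigma> s s' in auto)
qed

end

section \<open>From the growth hypothesis to the continuation\<close>

text \<open>The expression is monotone in \<open>\<sigma>\<close>, so its limit at 0 is an infimum,
  and an infimum below \<open>\<epsilon>\<close> is witnessed by some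
  \<open>\<sigma>\<close>.\<close>

lemma scaled_sup_limit_less:
  assumes "scaled_sup_limit u R < ereal \<epsilon>" "R > 0"
  shows "\<exists>\<sigma>>0. \<forall>p\<in>seg_disc \<sigma> R. cmod (u p) \<le> \<epsilon> * R\<^sup>2"
proof -
  define h where "h \<sigma> = ereal (1 / R\<^sup>2) * (SUP p\<in>seg_disc \<sigma> R. ereal (cmod (u p)))" for \<sigma>
  have mono: "h \<sigma> \<le> h \<sigma>'" if "\<sigma> \<le> \<sigma>'" for \<sigma> \<sigma>'
  proof -
    have "seg_disc \<sigma> R \<subseteq> seg_disc \<sigma>' R" using that by (auto simp: seg_disc_def)
    then show ?thesis unfolding h_def by (intro ereal_mult_left_mono SUP_subset_mono) auto
  qed
  have "(h \<longlongrightarrow> (INF \<sigma>\<in>{0<..}. h \<sigma>)) (at_right 0)"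
  proof (rule order_tendstoI)
    fix l assume "l < (INF \<sigma>\<in>{0<..}. h \<sigma>)"
    then have "l < h \<sigma>" if "0 < \<sigma>" for \<sigma> using that by (meson INF_lower greaterThan_iff less_le_trans)
    then show "\<forall>\<^sub>F \<sigma> in at_right 0. l < h \<sigma>" by (simp add: eventually_at_filter)
  next
    fix l assume "(INF \<sigma>\<in>{0<..}. h \<sigma>) < l"
    then obtain \<sigma> where \<sigma>: "0 < \<sigma>" "h \<sigma> < l" by (auto simp: INF_less_iff)
    have "\<forall>\<^sub>F \<sigma>' in at_right 0. \<sigma>' \<in> {0<..<\<sigma>}" using \<sigma>(1) by (rule eventually_at_right_real)
    then show "\<forall>\<^sub>F \<sigma>' in at_right 0. h \<sigma>' < l"
    proof eventually_elim
      case (elim \<sigma>')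
      then have "h \<sigma>' \<le> h \<sigma>" by (intro mono) simp
      then show ?case using \<sigma>(2) by (rule le_less_trans)
    qed
  qed
  then have "scaled_sup_limit u R = (INF \<sigma>\<in>{0<..}. h \<sigma>)"
    unfolding scaled_sup_limit_def h_def by (intro tendsto_Lim) auto
  with assms obtain \<sigma> where \<sigma>: "0 < \<sigma>" "h \<sigma> < ereal \<epsilon>" by (auto simp: INF_less_iff)
  have "cmod (u p) \<le> \<epsilon> * R\<^sup>2" if "p \<in> seg_disc \<sigma> R" for p
  proof -
    have "ereal (1 / R\<^sup>2) * ereal (cmod (u p)) \<le> h \<sigma>"
      unfolding h_def using that by (intro ereal_mult_left_mono SUP_upper) auto
    also have "\<dots> \<le> ereal \<epsilon>" using \<sigma> by simp
    finally show ?thesis using \<open>R > 0\<close> by (simp add: field_simps)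
  qed
  with \<sigma>(1) show ?thesis by blast
qed

theorem theorem2p10:
  fixes F :: "complex \<times> complex \<times> complex \<times> complex \<Rightarrow> complex"
    and \<Delta> :: "(complex \<times> complex \<times> complex \<times> complex) set"
    and u :: "complex \<times> complex \<Rightarrow> complex"
    and W :: "(complex \<times> complex) set"
    and \<sigma>\<^sub>0 R\<^sub>0 :: real
  assumes "(0, 0, 0, 0) \<in> \<Delta>"
    and "F holomorphic4_on \<Delta>"
    and "\<And>x. (0, x, 0, 0) \<in> \<Delta> \<Longrightarrow> F (0, x, 0, 0) = 0"
    and "\<And>x. (0, x, 0, 0) \<in> \<Delta> \<Longrightarrow> dF_dv F (0, x, 0, 0) = 0"
    and "Re (dF_du F (0, 0, 0, 0)) < 0"
    and "\<sigma>\<^sub>0 > 0" and "R\<^sub>0 > 0"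
    and "seg_disc \<sigma>\<^sub>0 R\<^sub>0 \<subseteq> W"
    and "holomorphic_solution \<Delta> F W u"
    and "Limsup (at_right 0) (scaled_sup_limit u) = 0"
  shows "continues_to_origin W u"
proof -
  obtain a lam \<rho> K c where "briot_bouquet_estimates F \<Delta> a lam \<rho> K c"
    using briot_bouquet_estimates_exist[OF assms(1-5)] by blast
  then interpret briot_bouquet_estimates F \<Delta> a lam "\<lambda>t x u v. F (t, x, u, v) - a x * t - lam x * u" \<rho> K c
    by simp
  obtain T r C w where T: "0 < T" "0 < r" "r \<le> \<rho>" "0 < C"
    and w: "w holomorphic2_on (ball 0 T \<times> ball 0 r)"
    and wb: "\<And>t x. cmod t < T \<Longrightarrow> cmod x < r \<Longrightarrow> cmod (w (t, x)) \<le> C * cmod t"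
      "\<And>t x. cmod t < T \<Longrightarrow> cmod x < r \<Longrightarrow> cmod (du_dx w (t, x)) \<le> C * cmod t"
    and weq: "\<And>t x. cmod t < T \<Longrightarrow> cmod x < r \<Longrightarrow> t * du_dt w (t, x) = F (t, x, w (t, x), du_dx w (t, x))"
    using holomorphic_solution_exists by metis
  have u: "u holomorphic2_on W" and ueq: "\<And>t x. (t, x) \<in> W \<Longrightarrow> t * du_dt u (t, x) = F (t, x, u (t, x), du_dx u (t, x))"
    using assms(9) by (auto simp: holomorphic_solution_def)
  define V where "V = ball (0 :: complex) T \<times> ball (0 :: complex) r"
  define \<sigma>\<^sub>1 where "\<sigma>\<^sub>1 = min \<sigma>\<^sub>0 T"
  define r\<^sub>1 where "r\<^sub>1 = min R\<^sub>0 r"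
  have sub: "seg_disc \<sigma>\<^sub>1 r\<^sub>1 \<subseteq> V \<inter> W" and seg: "\<And>t x. (t, x) \<in> seg_disc \<sigma>\<^sub>1 r\<^sub>1 \<Longrightarrow> cmod t < T \<and> cmod x < r \<and> (t, x) \<in> W"
  proof -
    have "seg_disc \<sigma>\<^sub>1 r\<^sub>1 \<subseteq> seg_disc \<sigma>\<^sub>0 R\<^sub>0" "seg_disc \<sigma>\<^sub>1 r\<^sub>1 \<subseteq> V"
      by (auto simp: seg_disc_def \<sigma>\<^sub>1_def r\<^sub>1_def V_def)
    with assms(8) show "seg_disc \<sigma>\<^sub>1 r\<^sub>1 \<subseteq> V \<inter> W" by blast
    then show "\<And>t x. (t, x) \<in> seg_disc \<sigma>\<^sub>1 r\<^sub>1 \<Longrightarrow> cmod t < T \<and> cmod x < r \<and> (t, x) \<in> W"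
      by (force simp: V_def)
  qed
  have "open (V \<inter> W)" using holo2_open[OF u] by (auto simp: V_def intro: open_Times)
  note uVW = holo2_subset[OF u this] and wVW = holo2_subset[OF w this]
  \<comment> \<open>The upper limit gives the bound for all sufficiently small radii; a single one
    below \<open>q\<close> is extracted for each \<open>\<epsilon>\<close>.\<close>
  have small: "\<exists>s \<sigma>. 0 < s \<and> s < q \<and> 0 < \<sigma> \<and> (\<forall>p\<in>seg_disc \<sigma> s. cmod (u p) \<le> \<epsilon> * s\<^sup>2)" if "0 < \<epsilon>" "0 < q" for \<epsilon> q :: real
  proof -
    have "\<forall>\<^sub>F R in at_right 0. scaled_sup_limit u R < ereal \<epsilon>"
      using that assms(10) by (intro Limsup_lessD) simp
    moreover have "\<forall>\<^sub>F R in at_right 0. R \<in> {0<..<q}" using that by (intro eventually_at_right_real)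
    ultimately have "\<forall>\<^sub>F R in at_right 0. scaled_sup_limit u R < ereal \<epsilon> \<and> R \<in> {0<..<q}"
      by (rule eventually_conj)
    then obtain s where "scaled_sup_limit u s < ereal \<epsilon>" "0 < s" "s < q"
      using eventually_happens'[OF trivial_limit_at_right_real] by fastforce
    then show ?thesis using scaled_sup_limit_less by blast
  qed
  obtain T' r' where T': "0 < T'" "0 < r'" "T' \<le> \<sigma>\<^sub>1" "r' \<le> r\<^sub>1" and eq: "\<And>p. p \<in> seg_disc T' r' \<Longrightarrow> u p = w p"
  proof (rule solution_unique[of u "V \<inter> W" w \<sigma>\<^sub>1 r\<^sub>1 C])
    show "0 < \<sigma>\<^sub>1" "0 < r\<^sub>1" "r\<^sub>1 \<le> \<rho>" using assms(6,7) T by (auto simp: \<sigma>\<^sub>1_def r\<^sub>1_def)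
  qed (use uVW wVW sub seg T wb weq ueq small in \<open>auto simp: V_def\<close>)
  have "seg_disc T' r' \<subseteq> V \<inter> W"
    using sub T' by (force simp: seg_disc_def)
  moreover have "(0, 0) \<in> V" using T by (simp add: V_def)
  ultimately show ?thesis
    unfolding continues_to_origin_def
    using w[folded V_def] T'(1,2) eq by metis
qed

end
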